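(* The following statements are pairwise equivalent over $\mathrm{RCA}_0$: 1. $\mathrm{ACA}_0$. 2. For each image-finite frame $F=(W,R)$ and each $v:W\times\mathrm{Prop}\to\{0,1\}$ there exists a valuation $V$ on $(W,R)$ such that $V$ is an extension of $v$. 3. For each image-finite frame $F=(W,R)$ and all $i,j,m,n\in\mathbb{N}$ such that neither $i=n=0$ nor $m=j=0$, the following are equivalent: (a) $\forall x,y,z\in W\,\bigl((x\rightsquigarrow^{i}y)\land(x\rightsquigarrow^{j}z)\rightarrow\exists u\in W((y\rightsquigarrow^{m}u)\land(z\rightsquigarrow^{n}u))\bigr)$; (b) $F\Vdash \Diamond^{i}\Box^{m}\varphi\rightarrow\Box^{j}\Diamond^{n}\varphi$ for all $\varphi\in\mathrm{Fml}$. 4. For each image-finite frame $F=(W,R)$ the following are equivalent: (a) $R$ is transitive and $W$ has no infinite ascending sequence by $R$; (b) $F\Vdash\Box(\Box\varphi\rightarrow\varphi)\rightarrow\Box\varphi$ for all $\varphi\in\mathrm{Fml}$. 5. For each image-finite frame $F=(W,R)$ there exists a valuation $V$ on $(W,R)$.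
   Context: Setting: second-order arithmetic. $\mathrm{RCA}_0$ consists of Robinson arithmetic, $\Sigma^0_1$-induction and $\Delta^0_1$-comprehension; $\mathrm{ACA}_0$ adds arithmetical comprehension. $\mathbb{N}$ denotes the first-order part of the model under consideration. $\mathrm{Prop}$ is an infinite set of propositional variables; $\mathrm{Fml}$ is the set of modal formulas built from $\mathrm{Prop}\cup\{\bot\}$ using $\rightarrow$ and $\Box$, coded as a set of natural numbers. $\neg\varphi$ is $\varphi\to\bot$, and $\Diamond\varphi$ abbreviates $\neg\Box\neg\varphi$. $\Box^0\varphi$ is $\varphi$, $\Box^{n+1}\varphi$ is $\Box(\Box^n\varphi)$; similarly for $\Diamond^n\varphi$. A frame is a pair $(W,R)$ with $W\subseteq\mathbb{N}$ non-empty and $R\subseteq W\times W$. It is image-finite if for every $w\in W$ the set $\{u\in W: wRu\}$ is finite. A valuation on $(W,R)$ is a function (a set in the sense of second-order arithmetic) $V:W\times\mathrm{Fml}\to\{0,1\}$ such that for all $w\in W$, $\varphi,\psi\in\mathrm{Fml}$: $V(w,\bot)=0$; $V(w,\varphi\to\psi)=1-V(w,\varphi)(1-V(w,\psi))$; $V(w,\Box\varphi)=1\iff\forall u\in W(wRu\to V(u,\varphi)=1)$. $F\Vdash\varphi$ means that for every valuation $V$ on $F$ and every $w\in W$, $V(w,\varphi)=1$. $u\rightsquigarrow^{n}v$ means that there is a finite sequence $\langle\sigma_0,\dots,\sigma_n\rangle$ of elements of $W$ with $\sigma_0=u$, $\sigma_n=v$ and $\sigma_lR\sigma_{l+1}$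 for all $l<n$ (so $u\rightsquigarrow^0 v$ iff $u=v$). An infinite ascending sequence by $R$ is a function $f:\mathbb{N}\to W$ with $f(i)Rf(i+1)$ for all $i$. *)

theory Defs
  imports Main
begin

text \<open>
  Structures for the language of second-order arithmetic. The type \<open>'a\<close> is the first-order part
  (possibly nonstandard); set variables range over \<open>l2_sets\<close>. Equality is interpreted as equality.
\<close>

record 'a l2 =
  l2_zero :: 'a  (\<open>\<zero>\<index>\<close>)
  l2_one  :: 'a  (\<open>\<one>\<index>\<close>)
  l2_add  :: "'a \<Rightarrow> 'a \<Rightarrow> 'a"  (infixl \<open>\<oplus>\<index>\<close> 65)
  l2_mul  :: "'a \<Rightarrow> 'a \<Rightarrow> 'a"  (infixl \<open>\<otimes>\<index>\<close> 70)
  l2_less :: "'a \<Rightarrow> 'a \<Rightarrow> bool"  (infix \<open>\<prec>\<index>\<close> 50)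
  l2_sets :: "'a set set"

text \<open>
  Arithmetical formulas, i.e. formulas without set quantifiers; no others occur in the axiom schemes
  below. Number variables are de Bruijn indices, set variables (always parameters) are plain
  indices. Bounded quantifiers are primitive; their bounding term lies outside the scope
  of the bound variable.
\<close>

datatype tm = Var nat | Zero | One | Add tm tm | Mul tm tm

datatype fm =
    Eq tm tm | Less tm tm | Mem tm nat
  | Neg fm | Conj fm fm
  | BAll tm fm | BEx tm fm
  | All fm | Ex fm

primrec eval :: "'a l2 \<Rightarrow> (nat \<Rightarrow> 'a) \<Rightarrow> tm \<Rightarrow> 'a" where
  "eval M e (Var k) = e k"
| "eval M e Zero = \<zero>\<^bsub>M\<^esub>"
| "eval M e One = \<one>\<^bsub>M\<^esub>"
| "eval M e (Add s t) = eval M e s \<oplus>\<^bsub>M\<^esub> eval M e t"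
| "eval M e (Mul s t) = eval M e s \<otimes>\<^bsub>M\<^esub> eval M e t"

primrec sat :: "'a l2 \<Rightarrow> (nat \<Rightarrow> 'a set) \<Rightarrow> (nat \<Rightarrow> 'a) \<Rightarrow> fm \<Rightarrow> bool" where
  "sat M E e (Eq s t) \<longleftrightarrow> eval M e s = eval M e t"
| "sat M E e (Less s t) \<longleftrightarrow> eval M e s \<prec>\<^bsub>M\<^esub> eval M e t"
| "sat M E e (Mem t k) \<longleftrightarrow> eval M e t \<in> E k"
| "sat M E e (Neg \<phi>) \<longleftrightarrow> \<not> sat M E e \<phi>"
| "sat M E e (Conj \<phi> \<psi>) \<longleftrightarrow> sat M E e \<phi> \<and> sat M E e \<psi>"
| "sat M E e (BAll t \<phi>) \<longleftrightarrow> (\<forall>x. x \<prec>\<^bsub>M\<^esub> eval M e t \<longrightarrow> sat M E (case_nat x e) \<phi>)"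
| "sat M E e (BEx t \<phi>) \<longleftrightarrow> (\<exists>x. x \<prec>\<^bsub>M\<^esub> eval M e t \<and> sat M E (case_nat x e) \<phi>)"
| "sat M E e (All \<phi>) \<longleftrightarrow> (\<forall>x. sat M E (case_nat x e) \<phi>)"
| "sat M E e (Ex \<phi>) \<longleftrightarrow> (\<exists>x. sat M E (case_nat x e) \<phi>)"

primrec bounded_fm :: "fm \<Rightarrow> bool" where
  "bounded_fm (Eq s t) \<longleftrightarrow> True"
| "bounded_fm (Less s t) \<longleftrightarrow> True"
| "bounded_fm (Mem t k) \<longleftrightarrow> True"
| "bounded_fm (Neg \<phi>) \<longleftrightarrow> bounded_fm \<phi>"
| "bounded_fm (Conj \<phi> \<psi>) \<longleftrightarrow> bounded_fm \<phi> \<and> bounded_fm \<psi>"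
| "bounded_fm (BAll t \<phi>) \<longleftrightarrow> bounded_fm \<phi>"
| "bounded_fm (BEx t \<phi>) \<longleftrightarrow> bounded_fm \<phi>"
| "bounded_fm (All \<phi>) \<longleftrightarrow> False"
| "bounded_fm (Ex \<phi>) \<longleftrightarrow> False"

definition sigma01 :: "fm \<Rightarrow> bool" where
  "sigma01 \<phi> \<longleftrightarrow> (\<exists>\<theta>. bounded_fm \<theta> \<and> \<phi> = Ex \<theta>)"

definition pi01 :: "fm \<Rightarrow> bool" where
  "pi01 \<phi> \<longleftrightarrow> (\<exists>\<theta>. bounded_fm \<theta> \<and> \<phi> = All \<theta>)"

context
  fixes M :: "'a l2" (structure)
begin

definition robinson :: bool where
  "robinson \<longleftrightarrow>
    (\<forall>x. x \<oplus> \<one> \<noteq> \<zero>) \<and>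
    (\<forall>x y. x \<oplus> \<one> = y \<oplus> \<one> \<longrightarrow> x = y) \<and>
    (\<forall>x. x = \<zero> \<or> (\<exists>y. x = y \<oplus> \<one>)) \<and>
    (\<forall>x. x \<oplus> \<zero> = x) \<and>
    (\<forall>x y. x \<oplus> (y \<oplus> \<one>) = (x \<oplus> y) \<oplus> \<one>) \<and>
    (\<forall>x. x \<otimes> \<zero> = \<zero>) \<and>
    (\<forall>x y. x \<otimes> (y \<oplus> \<one>) = x \<otimes> y \<oplus> x) \<and>
    (\<forall>x y. x \<prec> y \<longleftrightarrow> (\<exists>z. x \<oplus> (z \<oplus> \<one>) = y))"

text \<open>In the schemes the distinguished variable of a formula is \<open>Var 0\<close>; all others are parameters.\<close>

definition sigma01_induction :: bool where
  "sigma01_induction \<longleftrightarrow>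
    (\<forall>\<phi> E e. sigma01 \<phi> \<and> range E \<subseteq> l2_sets M \<longrightarrow>
      sat M E (case_nat \<zero> e) \<phi> \<longrightarrow>
      (\<forall>x. sat M E (case_nat x e) \<phi> \<longrightarrow> sat M E (case_nat (x \<oplus> \<one>) e) \<phi>) \<longrightarrow>
      (\<forall>x. sat M E (case_nat x e) \<phi>))"

definition delta01_comprehension :: bool where
  "delta01_comprehension \<longleftrightarrow>
    (\<forall>\<phi> \<psi> E e. sigma01 \<phi> \<and> pi01 \<psi> \<and> range E \<subseteq> l2_sets M \<longrightarrow>
      (\<forall>x. sat M E (case_nat x e) \<phi> \<longleftrightarrow> sat M E (case_nat x e) \<psi>) \<longrightarrow>
      {x. sat M E (case_nat x e) \<phi>} \<in> l2_sets M)"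

definition arithmetical_comprehension :: bool where
  "arithmetical_comprehension \<longleftrightarrow>
    (\<forall>\<phi> E e. range E \<subseteq> l2_sets M \<longrightarrow> {x. sat M E (case_nat x e) \<phi>} \<in> l2_sets M)"

text \<open>As usual in many-sorted logic, the sort of sets is non-empty.\<close>

definition RCA0 :: bool where
  "RCA0 \<longleftrightarrow> l2_sets M \<noteq> {} \<and> robinson \<and> sigma01_induction \<and> delta01_comprehension"

definition ACA0 :: bool where
  "ACA0 \<longleftrightarrow> RCA0 \<and> arithmetical_comprehension"

definition pair :: "'a \<Rightarrow> 'a \<Rightarrow> 'a" where
  "pair x y = (x \<oplus> y) \<otimes> (x \<oplus> y) \<oplus> x"

definition cross :: "'a set \<Rightarrow> 'a set \<Rightarrow> 'a set" where
  "cross X Y = {pair x y |x y. x \<in> X \<and> y \<in> Y}"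

text \<open>Functions \<open>X \<rightarrow> Y\<close> are elements of the second-order part; \<open>X\<close> and \<open>Y\<close> may be any classes.\<close>

definition is_function :: "'a set \<Rightarrow> 'a set \<Rightarrow> 'a set \<Rightarrow> bool" where
  "is_function X Y f \<longleftrightarrow>
    f \<in> l2_sets M \<and> f \<subseteq> cross X Y \<and> (\<forall>x\<in>X. \<exists>!y. pair x y \<in> f)"

definition app :: "'a set \<Rightarrow> 'a \<Rightarrow> 'a" where
  "app f x = (THE y. pair x y \<in> f)"

text \<open>
  Finite sequences are coded by pairs \<open>a\<close>, \<open>b\<close> through Goedel's beta function: the entry at position
  \<open>i\<close> is the remainder of \<open>a\<close> modulo \<open>(i + 1) b + 1\<close>. The length is given separately, and it may be
  a nonstandard element of the model.
\<close>

definition beta :: "'a \<Rightarrow> 'a \<Rightarrow> 'a \<Rightarrow> 'a" where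
  "beta a b i =
    (THE r. r \<prec> (i \<oplus> \<one>) \<otimes> b \<oplus> \<one> \<and> (\<exists>q. a = q \<otimes> ((i \<oplus> \<one>) \<otimes> b \<oplus> \<one>) \<oplus> r))"

text \<open>There is a sequence of elements of \<open>X\<close> of length \<open>n + 1\<close> from \<open>u\<close> to \<open>v\<close> whose consecutive
  entries are related by \<open>Q\<close>.\<close>

definition chain :: "'a set \<Rightarrow> ('a \<Rightarrow> 'a \<Rightarrow> bool) \<Rightarrow> 'a \<Rightarrow> 'a \<Rightarrow> 'a \<Rightarrow> bool" where
  "chain X Q n u v \<longleftrightarrow>
    (\<exists>a b. (\<forall>l. l \<prec> n \<or> l = n \<longrightarrow> beta a b l \<in> X) \<and>
      beta a b \<zero> = u \<and> beta a b n = v \<and>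
      (\<forall>l. l \<prec> n \<longrightarrow> Q (beta a b l) (beta a b (l \<oplus> \<one>))))"

text \<open>
  Coding of modal formulas. The codes \<open>0\<close>, \<open>3 (a, b) + 1\<close> and \<open>3 a + 2\<close> are those of falsum, of
  implications and of boxed formulas. All remaining numbers, among them every \<open>3 k + 3\<close>, serve
  as propositional variables. So every number codes exactly one formula, and the immediate
  subformulas of a formula have smaller codes.
\<close>

definition fbot :: 'a where
  "fbot = \<zero>"

definition fimp :: "'a \<Rightarrow> 'a \<Rightarrow> 'a" where
  "fimp \<phi> \<psi> = pair \<phi> \<psi> \<oplus> pair \<phi> \<psi> \<oplus> pair \<phi> \<psi> \<oplus> \<one>"

definition fbox :: "'a \<Rightarrow> 'a" where
  "fbox \<phi> = \<phi> \<oplus> \<phi> \<oplus> \<phi> \<oplus> \<one> \<oplus> \<one>"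

definition Prop :: "'a set" where
  "Prop = {p. p \<noteq> fbot \<and> (\<forall>\<phi> \<psi>. p \<noteq> fimp \<phi> \<psi>) \<and> (\<forall>\<phi>. p \<noteq> fbox \<phi>)}"

definition Fml :: "'a set" where
  "Fml = UNIV"

definition fneg :: "'a \<Rightarrow> 'a" where
  "fneg \<phi> = fimp \<phi> fbot"

definition fdia :: "'a \<Rightarrow> 'a" where
  "fdia \<phi> = fneg (fbox (fneg \<phi>))"

text \<open>The exponents below are elements of the model, so iteration is internal recursion.\<close>

definition fbox_pow :: "'a \<Rightarrow> 'a \<Rightarrow> 'a" where
  "fbox_pow n \<phi> = (THE \<psi>. chain Fml (\<lambda>x y. y = fbox x) n \<phi> \<psi>)"

definition fdia_pow :: "'a \<Rightarrow> 'a \<Rightarrow> 'a" where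
  "fdia_pow n \<phi> = (THE \<psi>. chain Fml (\<lambda>x y. y = fdia x) n \<phi> \<psi>)"

definition frame :: "'a set \<Rightarrow> 'a set \<Rightarrow> bool" where
  "frame W R \<longleftrightarrow> W \<in> l2_sets M \<and> R \<in> l2_sets M \<and> W \<noteq> {} \<and> R \<subseteq> cross W W"

definition rel :: "'a set \<Rightarrow> 'a \<Rightarrow> 'a \<Rightarrow> bool" where
  "rel R x y \<longleftrightarrow> pair x y \<in> R"

text \<open>A set is finite in the sense of the model if it is bounded.\<close>

definition image_finite :: "'a set \<Rightarrow> 'a set \<Rightarrow> bool" where
  "image_finite W R \<longleftrightarrow> (\<forall>w\<in>W. \<exists>b. \<forall>u\<in>W. rel R w u \<longrightarrow> u \<prec> b)"

definition reach :: "'a set \<Rightarrow> 'a set \<Rightarrow> 'a \<Rightarrow> 'a \<Rightarrow> 'a \<Rightarrow> bool" where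
  "reach W R n u v \<longleftrightarrow> chain W (rel R) n u v"

text \<open>Only used for \<open>y\<close> at most \<open>x\<close>.\<close>

definition diff :: "'a \<Rightarrow> 'a \<Rightarrow> 'a" where
  "diff x y = (THE z. z \<oplus> y = x)"

definition val :: "'a set \<Rightarrow> 'a \<Rightarrow> 'a \<Rightarrow> 'a" where
  "val V w \<phi> = app V (pair w \<phi>)"

definition valuation :: "'a set \<Rightarrow> 'a set \<Rightarrow> 'a set \<Rightarrow> bool" where
  "valuation W R V \<longleftrightarrow>
    is_function (cross W Fml) {\<zero>, \<one>} V \<and>
    (\<forall>w\<in>W. \<forall>\<phi>\<in>Fml. \<forall>\<psi>\<in>Fml.
      val V w fbot = \<zero> \<and>
      val V w (fimp \<phi> \<psi>) = diff \<one> (val V w \<phi> \<otimes> diff \<one> (val V w \<psi>)) \<and>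
      (val V w (fbox \<phi>) = \<one> \<longleftrightarrow> (\<forall>u\<in>W. rel R w u \<longrightarrow> val V u \<phi> = \<one>)))"

definition forces :: "'a set \<Rightarrow> 'a set \<Rightarrow> 'a \<Rightarrow> bool" where
  "forces W R \<phi> \<longleftrightarrow> (\<forall>V. valuation W R V \<longrightarrow> (\<forall>w\<in>W. val V w \<phi> = \<one>))"

definition transitive :: "'a set \<Rightarrow> 'a set \<Rightarrow> bool" where
  "transitive W R \<longleftrightarrow>
    (\<forall>x\<in>W. \<forall>y\<in>W. \<forall>z\<in>W. rel R x y \<longrightarrow> rel R y z \<longrightarrow> rel R x z)"

definition ascending_sequence :: "'a set \<Rightarrow> 'a set \<Rightarrow> 'a set \<Rightarrow> bool" where
  "ascending_sequence W R f \<longleftrightarrow>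
    is_function UNIV W f \<and> (\<forall>i. rel R (app f i) (app f (i \<oplus> \<one>)))"

end

end

theory Submission imports Defs begin

text \<open>
  Each of the statements 2 to 5 yields a valuation on one particular image-finite frame. For a bounded
  relation \<open>P\<close> let the world \<open>x + 3\<close> see exactly the least witness \<open>y\<close> with \<open>P y x\<close>, if there is one;
  a valuation, evaluated at \<open>\<box>\<bottom>\<close>, then decides \<open>\<exists>y. P y x\<close>. Three further worlds make the frame
  neither transitive nor serial, so that (a) fails in statement 4, and in statement 3 for
  \<open>i = j = 0\<close>, \<open>m = n = 1\<close>; hence (b) fails as well, and its failure is witnessed by a valuation.
  Closure of the sets under projection already gives \<open>ACA0\<close>.

  In \<open>ACA0\<close> the values of a valuation extending \<open>v\<close> are read off from finite tables that are
  correct wherever they are defined and whose domains are closed under passing to the subformulas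
  and successors that matter. Two tables agree where both are defined, and since every world has
  a bounded set of successors, induction on \<open>\<phi>\<close> yields a table for each world and \<open>\<phi>\<close>.
\<close>

section \<open>Definability by bounded formulas\<close>

text \<open>The axiom schemes range over syntax, so each use of induction or comprehension must show
  that a mathematical predicate fits a scheme. \<open>definable\<close> is a semantic notion closed
  under connectives and bounded quantifiers, which turns this task into backward chaining with
  introduction rules. Over RCA0 bounded formulas are enough for the arithmetic, for least witnesses
  and for the reversal. Over ACA0 the notion is kept: a projected set is itself a set and hence an
  admissible parameter, so a quantified predicate again has a bounded definition, and the same two
  lemmas then give full arithmetical induction and comprehension. The first-order part may be
  nonstandard, so no induction of HOL reaches its numbers; every recursion, including the Chinese
  remainder construction behind sequence codes, runs inside the model. In the frame of the reversal
  the least witness serves two ends: minimality is a bounded condition, and it leaves one successor,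
  whereas a world that saw all witnesses could have unboundedly many.\<close>

primrec tm_subst :: "(nat \<Rightarrow> tm) \<Rightarrow> tm \<Rightarrow> tm" where
  "tm_subst s (Var k) = s k"
| "tm_subst s Zero = Zero"
| "tm_subst s One = One"
| "tm_subst s (Add t u) = Add (tm_subst s t) (tm_subst s u)"
| "tm_subst s (Mul t u) = Mul (tm_subst s t) (tm_subst s u)"

definition lift_subst :: "(nat \<Rightarrow> tm) \<Rightarrow> nat \<Rightarrow> tm" where
  "lift_subst s = case_nat (Var 0) (\<lambda>n. tm_subst (\<lambda>k. Var (Suc k)) (s n))"

text \<open>\<open>r\<close> renames set variables, which are never bound; \<open>s\<close>
  substitutes terms and is shifted past each binder. Bounding terms take the unshifted
  \<open>s\<close> because they lie outside the scope of the binder.\<close>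

primrec fm_subst :: "(nat \<Rightarrow> nat) \<Rightarrow> (nat \<Rightarrow> tm) \<Rightarrow> fm \<Rightarrow> fm" where
  "fm_subst r s (Eq t u) = Eq (tm_subst s t) (tm_subst s u)"
| "fm_subst r s (Less t u) = Less (tm_subst s t) (tm_subst s u)"
| "fm_subst r s (Mem t k) = Mem (tm_subst s t) (r k)"
| "fm_subst r s (Neg \<phi>) = Neg (fm_subst r s \<phi>)"
| "fm_subst r s (Conj \<phi> \<psi>) = Conj (fm_subst r s \<phi>) (fm_subst r s \<psi>)"
| "fm_subst r s (BAll t \<phi>) = BAll (tm_subst s t) (fm_subst r (lift_subst s) \<phi>)"
| "fm_subst r s (BEx t \<phi>) = BEx (tm_subst s t) (fm_subst r (lift_subst s) \<phi>)"
| "fm_subst r s (All \<phi>) = All (fm_subst r (lift_subst s) \<phi>)"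
| "fm_subst r s (Ex \<phi>) = Ex (fm_subst r (lift_subst s) \<phi>)"

lemma eval_tm_subst: "eval M e (tm_subst s t) = eval M (\<lambda>n. eval M e (s n)) t"
  by (induction t) auto

lemma eval_lift_subst:
  "(\<lambda>n. eval M (case_nat x e) (lift_subst s n)) = case_nat x (\<lambda>n. eval M e (s n))"
  by (rule ext) (auto simp: lift_subst_def eval_tm_subst split: nat.split)

lemma sat_fm_subst:
  "sat M E e (fm_subst r s \<phi>) \<longleftrightarrow> sat M (\<lambda>n. E (r n)) (\<lambda>n. eval M e (s n)) \<phi>"
  by (induction \<phi> arbitrary: e s) (auto simp: eval_tm_subst eval_lift_subst)

lemma bounded_fm_subst [simp]: "bounded_fm (fm_subst r s \<phi>) = bounded_fm \<phi>"
  by (induction \<phi> arbitrary: s) auto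

lemma eval_finite_support: "\<exists>k. \<forall>e e'. (\<forall>i<k. e i = e' i) \<longrightarrow> eval M e t = eval M e' t"
proof (induction t)
  case (Var n)
  show ?case by (rule exI [of _ "Suc n"]) simp
next
  case (Add t u)
  then obtain k l where "\<forall>e e'. (\<forall>i<k. e i = e' i) \<longrightarrow> eval M e t = eval M e' t"
    "\<forall>e e'. (\<forall>i<l. e i = e' i) \<longrightarrow> eval M e u = eval M e' u" by blast
  then show ?case by (intro exI [of _ "max k l"]) (metis eval.simps(4) max_less_iff_conj less_max_iff_disj)
next
  case (Mul t u)
  then obtain k l where "\<forall>e e'. (\<forall>i<k. e i = e' i) \<longrightarrow> eval M e t = eval M e' t"
    "\<forall>e e'. (\<forall>i<l. e i = e' i) \<longrightarrow> eval M e u = eval M e' u" by blast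
  then show ?case by (intro exI [of _ "max k l"]) (metis eval.simps(5) max_less_iff_conj less_max_iff_disj)
qed auto

text \<open>Needed for unbounded quantifiers later: there variables are merged by pairing, in an
  induction on the number of relevant ones.\<close>

lemma sat_finite_support:
  "\<exists>k. \<forall>e e'. (\<forall>i<k. e i = e' i) \<longrightarrow> sat M E e \<phi> = sat M E e' \<phi>"
proof (induction \<phi>)
  case (Eq t u)
  obtain k l where "\<forall>e e'. (\<forall>i<k. e i = e' i) \<longrightarrow> eval M e t = eval M e' t"
    "\<forall>e e'. (\<forall>i<l. e i = e' i) \<longrightarrow> eval M e u = eval M e' u" using eval_finite_support by metis
  then show ?case by (intro exI [of _ "max k l"]) (metis sat.simps(1) less_max_iff_disj)
next
  case (Less t u)
  obtain k l where "\<forall>e e'. (\<forall>i<k. e i = e' i) \<longrightarrow> eval M e t = eval M e' t"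
    "\<forall>e e'. (\<forall>i<l. e i = e' i) \<longrightarrow> eval M e u = eval M e' u" using eval_finite_support by metis
  then show ?case by (intro exI [of _ "max k l"]) (metis sat.simps(2) less_max_iff_disj)
next
  case (Mem t n)
  show ?case using eval_finite_support [of M t] by (metis sat.simps(3))
next
  case (Neg \<phi>)
  then show ?case by simp
next
  case (Conj \<phi> \<psi>)
  then obtain k l where "\<forall>e e'. (\<forall>i<k. e i = e' i) \<longrightarrow> sat M E e \<phi> = sat M E e' \<phi>"
    "\<forall>e e'. (\<forall>i<l. e i = e' i) \<longrightarrow> sat M E e \<psi> = sat M E e' \<psi>" by blast
  then show ?case by (intro exI [of _ "max k l"]) (metis sat.simps(5) less_max_iff_disj)
next
  case (BAll t \<phi>)
  obtain l where l: "\<forall>e e'. (\<forall>i<l. e i = e' i) \<longrightarrow> eval M e t = eval M e' t"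
    using eval_finite_support by metis
  from BAll obtain k where k: "\<forall>e e'. (\<forall>i<k. e i = e' i) \<longrightarrow> sat M E e \<phi> = sat M E e' \<phi>" by blast
  have "sat M E (case_nat x e) \<phi> = sat M E (case_nat x e') \<phi>" if "\<forall>i<max k l. e i = e' i" for x e e'
    by (rule k [rule_format]) (use that in \<open>auto split: nat.split\<close>)
  moreover have "eval M e t = eval M e' t" if "\<forall>i<max k l. e i = e' i" for e e'
    by (rule l [rule_format]) (use that in auto)
  ultimately show ?case by (intro exI [of _ "max k l"]) (simp, metis)
next
  case (BEx t \<phi>)
  obtain l where l: "\<forall>e e'. (\<forall>i<l. e i = e' i) \<longrightarrow> eval M e t = eval M e' t"
    using eval_finite_support by metis
  from BEx obtain k where k: "\<forall>e e'. (\<forall>i<k. e i = e' i) \<longrightarrow> sat M E e \<phi> = sat M E e' \<phi>" by blast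
  have "sat M E (case_nat x e) \<phi> = sat M E (case_nat x e') \<phi>" if "\<forall>i<max k l. e i = e' i" for x e e'
    by (rule k [rule_format]) (use that in \<open>auto split: nat.split\<close>)
  moreover have "eval M e t = eval M e' t" if "\<forall>i<max k l. e i = e' i" for e e'
    by (rule l [rule_format]) (use that in auto)
  ultimately show ?case by (intro exI [of _ "max k l"]) (simp, metis)
next
  case (All \<phi>)
  then obtain k where k: "\<forall>e e'. (\<forall>i<k. e i = e' i) \<longrightarrow> sat M E e \<phi> = sat M E e' \<phi>" by blast
  have "sat M E (case_nat x e) \<phi> = sat M E (case_nat x e') \<phi>" if "\<forall>i<k. e i = e' i" for x e e'
    by (rule k [rule_format]) (use that in \<open>auto split: nat.split\<close>)
  then show ?case by (intro exI [of _ k]) (simp, metis)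
next
  case (Ex \<phi>)
  then obtain k where k: "\<forall>e e'. (\<forall>i<k. e i = e' i) \<longrightarrow> sat M E e \<phi> = sat M E e' \<phi>" by blast
  have "sat M E (case_nat x e) \<phi> = sat M E (case_nat x e') \<phi>" if "\<forall>i<k. e i = e' i" for x e e'
    by (rule k [rule_format]) (use that in \<open>auto split: nat.split\<close>)
  then show ?case by (intro exI [of _ k]) (simp, metis)
qed

text \<open>Interleaving leaves infinitely many slots both for variables and for parameters, so
  formulas can be combined without counting their variables.\<close>

definition mix :: "(nat \<Rightarrow> 'b) \<Rightarrow> (nat \<Rightarrow> 'b) \<Rightarrow> nat \<Rightarrow> 'b" where
  "mix e p n = (if even n then e (n div 2) else p (n div 2))"

text \<open>In \<open>mix e (mix p q)\<close> the entry \<open>p k\<close> sits at index 4k+1 and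
  \<open>q k\<close> at index 4k+3. This map and \<open>mix_right\<close> send index 2k+1 to these
  places and fix the even indices.\<close>

definition mix_left :: "nat \<Rightarrow> nat" where
  "mix_left m = (if even m then m else 2 * m - 1)"

definition mix_right :: "nat \<Rightarrow> nat" where
  "mix_right m = (if even m then m else 2 * m + 1)"

lemma mix_mix_left: "(\<lambda>n. mix e (mix p q) (mix_left n)) = mix e p"
  by (rule ext) (auto simp: mix_def mix_left_def double_not_eq_Suc_double elim!: oddE)

lemma mix_mix_right: "(\<lambda>n. mix e (mix p q) (mix_right n)) = mix e q"
  by (rule ext) (auto simp: mix_def mix_right_def double_not_eq_Suc_double elim!: oddE)

text \<open>A binder pushes its value to index 0 and moves all other indices up by one, which swaps
  the parities of variables and parameters. The renaming swaps them back.\<close>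

lemma mix_case_nat:
  "(\<lambda>n. case_nat x (mix e p) (if n = 0 then 0 else if even n then n - 1 else Suc n)) = mix (case_nat x e) p"
proof
  fix n show "case_nat x (mix e p) (if n = 0 then 0 else if even n then n - 1 else Suc n) = mix (case_nat x e) p n"
    by (cases "n = 0"; cases "even n") (auto simp: mix_def double_not_eq_Suc_double elim!: oddE evenE split: nat.split)
qed

lemma mix_even [simp]: "mix E F (2 * n) = E n"
  and mix_odd [simp]: "mix E F (Suc (2 * n)) = F n"
  by (auto simp: mix_def)

lemma range_mix: "range E \<subseteq> S \<Longrightarrow> range F \<subseteq> S \<Longrightarrow> range (mix E F) \<subseteq> S"
  by (auto simp: mix_def)

lemma fm_rename:
  assumes "bounded_fm \<phi>"
  obtains \<psi> where "bounded_fm \<psi>"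
    "\<And>E e. sat M E e \<psi> \<longleftrightarrow> sat M (\<lambda>n. E (r n)) (\<lambda>n. e (h n)) \<phi>"
proof
  show "bounded_fm (fm_subst r (\<lambda>n. Var (h n)) \<phi>)" using assms by simp
qed (simp add: sat_fm_subst)

lemma tm_rename: obtains t' where "\<And>e. eval M e t' = eval M (\<lambda>n. e (h n)) t"
proof
  show "eval M e (tm_subst (\<lambda>n. Var (h n)) t) = eval M (\<lambda>n. e (h n)) t" for e
    by (simp add: eval_tm_subst)
qed

locale rca =
  fixes M :: "'a l2" (structure)
  assumes RCA0: "RCA0 M"
begin

section \<open>Closure properties of definability\<close>

abbreviation "sets \<equiv> l2_sets M"

text \<open>Definability is a property of predicates on environments, with variable \<open>k\<close> read as \<open>e k\<close>. The
  even variables of the defining formula are those of \<open>e\<close>, the odd ones hold number parameters.\<close>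

definition definable_tm :: "((nat \<Rightarrow> 'a) \<Rightarrow> 'a) \<Rightarrow> bool" where
  "definable_tm t \<longleftrightarrow> (\<exists>s p. \<forall>e. t e = eval M (mix e p) s)"

definition definable :: "((nat \<Rightarrow> 'a) \<Rightarrow> bool) \<Rightarrow> bool" where
  "definable P \<longleftrightarrow> (\<exists>\<phi> E p. bounded_fm \<phi> \<and> range E \<subseteq> sets \<and> (\<forall>e. P e \<longleftrightarrow> sat M E (mix e p) \<phi>))"

lemma ex_set: "\<exists>X. X \<in> sets"
  using RCA0 by (auto simp: RCA0_def)

lemma definableI:
  assumes "bounded_fm \<phi>" "range E \<subseteq> sets" "\<And>e. P e \<longleftrightarrow> sat M E (mix e p) \<phi>"
  shows "definable P"
  using assms unfolding definable_def by blast

lemma definable_tm_var: "definable_tm (\<lambda>e. e k)"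
  unfolding definable_tm_def by (rule exI [of _ "Var (2 * k)"]) simp

lemma definable_tm_const: "definable_tm (\<lambda>e. c)"
  unfolding definable_tm_def by (rule exI [of _ "Var (Suc (2 * 0))"], rule exI [of _ "\<lambda>_. c"]) (simp add: mix_def)

lemma definable_tm_common:
  assumes "definable_tm t" "definable_tm u"
  obtains s s' p where "\<And>e. t e = eval M (mix e p) s" "\<And>e. u e = eval M (mix e p) s'"
proof -
  obtain s p where s: "\<And>e. t e = eval M (mix e p) s" using assms(1) by (auto simp: definable_tm_def)
  obtain s' p' where s': "\<And>e. u e = eval M (mix e p') s'" using assms(2) by (auto simp: definable_tm_def)
  obtain r where r: "\<And>e. eval M e r = eval M (\<lambda>n. e (mix_left n)) s" using tm_rename by metis
  obtain r' where r': "\<And>e. eval M e r' = eval M (\<lambda>n. e (mix_right n)) s'" using tm_rename by metis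
  show ?thesis
  proof
    show "t e = eval M (mix e (mix p p')) r" "u e = eval M (mix e (mix p p')) r'" for e
      by (simp_all add: s s' r r' mix_mix_left mix_mix_right)
  qed
qed

lemma definable_tm_add: assumes "definable_tm t" "definable_tm u" shows "definable_tm (\<lambda>e. t e \<oplus> u e)"
proof -
  obtain s s' p where "\<And>e. t e = eval M (mix e p) s" "\<And>e. u e = eval M (mix e p) s'"
    using definable_tm_common [OF assms] by metis
  then show ?thesis unfolding definable_tm_def by (intro exI [of _ "Add s s'"] exI [of _ p]) simp
qed

lemma definable_tm_mul: assumes "definable_tm t" "definable_tm u" shows "definable_tm (\<lambda>e. t e \<otimes> u e)"
proof -
  obtain s s' p where "\<And>e. t e = eval M (mix e p) s" "\<And>e. u e = eval M (mix e p) s'"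
    using definable_tm_common [OF assms] by metis
  then show ?thesis unfolding definable_tm_def by (intro exI [of _ "Mul s s'"] exI [of _ p]) simp
qed

lemma definable_eq: assumes "definable_tm t" "definable_tm u" shows "definable (\<lambda>e. t e = u e)"
proof -
  obtain s s' p where "\<And>e. t e = eval M (mix e p) s" "\<And>e. u e = eval M (mix e p) s'"
    using definable_tm_common [OF assms] by metis
  moreover obtain X where "X \<in> sets" using ex_set ..
  ultimately show ?thesis by (intro definableI [of "Eq s s'" "\<lambda>_. X" _ p]) auto
qed

lemma definable_less: assumes "definable_tm t" "definable_tm u" shows "definable (\<lambda>e. t e \<prec> u e)"
proof -
  obtain s s' p where "\<And>e. t e = eval M (mix e p) s" "\<And>e. u e = eval M (mix e p) s'"
    using definable_tm_common [OF assms] by metis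
  moreover obtain X where "X \<in> sets" using ex_set ..
  ultimately show ?thesis by (intro definableI [of "Less s s'" "\<lambda>_. X" _ p]) auto
qed

lemma definable_mem: assumes "definable_tm t" "X \<in> sets" shows "definable (\<lambda>e. t e \<in> X)"
proof -
  obtain s p where "\<And>e. t e = eval M (mix e p) s" using assms(1) by (auto simp: definable_tm_def)
  then show ?thesis using assms(2) by (intro definableI [of "Mem s 0" "\<lambda>_. X" _ p]) auto
qed

lemma definable_not: assumes "definable P" shows "definable (\<lambda>e. \<not> P e)"
proof -
  obtain \<phi> E p where "bounded_fm \<phi>" "range E \<subseteq> sets" "\<And>e. P e \<longleftrightarrow> sat M E (mix e p) \<phi>"
    using assms unfolding definable_def by blast
  then show ?thesis by (intro definableI [of "Neg \<phi>" E _ p]) auto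
qed

text \<open>The set parameters of the two formulas become the even and the odd entries of one
  sequence, the number parameters are separated by \<open>mix\<close>. Conjunction rests on this,
  and the other binary connectives reduce to conjunction.\<close>

lemma definable_common:
  assumes "definable P" "definable Q"
  obtains \<phi> \<psi> E p where "bounded_fm \<phi>" "bounded_fm \<psi>" "range E \<subseteq> sets"
    "\<And>e. P e \<longleftrightarrow> sat M E (mix e p) \<phi>" "\<And>e. Q e \<longleftrightarrow> sat M E (mix e p) \<psi>"
proof -
  obtain \<phi> E p where P: "bounded_fm \<phi>" "range E \<subseteq> sets" "\<And>e. P e \<longleftrightarrow> sat M E (mix e p) \<phi>"
    using assms(1) unfolding definable_def by blast
  obtain \<psi> F q where Q: "bounded_fm \<psi>" "range F \<subseteq> sets" "\<And>e. Q e \<longleftrightarrow> sat M F (mix e q) \<psi>"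
    using assms(2) unfolding definable_def by blast
  obtain \<phi>' where \<phi>': "bounded_fm \<phi>'"
    "\<And>E e. sat M E e \<phi>' \<longleftrightarrow> sat M (\<lambda>n. E (2 * n)) (\<lambda>n. e (mix_left n)) \<phi>"
    using fm_rename [OF P(1), of M "\<lambda>n. 2 * n" mix_left] by blast
  obtain \<psi>' where \<psi>': "bounded_fm \<psi>'"
    "\<And>E e. sat M E e \<psi>' \<longleftrightarrow> sat M (\<lambda>n. E (Suc (2 * n))) (\<lambda>n. e (mix_right n)) \<psi>"
    using fm_rename [OF Q(1), of M "\<lambda>n. Suc (2 * n)" mix_right] by blast
  show ?thesis
  proof
    show "range (mix E F) \<subseteq> sets" by (rule range_mix [OF P(2) Q(2)])
    show "P e \<longleftrightarrow> sat M (mix E F) (mix e (mix p q)) \<phi>'"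
      "Q e \<longleftrightarrow> sat M (mix E F) (mix e (mix p q)) \<psi>'" for e
      by (simp_all add: P(3) Q(3) \<phi>' \<psi>' mix_mix_left mix_mix_right)
  qed fact+
qed

lemma definable_conj: assumes "definable P" "definable Q" shows "definable (\<lambda>e. P e \<and> Q e)"
proof -
  obtain \<phi> \<psi> E p where "bounded_fm \<phi>" "bounded_fm \<psi>" "range E \<subseteq> sets"
    "\<And>e. P e \<longleftrightarrow> sat M E (mix e p) \<phi>" "\<And>e. Q e \<longleftrightarrow> sat M E (mix e p) \<psi>"
    using definable_common [OF assms] by metis
  then show ?thesis by (intro definableI [of "Conj \<phi> \<psi>" E _ p]) auto
qed

lemma definable_disj: "definable P \<Longrightarrow> definable Q \<Longrightarrow> definable (\<lambda>e. P e \<or> Q e)"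
  by (subst not_not [symmetric], unfold de_Morgan_disj) (intro definable_not definable_conj)

lemma definable_imp: "definable P \<Longrightarrow> definable Q \<Longrightarrow> definable (\<lambda>e. P e \<longrightarrow> Q e)"
  unfolding imp_conv_disj by (intro definable_not definable_disj)

lemma definable_iff: "definable P \<Longrightarrow> definable Q \<Longrightarrow> definable (\<lambda>e. P e \<longleftrightarrow> Q e)"
  unfolding iff_conv_conj_imp by (intro definable_conj definable_imp)

lemma definable_const: "definable (\<lambda>e. b)"
  using definable_eq [OF definable_tm_const definable_tm_const, of "\<zero>" "\<zero>"] definable_not [OF definable_eq [OF definable_tm_const definable_tm_const, of "\<zero>" "\<zero>"]]
  by (cases b) auto

lemma definable_bex_case:
  assumes "definable_tm t" "definable P" shows "definable (\<lambda>e. \<exists>x. x \<prec> t e \<and> P (case_nat x e))"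
proof -
  obtain s p where s: "\<And>e. t e = eval M (mix e p) s" using assms(1) by (auto simp: definable_tm_def)
  obtain \<phi> E q where P: "bounded_fm \<phi>" "range E \<subseteq> sets" "\<And>e. P e \<longleftrightarrow> sat M E (mix e q) \<phi>"
    using assms(2) unfolding definable_def by blast
  obtain s' where s': "\<And>e. eval M e s' = eval M (\<lambda>n. e (mix_left n)) s" using tm_rename by metis
  define h :: "nat \<Rightarrow> nat" where "h n = (if n = 0 then 0 else if even n then n - 1 else Suc n)" for n
  obtain \<phi>' where \<phi>': "bounded_fm \<phi>'"
    "\<And>E e. sat M E e \<phi>' \<longleftrightarrow> sat M (\<lambda>n. E n) (\<lambda>n. e (h (mix_right n))) \<phi>"
    using fm_rename [OF P(1), of M "\<lambda>n. n" "\<lambda>n. h (mix_right n)"] by blast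
  have "(\<lambda>n. case_nat x (mix e (mix p q)) (h (mix_right n))) = mix (case_nat x e) q" for x e
    using mix_case_nat [of x e "mix p q"] mix_mix_right [of "case_nat x e" p q]
    by (simp add: h_def fun_eq_iff)
  then show ?thesis
    by (intro definableI [of "BEx s' \<phi>'" E _ "mix p q"]) (simp_all add: \<phi>' P s s' mix_mix_left)
qed

lemma definable_bex:
  assumes "definable_tm t" "definable (\<lambda>e. P (e 0) (\<lambda>n. e (Suc n)))" shows "definable (\<lambda>e. \<exists>x. x \<prec> t e \<and> P x e)"
  using definable_bex_case [OF assms] by simp

lemma definable_ball:
  assumes "definable_tm t" "definable (\<lambda>e. P (e 0) (\<lambda>n. e (Suc n)))" shows "definable (\<lambda>e. \<forall>x. x \<prec> t e \<longrightarrow> P x e)"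
  using definable_not [OF definable_bex [OF assms(1) definable_not [OF assms(2)]]] by simp

lemma definable_tm_subst: assumes "definable P" shows "definable (\<lambda>e. P (\<lambda>n. eval M e (s n)))"
proof -
  obtain \<phi> E p where P: "bounded_fm \<phi>" "range E \<subseteq> sets" "\<And>e. P e \<longleftrightarrow> sat M E (mix e p) \<phi>"
    using assms unfolding definable_def by blast
  \<comment> \<open>Inside an interleaved environment the proper variables have even indices, hence
    \<open>Var (2 * k)\<close>; the odd indices, which hold parameters, are left alone.\<close>
  define s' where "s' = mix (\<lambda>n. tm_subst (\<lambda>k. Var (2 * k)) (s n)) (\<lambda>n. Var (Suc (2 * n)))"
  have "(\<lambda>n. eval M (mix e p) (s' n)) = mix (\<lambda>n. eval M e (s n)) p" for e
    by (rule ext) (auto simp: s'_def mix_def eval_tm_subst)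
  then show ?thesis
    by (intro definableI [of "fm_subst (\<lambda>n. n) s' \<phi>" E _ p]) (simp_all add: P sat_fm_subst)
qed

lemma definable_rename: "definable P \<Longrightarrow> definable (\<lambda>e. P (\<lambda>n. e (h n)))"
  using definable_tm_subst [of P "\<lambda>n. Var (h n)"] by simp

lemma definable_finite_support:
  assumes "definable P" obtains k where "\<And>e e'. (\<And>i. i < k \<Longrightarrow> e i = e' i) \<Longrightarrow> P e = P e'"
proof -
  obtain \<phi> E p where P: "bounded_fm \<phi>" "range E \<subseteq> sets" "\<And>e. P e \<longleftrightarrow> sat M E (mix e p) \<phi>"
    using assms unfolding definable_def by blast
  obtain k where k: "\<forall>e e'. (\<forall>i<k. e i = e' i) \<longrightarrow> sat M E e \<phi> = sat M E e' \<phi>"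
    using sat_finite_support by metis
  show ?thesis
  proof
    show "P e = P e'" if "\<And>i. i < k \<Longrightarrow> e i = e' i" for e e'
      unfolding P by (rule k [rule_format]) (use that in \<open>auto simp: mix_def\<close>)
  qed
qed

lemmas bounded_intros = definable_tm_var definable_tm_const definable_tm_add definable_tm_mul definable_eq definable_less definable_mem definable_not definable_conj definable_disj definable_imp definable_iff
  definable_bex definable_ball definable_const

text \<open>The schemes single out \<open>Var 0\<close> and treat all other number variables as
  parameters. The predicate reads only the first variable, so the remaining even slots may hold any
  value \<open>x0\<close>.\<close>

lemma definable_shape:
  assumes "definable (\<lambda>e. P (e 0))"
  obtains \<phi> E e where "bounded_fm \<phi>" "range E \<subseteq> sets" "\<And>x. P x \<longleftrightarrow> sat M E (case_nat x e) \<phi>"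
proof -
  obtain \<phi> E p where P: "bounded_fm \<phi>" "range E \<subseteq> sets"
    "\<And>e. P (e 0) \<longleftrightarrow> sat M E (mix e p) \<phi>"
    using assms unfolding definable_def by blast
  obtain \<phi>' where \<phi>': "bounded_fm \<phi>'"
    "\<And>E e. sat M E e \<phi>' \<longleftrightarrow> sat M (\<lambda>n. E n) (\<lambda>n. e (if n = 0 then 0 else if even n then n - 1 else Suc n)) \<phi>"
    using fm_rename [OF P(1), of M "\<lambda>n. n" "\<lambda>n. if n = 0 then 0 else if even n then n - 1 else Suc n"] by metis
  show ?thesis
  proof
    show "P x \<longleftrightarrow> sat M E (case_nat x (mix (\<lambda>_. x0) p)) \<phi>'" for x x0
      using P(3) [of "case_nat x (\<lambda>_. x0)"] mix_case_nat [of x "\<lambda>_. x0" p] by (simp add: \<phi>')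
  qed fact+
qed

text \<open>The scheme wants an outermost unbounded existential quantifier, so the bounded formula
  is shifted by one index and put under a vacuous \<open>Ex\<close>.\<close>

lemma bounded_induct:
  assumes "definable (\<lambda>e. P (e 0))" "P \<zero>" "\<And>x. P x \<Longrightarrow> P (x \<oplus> \<one>)" shows "P x"
proof -
  obtain \<phi> E e where \<phi>: "bounded_fm \<phi>" "range E \<subseteq> sets" "\<And>x. P x \<longleftrightarrow> sat M E (case_nat x e) \<phi>"
    by (rule definable_shape [OF assms(1)]) auto
  obtain \<psi> where \<psi>: "bounded_fm \<psi>"
    "\<And>E e. sat M E e \<psi> \<longleftrightarrow> sat M (\<lambda>n. E n) (\<lambda>n. e (Suc n)) \<phi>"
    using fm_rename [OF \<phi>(1), of M "\<lambda>n. n" Suc] by metis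
  have sat: "sat M E (case_nat x e) (Ex \<psi>) \<longleftrightarrow> P x" for x by (simp add: \<psi> \<phi>)
  have ind: "sigma01_induction M" using RCA0 by (simp add: RCA0_def)
  have "sigma01 (Ex \<psi>)" using \<psi>(1) by (auto simp: sigma01_def)
  then have "sat M E (case_nat x e) (Ex \<psi>)"
    using ind [unfolded sigma01_induction_def, rule_format, of "Ex \<psi>" E e x] \<phi>(2) assms(2,3)
    unfolding sat by (simp only: simp_thms)
  then show ?thesis unfolding sat .
qed

text \<open>With vacuous quantifiers \<open>Ex \<psi>\<close> and \<open>All \<psi>\<close> say the
  same, which is the equivalence that the scheme demands.\<close>

lemma comprehension:
  assumes "definable (\<lambda>e. P (e 0))" shows "Collect P \<in> sets"
proof -
  obtain \<phi> E e where \<phi>: "bounded_fm \<phi>" "range E \<subseteq> sets" "\<And>x. P x \<longleftrightarrow> sat M E (case_nat x e) \<phi>"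
    by (rule definable_shape [OF assms(1)]) auto
  obtain \<psi> where \<psi>: "bounded_fm \<psi>"
    "\<And>E e. sat M E e \<psi> \<longleftrightarrow> sat M (\<lambda>n. E n) (\<lambda>n. e (Suc n)) \<phi>"
    using fm_rename [OF \<phi>(1), of M "\<lambda>n. n" Suc] by metis
  have sat: "sat M E (case_nat x e) (Ex \<psi>) \<longleftrightarrow> P x" "sat M E (case_nat x e) (All \<psi>) \<longleftrightarrow> P x" for x
    by (simp_all add: \<psi> \<phi>)
  have comp: "delta01_comprehension M" using RCA0 by (simp add: RCA0_def)
  have "sigma01 (Ex \<psi>)" "pi01 (All \<psi>)" using \<psi>(1) by (auto simp: sigma01_def pi01_def)
  then have "{x. sat M E (case_nat x e) (Ex \<psi>)} \<in> sets"
    using comp [unfolded delta01_comprehension_def, rule_format, of "Ex \<psi>" "All \<psi>" E e] \<phi>(2)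
    unfolding sat by (simp only: simp_thms)
  then show ?thesis unfolding sat .
qed

end

section \<open>The ordered semiring of a model and the codes of pairs and formulas\<close>

context rca
begin

section \<open>Arithmetic from Robinson's axioms and bounded induction\<close>

lemma robinson_axioms:
  "x \<oplus> \<one> \<noteq> \<zero>" "x \<oplus> \<one> = y \<oplus> \<one> \<longleftrightarrow> x = y" "x = \<zero> \<or> (\<exists>y. x = y \<oplus> \<one>)"
  "x \<oplus> \<zero> = x" "x \<oplus> (y \<oplus> \<one>) = (x \<oplus> y) \<oplus> \<one>" "x \<otimes> \<zero> = \<zero>" "x \<otimes> (y \<oplus> \<one>) = x \<otimes> y \<oplus> x"
  "x \<prec> y \<longleftrightarrow> (\<exists>z. x \<oplus> (z \<oplus> \<one>) = y)"
  using RCA0 unfolding RCA0_def robinson_def by blast+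

lemma add_assoc: "(x \<oplus> y) \<oplus> z = x \<oplus> (y \<oplus> z)"
  by (rule bounded_induct [where P="\<lambda>z. (x \<oplus> y) \<oplus> z = x \<oplus> (y \<oplus> z)"], intro bounded_intros)
    (simp_all add: robinson_axioms)

lemma zero_add: "\<zero> \<oplus> x = x"
  by (rule bounded_induct [where P="\<lambda>x. \<zero> \<oplus> x = x"], intro bounded_intros)
    (simp_all add: robinson_axioms)

lemma one_add: "\<one> \<oplus> x = x \<oplus> \<one>"
  by (rule bounded_induct [where P="\<lambda>x. \<one> \<oplus> x = x \<oplus> \<one>"], intro bounded_intros)
    (simp_all add: robinson_axioms zero_add)

lemma add_commute: "x \<oplus> y = y \<oplus> x"
proof (rule bounded_induct [where P="\<lambda>x. x \<oplus> y = y \<oplus> x"], intro bounded_intros)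
  fix x assume "x \<oplus> y = y \<oplus> x"
  then show "(x \<oplus> \<one>) \<oplus> y = y \<oplus> (x \<oplus> \<one>)"
    by (simp add: add_assoc one_add) (simp add: robinson_axioms)
qed (simp add: robinson_axioms zero_add)

lemma add_left_commute: "x \<oplus> (y \<oplus> z) = y \<oplus> (x \<oplus> z)"
  by (metis add_assoc add_commute)

lemmas add_ac = add_assoc add_commute add_left_commute

lemma zero_mul: "\<zero> \<otimes> x = \<zero>"
  by (rule bounded_induct [where P="\<lambda>x. \<zero> \<otimes> x = \<zero>"], intro bounded_intros)
    (simp_all add: robinson_axioms)

lemma mul_one: "x \<otimes> \<one> = x"
  using robinson_axioms(7) [of x "\<zero>"] by (simp add: zero_add robinson_axioms)

lemma distrib_right: "(x \<oplus> y) \<otimes> z = x \<otimes> z \<oplus> y \<otimes> z"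
proof (rule bounded_induct [where P="\<lambda>z. (x \<oplus> y) \<otimes> z = x \<otimes> z \<oplus> y \<otimes> z"], intro bounded_intros)
  fix z assume "(x \<oplus> y) \<otimes> z = x \<otimes> z \<oplus> y \<otimes> z"
  then show "(x \<oplus> y) \<otimes> (z \<oplus> \<one>) = x \<otimes> (z \<oplus> \<one>) \<oplus> y \<otimes> (z \<oplus> \<one>)"
    by (simp add: robinson_axioms(7) add_ac)
qed (simp add: robinson_axioms)

lemma one_mul: "\<one> \<otimes> x = x"
  by (rule bounded_induct [where P="\<lambda>x. \<one> \<otimes> x = x"], intro bounded_intros)
    (simp_all add: robinson_axioms)

lemma mul_commute: "x \<otimes> y = y \<otimes> x"
  by (rule bounded_induct [where P="\<lambda>x. x \<otimes> y = y \<otimes> x"], intro bounded_intros)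
    (simp_all add: robinson_axioms(6,7) zero_mul distrib_right one_mul)

lemma distrib_left: "z \<otimes> (x \<oplus> y) = z \<otimes> x \<oplus> z \<otimes> y"
  by (simp add: mul_commute [of z] distrib_right)

lemma mul_assoc: "(x \<otimes> y) \<otimes> z = x \<otimes> (y \<otimes> z)"
  by (rule bounded_induct [where P="\<lambda>x. (x \<otimes> y) \<otimes> z = x \<otimes> (y \<otimes> z)"], intro bounded_intros)
    (simp_all add: zero_mul distrib_right one_mul)

lemma add_right_cancel: "x \<oplus> z = y \<oplus> z \<longleftrightarrow> x = y"
  by (rule bounded_induct [where P="\<lambda>z. x \<oplus> z = y \<oplus> z \<longleftrightarrow> x = y"], intro bounded_intros)
    (simp_all add: robinson_axioms)

definition le :: "'a \<Rightarrow> 'a \<Rightarrow> bool" (infix \<open>\<preceq>\<close> 50) where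
  "x \<preceq> y \<longleftrightarrow> x \<prec> y \<or> x = y"

text \<open>Truncated subtraction, as \<open>linordered_semidom\<close> requires it;
  \<open>diff\<close> itself has no specified value when the second argument is the larger
  one.\<close>

definition minus :: "'a \<Rightarrow> 'a \<Rightarrow> 'a" where
  "minus x y = (if y \<preceq> x then diff M x y else \<zero>)"

lemma le_iff_add: "x \<preceq> y \<longleftrightarrow> (\<exists>z. x \<oplus> z = y)"
  unfolding le_def robinson_axioms(8) by (metis robinson_axioms(3,4))

lemma not_less_self: "\<not> x \<prec> x"
  unfolding robinson_axioms(8)
  by (metis add_commute add_right_cancel robinson_axioms(1) zero_add)

lemma le_antisym: "x \<preceq> y \<Longrightarrow> y \<preceq> x \<Longrightarrow> x = y"
proof -
  assume "x \<preceq> y" "y \<preceq> x"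
  then obtain z w where z: "x \<oplus> z = y" "y \<oplus> w = x" by (auto simp: le_iff_add)
  then have "(z \<oplus> w) \<oplus> x = \<zero> \<oplus> x" by (metis add_assoc add_commute zero_add)
  then have "z \<oplus> w = \<zero>" by (simp only: add_right_cancel)
  then have "w = \<zero>" by (metis robinson_axioms(1,3,5))
  then show ?thesis using z by (simp add: robinson_axioms)
qed

lemma less_iff_le_not_le: "x \<prec> y \<longleftrightarrow> x \<preceq> y \<and> \<not> y \<preceq> x"
  using le_antisym le_def not_less_self by blast

lemma le_add: "x \<preceq> y \<oplus> x"
  using add_commute le_iff_add by blast

lemma le_linear: "x \<preceq> y \<or> y \<preceq> x"
proof -
  have "x \<prec> y \<or> x = y \<or> y \<prec> x"
  proof (rule bounded_induct [where P="\<lambda>x. x \<prec> y \<or> x = y \<or> y \<prec> x"], intro bounded_intros)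
    show "\<zero> \<prec> y \<or> \<zero> = y \<or> y \<prec> \<zero>" by (metis robinson_axioms(3,8) zero_add)
  next
    fix x assume "x \<prec> y \<or> x = y \<or> y \<prec> x"
    then show "x \<oplus> \<one> \<prec> y \<or> x \<oplus> \<one> = y \<or> y \<prec> x \<oplus> \<one>"
    proof (elim disjE)
      assume "x \<prec> y"
      then obtain z where z: "x \<oplus> (z \<oplus> \<one>) = y" using robinson_axioms(8) by blast
      then have "(x \<oplus> \<one>) \<oplus> z = y" by (simp add: add_ac)
      then have "x \<oplus> \<one> \<preceq> y" using le_iff_add by blast
      then show ?thesis unfolding le_def by blast
    next
      assume "x = y"
      then show ?thesis unfolding robinson_axioms(8) by (metis zero_add)
    next
      assume "y \<prec> x"
      then show ?thesis unfolding robinson_axioms(8) by (metis robinson_axioms(5))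
    qed
  qed
  then show ?thesis by (auto simp: le_def)
qed

lemma diff_eqI: "z \<oplus> y = x \<Longrightarrow> diff M x y = z"
  unfolding diff_def by (rule the_equality) (metis add_right_cancel)+

lemma minus_eqI: "z \<oplus> y = x \<Longrightarrow> minus x y = z"
  by (metis diff_eqI le_add minus_def)

lemma add_less_cancel: "x \<oplus> z \<prec> y \<oplus> z \<longleftrightarrow> x \<prec> y"
proof -
  have "x \<oplus> z \<oplus> (w \<oplus> \<one>) = y \<oplus> z \<longleftrightarrow> x \<oplus> (w \<oplus> \<one>) = y" for w
    using add_right_cancel [of "x \<oplus> (w \<oplus> \<one>)" z y] by (simp add: add_ac)
  then show ?thesis unfolding robinson_axioms(8) by simp
qed

lemma zero_less_one: "\<zero> \<prec> \<one>"
  unfolding robinson_axioms(8) by (metis zero_add)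

lemma mul_less_cancel:
  assumes "x \<prec> y" "\<zero> \<prec> z" shows "z \<otimes> x \<prec> z \<otimes> y"
proof -
  obtain w v where w: "x \<oplus> (w \<oplus> \<one>) = y" and v: "v \<oplus> \<one> = z"
    using assms unfolding robinson_axioms(8) by (metis zero_add)
  have "z \<otimes> y = z \<otimes> x \<oplus> (z \<otimes> w \<oplus> v \<oplus> \<one>)"
    by (simp add: w [symmetric] v [symmetric] distrib_right distrib_left one_mul mul_one add_ac)
  then show ?thesis unfolding robinson_axioms(8) by metis
qed

text \<open>With the model as an instance, \<open>algebra_simps\<close> and the library's order
  lemmas carry out the polynomial computations for pairs and for the beta function.\<close>

sublocale ar: linordered_semidom
  where plus = "(\<oplus>)" and zero = "\<zero>" and times = "(\<otimes>)" and one = "\<one>"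
    and minus = minus and less_eq = "(\<preceq>)" and less = "(\<prec>)"
proof unfold_locales
  show "\<And>a b c. a \<oplus> b \<oplus> c = a \<oplus> (b \<oplus> c)" by (rule add_assoc)
  show "\<And>a b. a \<oplus> b = b \<oplus> a" by (rule add_commute)
  show "\<And>a. \<zero> \<oplus> a = a" by (rule zero_add)
  show "\<And>a b. minus (a \<oplus> b) a = b" by (rule minus_eqI) (rule add_commute)
  show "minus (minus a b) c = minus a (b \<oplus> c)" for a b c
  proof (cases "b \<oplus> c \<preceq> a")
    case True
    then obtain z where z: "z \<oplus> (b \<oplus> c) = a" by (metis le_iff_add add_commute)
    then have "minus a b = z \<oplus> c" by (intro minus_eqI) (metis add_assoc add_commute)
    then show ?thesis using z by (metis minus_eqI)
  next
    case False
    then have zero: "minus a (b \<oplus> c) = \<zero>" by (simp add: minus_def)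
    show ?thesis
    proof (cases "b \<preceq> a")
      case True
      then obtain w where w: "w \<oplus> b = a" by (metis le_iff_add add_commute)
      with False have "\<not> c \<preceq> w" by (metis le_iff_add add_assoc add_commute)
      then show ?thesis using zero minus_eqI [OF w] by (simp add: minus_def)
    next
      case False
      moreover have "minus \<zero> c = \<zero>"
        by (metis minus_def minus_eqI le_antisym le_iff_add zero_add)
      ultimately show ?thesis using zero by (simp add: minus_def [of a b])
    qed
  qed
  show "a \<otimes> b \<noteq> \<zero>" if "a \<noteq> \<zero>" "b \<noteq> \<zero>" for a b
    using that by (metis robinson_axioms(1,3,5,7))
  show "c \<oplus> a \<preceq> c \<oplus> b" if "a \<preceq> b" for a b c
    using that by (metis add_less_cancel le_def add_commute)
  show "minus a b \<oplus> b = a" if "b \<preceq> a" for a b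
    using that by (metis minus_eqI le_iff_add add_commute)
  show "(x \<prec> y) = (x \<preceq> y \<and> \<not> y \<preceq> x)" for x y by (rule less_iff_le_not_le)
  show "x \<preceq> x" for x by (simp add: le_def)
  show "x \<preceq> z" if "x \<preceq> y" "y \<preceq> z" for x y z using that by (metis le_iff_add add_assoc)
  show "x = y" if "x \<preceq> y" "y \<preceq> x" for x y using that by (rule le_antisym)
  show "x \<preceq> y \<or> y \<preceq> x" for x y by (rule le_linear)
  show "a \<otimes> b \<otimes> c = a \<otimes> (b \<otimes> c)" for a b c by (rule mul_assoc)
  show "a \<otimes> b = b \<otimes> a" for a b by (rule mul_commute)
  show "\<one> \<otimes> a = a" for a by (rule one_mul)
  show "(a \<oplus> b) \<otimes> c = a \<otimes> c \<oplus> b \<otimes> c" for a b c by (rule distrib_right)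
  show "\<zero> \<otimes> a = \<zero>" for a by (rule zero_mul)
  show "a \<otimes> \<zero> = \<zero>" for a by (rule robinson_axioms)
  show "\<zero> \<noteq> \<one>" using robinson_axioms(1) [of "\<zero>"] by (simp add: zero_add)
  show "\<zero> \<prec> \<one>" by (rule zero_less_one)
  show "c \<otimes> a \<prec> c \<otimes> b" if "a \<prec> b" "\<zero> \<prec> c" for a b c using that by (rule mul_less_cancel)
  show dist: "a \<otimes> (b \<oplus> c) = a \<otimes> b \<oplus> a \<otimes> c" for a b c by (rule distrib_left)
  show "a \<otimes> minus b c = minus (a \<otimes> b) (a \<otimes> c)" for a b c
  proof (cases "c \<preceq> b")
    case True
    then obtain w where w: "w \<oplus> c = b" by (metis le_iff_add add_commute)
    have "a \<otimes> w \<oplus> a \<otimes> c = a \<otimes> b" by (simp add: w [symmetric] dist)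
    then show ?thesis by (metis minus_eqI w)
  next
    case False
    then have "b \<prec> c" using le_linear le_def by blast
    moreover have "minus b c = \<zero>" using False by (simp add: minus_def)
    moreover have "minus \<zero> \<zero> = \<zero>" by (rule minus_eqI) (rule zero_add)
    moreover have "minus (a \<otimes> b) (a \<otimes> c) = \<zero>" if "a \<noteq> \<zero>"
    proof -
      have "\<zero> \<prec> a" using that by (metis robinson_axioms(3,8) zero_add)
      then have "\<not> a \<otimes> c \<preceq> a \<otimes> b"
        using mul_less_cancel [OF \<open>b \<prec> c\<close>] less_iff_le_not_le by blast
      then show ?thesis by (simp add: minus_def)
    qed
    ultimately show ?thesis
      by (cases "a = \<zero>") (simp_all add: zero_mul robinson_axioms(6))
  qed
qed

lemma not_less_zero [simp]: "\<not> x \<prec> \<zero>"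
  by (simp add: robinson_axioms(5,8) robinson_axioms(1))

lemma zero_le [simp]: "\<zero> \<preceq> x"
  using not_less_zero ar.not_less by blast

lemma less_add_one: "x \<prec> y \<oplus> \<one> \<longleftrightarrow> x \<preceq> y"
  unfolding robinson_axioms(8) le_iff_add by (metis robinson_axioms(2,5))

lemma add_one_le: "x \<oplus> \<one> \<preceq> y \<longleftrightarrow> x \<prec> y"
  using less_add_one [of y x] by (simp add: ar.not_less [symmetric])

lemma less_add_one_iff: "x \<prec> y \<oplus> \<one> \<longleftrightarrow> x \<prec> y \<or> x = y"
  by (simp add: less_add_one le_def)

lemma exists_pred: "x \<noteq> \<zero> \<Longrightarrow> \<exists>y. x = y \<oplus> \<one>"
  using robinson_axioms(3) by blast

section \<open>Pairing and formula codes\<close>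

lemma pair_less:
  assumes "x \<oplus> y \<prec> u \<oplus> v" shows "pair M x y \<prec> pair M u v"
proof -
  obtain z where z: "u \<oplus> v = (x \<oplus> y) \<oplus> (z \<oplus> \<one>)" using assms robinson_axioms(8) by metis
  \<comment> \<open>With s = x + y the larger code is at least (s + 1)^2 = s^2 + 2 s + 1, which
    exceeds s^2 + x since x is at most s. \<open>?w\<close> is the difference less one, written
    without subtraction.\<close>
  let ?w = "y \<oplus> (x \<oplus> y) \<otimes> z \<oplus> z \<otimes> (x \<oplus> y) \<oplus> (x \<oplus> y) \<oplus> z \<otimes> z \<oplus> z \<oplus> z \<oplus> u"
  have "pair M u v = pair M x y \<oplus> (?w \<oplus> \<one>)"
    unfolding pair_def z by (simp add: algebra_simps)
  then show ?thesis unfolding robinson_axioms(8) by metis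
qed

text \<open>By \<open>pair_less\<close> equal codes have equal component sums; cancelling the square
  then leaves the first component.\<close>

lemma pair_inj [simp]: "pair M x y = pair M u v \<longleftrightarrow> x = u \<and> y = v"
proof
  assume eq: "pair M x y = pair M u v"
  then have "x \<oplus> y = u \<oplus> v"
    using pair_less [of x y u v] pair_less [of u v x y] ar.linorder_cases ar.less_irrefl by metis
  with eq show "x = u \<and> y = v" by (simp add: pair_def)
qed simp

lemma le_pair_left: "x \<preceq> pair M x y"
  by (simp add: pair_def le_add)

lemma le_square: "x \<preceq> x \<otimes> x"
  using exists_pred [of x] le_add [of x] by (cases "x = \<zero>") (auto simp: ar.distrib_left ar.distrib_right)

lemma le_pair_right: "y \<preceq> pair M x y"
  by (metis pair_def le_add le_iff_add le_square ar.order_trans)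

lemma pair_mono: "x \<preceq> u \<Longrightarrow> y \<preceq> v \<Longrightarrow> pair M x y \<preceq> pair M u v"
  unfolding pair_def by (intro ar.add_mono ar.mult_mono) simp_all

lemma triple_le: "x \<preceq> x \<oplus> x \<oplus> x"
  by (metis le_add)

lemma triple_less: "x \<prec> y \<Longrightarrow> x \<oplus> x \<oplus> x \<oplus> \<one> \<oplus> \<one> \<prec> y \<oplus> y \<oplus> y"
proof -
  assume "x \<prec> y"
  then obtain z where z: "y = x \<oplus> (z \<oplus> \<one>)" using robinson_axioms(8) by metis
  have "y \<oplus> y \<oplus> y = (x \<oplus> x \<oplus> x \<oplus> \<one> \<oplus> \<one>) \<oplus> (z \<oplus> z \<oplus> z \<oplus> \<one>)"
    by (simp add: z algebra_simps)
  then show ?thesis unfolding robinson_axioms(8) by metis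
qed

lemma triple_inj: "x \<oplus> x \<oplus> x = y \<oplus> y \<oplus> y \<longleftrightarrow> x = y"
proof
  assume eq: "x \<oplus> x \<oplus> x = y \<oplus> y \<oplus> y"
  have "u \<oplus> u \<oplus> u \<prec> v \<oplus> v \<oplus> v" if "u \<prec> v" for u v
    using triple_less [OF that] robinson_axioms(5,8) add_assoc by metis
  with eq show "x = y" by (metis ar.linorder_cases ar.less_irrefl)
qed simp

text \<open>Residues 1 and 2 modulo 3 keep implications and boxed formulas apart. Comparing y with x
  replaces an argument by division, which is not yet available.\<close>

lemma triple_add_one: "x \<oplus> x \<oplus> x \<oplus> \<one> \<noteq> y \<oplus> y \<oplus> y \<oplus> \<one> \<oplus> \<one>"
proof (cases "y \<prec> x")
  case True
  then have "y \<oplus> y \<oplus> y \<oplus> \<one> \<oplus> \<one> \<prec> x \<oplus> x \<oplus> x" by (rule triple_less)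
  then show ?thesis by (metis ar.less_irrefl less_add_one le_def)
next
  case False
  then have "x \<oplus> x \<oplus> x \<preceq> y \<oplus> y \<oplus> y" by (intro ar.add_mono) (simp_all add: ar.not_less)
  then have "x \<oplus> x \<oplus> x \<oplus> \<one> \<prec> y \<oplus> y \<oplus> y \<oplus> \<one> \<oplus> \<one>" by (simp add: less_add_one)
  then show ?thesis by (metis ar.less_irrefl)
qed

lemma formula_codes [simp]:
  "fimp M \<phi> \<psi> = fimp M \<phi>' \<psi>' \<longleftrightarrow> \<phi> = \<phi>' \<and> \<psi> = \<psi>'"
  "fbox M \<phi> = fbox M \<phi>' \<longleftrightarrow> \<phi> = \<phi>'"
  "fimp M \<phi> \<psi> \<noteq> fbox M \<phi>'" "fbox M \<phi>' \<noteq> fimp M \<phi> \<psi>"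
  "fimp M \<phi> \<psi> \<noteq> fbot M" "fbot M \<noteq> fimp M \<phi> \<psi>"
  "fbox M \<phi> \<noteq> fbot M" "fbot M \<noteq> fbox M \<phi>"
  using triple_add_one robinson_axioms(1)
  by (auto simp: fimp_def fbox_def fbot_def triple_inj) metis+

text \<open>Strong induction on codes thereby serves as induction on formulas, and the quantifiers
  over subformulas in \<open>Prop\<close> can be bounded.\<close>

lemma subformula_less:
  "\<phi> \<prec> fimp M \<phi> \<psi>" "\<psi> \<prec> fimp M \<phi> \<psi>" "\<phi> \<prec> fbox M \<phi>"
  unfolding fimp_def fbox_def less_add_one
  by (metis triple_le le_pair_left ar.order_trans, metis triple_le le_pair_right ar.order_trans,
      metis triple_le le_add add_commute ar.order_trans)

lemma definable_tm_pair: "definable_tm t \<Longrightarrow> definable_tm u \<Longrightarrow> definable_tm (\<lambda>e. pair M (t e) (u e))"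
  unfolding pair_def by (intro bounded_intros)

lemma definable_tm_fimp: "definable_tm t \<Longrightarrow> definable_tm u \<Longrightarrow> definable_tm (\<lambda>e. fimp M (t e) (u e))"
  unfolding fimp_def by (intro bounded_intros definable_tm_pair)

lemma definable_tm_fbox: "definable_tm t \<Longrightarrow> definable_tm (\<lambda>e. fbox M (t e))"
  unfolding fbox_def by (intro bounded_intros)

lemma definable_rel: "R \<in> sets \<Longrightarrow> definable_tm t \<Longrightarrow> definable_tm u \<Longrightarrow> definable (\<lambda>e. rel M R (t e) (u e))"
  unfolding rel_def by (intro bounded_intros definable_tm_pair)

end

context rca begin

lemma definable_tm_eval: "definable_tm (\<lambda>e. eval M e t)"
  by (induction t) (simp_all add: definable_tm_var definable_tm_const definable_tm_add definable_tm_mul)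

text \<open>All variables but the first turn into number parameters, which is the form that
  \<open>comprehension\<close> accepts.\<close>

lemma definable_fix:
  assumes "definable P" shows "definable (\<lambda>e. P (case_nat (e 0) p))"
proof -
  obtain \<phi> E q where P: "bounded_fm \<phi>" "range E \<subseteq> sets" "\<And>e. P e \<longleftrightarrow> sat M E (mix e q) \<phi>"
    using assms unfolding definable_def by blast
  define h :: "nat \<Rightarrow> nat" where "h n = (if n = 0 then 0 else Suc (2 * n))" for n
  obtain \<psi> where \<psi>: "bounded_fm \<psi>"
    "\<And>E e. sat M E e \<psi> \<longleftrightarrow> sat M (\<lambda>n. E n) (\<lambda>n. e (h n)) \<phi>"
    using fm_rename [OF P(1), of M "\<lambda>n. n" h] by metis
  have "(\<lambda>n. mix e (mix (case_nat \<zero> p) q) (h n)) = mix (case_nat (e 0) p) q" for e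
    by (rule ext) (auto simp: h_def mix_def elim!: evenE split: nat.split)
  then show ?thesis
    by (intro definableI [of \<psi> E _ "mix (case_nat \<zero> p) q"]) (simp_all add: \<psi> P)
qed

lemma case_nat_tail [simp]: "case_nat (e 0) (\<lambda>n. e (Suc n)) = e"
  by (rule ext) (simp split: nat.split)

end

section \<open>Arithmetical comprehension as closure under projection\<close>

text \<open>Projection is what a valuation on the special frame delivers. \<open>ACA0\<close> and
  \<open>aca_if_ACA0\<close> show that it amounts to arithmetical comprehension, so both halves of
  the proof meet here.\<close>

locale aca = rca +
  assumes projection: "definable (\<lambda>e. P (e 0) (e (Suc 0))) \<Longrightarrow> {x. \<exists>y. P y x} \<in> sets"
begin

text \<open>The last two variables are repeatedly merged into one by the pairing function, until
  the projection axiom applies.\<close>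

lemma definable_ex_finite_support:
  assumes "definable P" "\<And>e e'. (\<And>i. i < Suc (Suc k) \<Longrightarrow> e i = e' i) \<Longrightarrow> P e = P e'"
  shows "definable (\<lambda>e. \<exists>x. P (case_nat x e))"
  using assms
proof (induction k arbitrary: P)
  case 0
  define Q where "Q a b = P (case_nat a (\<lambda>_. b))" for a b
  have Q: "P e = Q (e 0) (e (Suc 0))" for e
    unfolding Q_def by (rule 0(2)) (auto simp: less_Suc_eq)
  define X where "X = {b. \<exists>a. Q a b}"
  have "X \<in> sets" unfolding X_def using 0(1) by (intro projection) (simp add: Q [abs_def])
  \<comment> \<open>The projected set enters as a parameter, so the quantified statement now has an
    atomic definition.\<close>
  then have "definable (\<lambda>e. e 0 \<in> X)" by (intro bounded_intros)
  then show ?case by (simp add: Q X_def)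
next
  case (Suc k)
  \<comment> \<open>The last two relevant variables are \<open>m\<close> and \<open>Suc m\<close>.
    \<open>Q\<close> decodes both from \<open>m\<close>; the search is bounded because components do
    not exceed the code.\<close>
  define m where "m = Suc k"
  define Q where "Q e \<longleftrightarrow> (\<exists>y. y \<prec> e m \<oplus> \<one> \<and> (\<exists>z. z \<prec> e m \<oplus> \<one> \<and>
    e m = pair M y z \<and> P (e(m := y, Suc m := z))))" for e
  have "definable Q"
  proof -
    \<comment> \<open>Under the two bounded quantifiers \<open>z\<close> has index 0 and
      \<open>y\<close> has index 1, and the old variables are shifted by two.\<close>
    define h where "h n = (if n = m then 1 else if n = Suc m then 0 else Suc (Suc n))" for n
    have h: "(\<lambda>n. e (h n)) = (\<lambda>n. e (Suc (Suc n)))(m := e 1, Suc m := e 0)" for e :: "nat \<Rightarrow> 'a"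
      by (rule ext) (simp add: h_def)
    have "definable (\<lambda>e. P ((\<lambda>n. e (Suc (Suc n)))(m := e 1, Suc m := e 0)))"
      using definable_rename [OF Suc(2), of h] unfolding h .
    then show ?thesis unfolding Q_def by (intro bounded_intros definable_tm_pair) simp
  qed
  moreover have "Q e = Q e'" if "\<And>i. i < Suc (Suc k) \<Longrightarrow> e i = e' i" for e e'
  proof -
    have "e m = e' m" using that by (simp add: m_def)
    moreover have "P (e(m := y, Suc m := z)) = P (e'(m := y, Suc m := z))" for y z
      by (rule Suc(3)) (use that in \<open>auto simp: m_def less_Suc_eq\<close>)
    ultimately show ?thesis by (simp add: Q_def)
  qed
  ultimately have "definable (\<lambda>e. \<exists>x. Q (case_nat x e))" by (rule Suc(1))
  \<comment> \<open>Binding one variable lowers the other indices by one, so the merged variable is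
    now \<open>k\<close>. The term substituted for it is the polynomial of
    \<open>pair\<close>.\<close>
  note subst = definable_tm_subst [OF this, of "\<lambda>n. if n = k then
    Add (Mul (Add (Var k) (Var (Suc k))) (Add (Var k) (Var (Suc k)))) (Var k) else Var n"]
  have "Q (case_nat x (\<lambda>n. if n = k then pair M (e k) (e (Suc k)) else e n)) = P (case_nat x e)" for x e
  proof -
    define e' where "e' = case_nat x (\<lambda>n. if n = k then pair M (e k) (e (Suc k)) else e n)"
    have "P (e'(m := e k, Suc m := e (Suc k))) = P (case_nat x e)"
      by (rule Suc(3)) (auto simp: e'_def m_def split: nat.split)
    moreover have "e' m = pair M (e k) (e (Suc k))" by (simp add: e'_def m_def)
    ultimately show ?thesis
      unfolding e'_def [symmetric] Q_def by (auto simp: less_add_one le_pair_left le_pair_right)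
  qed
  moreover have "eval M e (if n = k then
    Add (Mul (Add (Var k) (Var (Suc k))) (Add (Var k) (Var (Suc k)))) (Var k) else Var n)
    = (if n = k then pair M (e k) (e (Suc k)) else e n)" for e n
    by (simp add: pair_def)
  ultimately show ?case using subst by (simp only:)
qed

lemma definable_ex_case: assumes "definable P" shows "definable (\<lambda>e. \<exists>x. P (case_nat x e))"
proof -
  obtain k where k: "\<And>e e'. (\<And>i. i < k \<Longrightarrow> e i = e' i) \<Longrightarrow> P e = P e'"
    using definable_finite_support [OF assms] by metis
  show ?thesis by (rule definable_ex_finite_support [OF assms, of k]) (rule k, simp)
qed

lemma definable_ex:
  assumes "definable (\<lambda>e. P (e 0) (\<lambda>n. e (Suc n)))" shows "definable (\<lambda>e. \<exists>x. P x e)"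
  using definable_ex_case [OF assms] by simp

lemma definable_all:
  assumes "definable (\<lambda>e. P (e 0) (\<lambda>n. e (Suc n)))" shows "definable (\<lambda>e. \<forall>x. P x e)"
  using definable_not [OF definable_ex [OF definable_not [OF assms]]] by simp

lemma definable_sat: assumes "range E \<subseteq> sets" shows "definable (\<lambda>e. sat M E e \<phi>)"
proof (induction \<phi>)
  case (BAll t \<phi>)
  then show ?case using definable_ball [OF definable_tm_eval, of "\<lambda>x e. sat M E (case_nat x e) \<phi>"] by simp
next
  case (BEx t \<phi>)
  then show ?case using definable_bex [OF definable_tm_eval, of "\<lambda>x e. sat M E (case_nat x e) \<phi>"] by simp
next
  case (All \<phi>)
  then show ?case using definable_all [of "\<lambda>x e. sat M E (case_nat x e) \<phi>"] by simp
next
  case (Ex \<phi>)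
  then show ?case using definable_ex [of "\<lambda>x e. sat M E (case_nat x e) \<phi>"] by simp
qed (use assms in \<open>auto intro!: bounded_intros definable_tm_eval\<close>)

lemma ACA0: "ACA0 M"
proof -
  have "{x. sat M E (case_nat x e) \<phi>} \<in> sets" if "range E \<subseteq> sets" for E e \<phi>
    by (rule comprehension) (rule definable_fix [OF definable_sat [OF that]])
  then show ?thesis using RCA0 by (simp add: ACA0_def arithmetical_comprehension_def)
qed

end

lemma (in rca) aca_if_ACA0:
  assumes "ACA0 M" shows "aca M"
proof
  fix P assume "definable (\<lambda>e. P (e 0) (e (Suc 0)))"
  then obtain \<phi> E p where P: "bounded_fm \<phi>" "range E \<subseteq> sets"
    "\<And>e. P (e 0) (e (Suc 0)) \<longleftrightarrow> sat M E (mix e p) \<phi>"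
    unfolding definable_def by blast
  \<comment> \<open>The witness takes index 0 and the argument index 1; parameters follow from index
    2. Every other even slot may also be filled with the argument, as \<open>P\<close> reads only
    the first two variables.\<close>
  define h :: "nat \<Rightarrow> nat" where "h n = (if n = 0 then 0 else if even n then 1 else Suc (Suc (n div 2)))" for n
  obtain \<psi> where \<psi>: "\<And>E e. sat M E e \<psi> \<longleftrightarrow> sat M (\<lambda>n. E n) (\<lambda>n. e (h n)) \<phi>"
    using fm_rename [OF P(1), of M "\<lambda>n. n" h] by metis
  have "(\<lambda>n. case_nat y (case_nat x p) (h n)) = mix (case_nat y (\<lambda>_. x)) p" for x y
    by (rule ext) (auto simp: h_def mix_def elim!: evenE split: nat.split)
  then have "P y x \<longleftrightarrow> sat M E (case_nat y (case_nat x p)) \<psi>" for x y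
    using P(3) [of "case_nat y (\<lambda>_. x)"] by (simp add: \<psi>)
  then have "{x. \<exists>y. P y x} = {x. sat M E (case_nat x p) (Ex \<psi>)}" by simp
  also have "\<dots> \<in> sets"
    using assms P(2) by (simp only: ACA0_def arithmetical_comprehension_def)
  finally show "{x. \<exists>y. P y x} \<in> sets" .
qed

section \<open>The frame for the reversal\<close>

context rca begin

lemma bounded_less_induct:
  assumes "definable (\<lambda>e. P (e 0))" "\<And>x. (\<And>y. y \<prec> x \<Longrightarrow> P y) \<Longrightarrow> P x" shows "P x"
proof -
  have "\<forall>y. y \<prec> x \<longrightarrow> P y" for x
  proof (rule bounded_induct [where P="\<lambda>x. \<forall>y. y \<prec> x \<longrightarrow> P y"])
    show "definable (\<lambda>e. \<forall>y. y \<prec> e 0 \<longrightarrow> P y)" using assms(1) by (intro bounded_intros)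
  qed (use assms(2) in \<open>auto simp: less_add_one_iff\<close>)
  then show ?thesis using assms(2) by blast
qed

lemma least_exists:
  assumes "definable (\<lambda>e. P (e 0))" "P x" shows "\<exists>y. P y \<and> (\<forall>z. z \<prec> y \<longrightarrow> \<not> P z)"
proof (rule ccontr)
  assume "\<not> ?thesis"
  then have "\<not> P y" if "\<And>z. z \<prec> y \<Longrightarrow> \<not> P z" for y using that by blast
  then have "\<not> P y" for y by (rule bounded_less_induct [OF definable_not [OF assms(1)]])
  then show False using assms(2) by blast
qed

section \<open>Beta function, functions and truth conditions over RCA0\<close>

lemma division_unique:
  assumes "q \<otimes> m \<oplus> r = q' \<otimes> m \<oplus> r'" "r \<prec> m" "r' \<prec> m" shows "r = r'"
proof -
  have False if less: "q \<prec> q'" and eq: "q \<otimes> m \<oplus> r = q' \<otimes> m \<oplus> r'" and r: "r \<prec> m" for q q' r r'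
  proof -
    obtain z where "q' = q \<oplus> (z \<oplus> \<one>)" using less robinson_axioms(8) by metis
    then have "q \<otimes> m \<oplus> r = q \<otimes> m \<oplus> (m \<oplus> (z \<otimes> m \<oplus> r'))"
      using eq by (simp add: algebra_simps)
    then have "r = m \<oplus> (z \<otimes> m \<oplus> r')" by (metis add_right_cancel add_commute)
    then have "m \<preceq> r" using le_iff_add by blast
    then show False using r ar.not_less by blast
  qed
  then have "q = q'" using assms ar.linorder_cases by metis
  then show ?thesis using assms(1) by (metis add_right_cancel add_commute)
qed

lemma beta_eqI:
  assumes "a = q \<otimes> ((i \<oplus> \<one>) \<otimes> b \<oplus> \<one>) \<oplus> r" "r \<prec> (i \<oplus> \<one>) \<otimes> b \<oplus> \<one>"
  shows "beta M a b i = r"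
  unfolding beta_def using assms division_unique by (intro the_equality) blast+

lemma chain_zero: "chain M X Q \<zero> u v \<longleftrightarrow> u = v \<and> u \<in> X"
proof
  assume "u = v \<and> u \<in> X"
  \<comment> \<open>Both components of the code are \<open>u\<close>: the modulus at position zero
    is then u + 1, and the remainder of \<open>u\<close> is \<open>u\<close> itself.\<close>
  moreover have "beta M u u \<zero> = u"
    by (rule beta_eqI [of _ \<zero>]) (simp_all add: less_add_one)
  ultimately show "chain M X Q \<zero> u v" unfolding chain_def
    by (intro exI [of _ u]) auto
qed (auto simp: chain_def)

lemma chain_oneD: "chain M X Q \<one> u v \<Longrightarrow> Q u v"
  unfolding chain_def by (metis zero_add zero_less_one)

lemma Fml [simp]: "\<phi> \<in> Fml"
  by (simp add: Fml_def)

lemma mem_cross [simp]: "pair M x y \<in> cross M X Y \<longleftrightarrow> x \<in> X \<and> y \<in> Y"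
  by (auto simp: cross_def)

lemma zero_neq_one [simp]: "\<zero> \<noteq> \<one>" "\<one> \<noteq> \<zero>"
  using zero_less_one by auto

lemma is_functionI:
  assumes "f \<in> sets" "f \<subseteq> cross M X Y" "\<And>x. x \<in> X \<Longrightarrow> \<exists>!y. pair M x y \<in> f"
  shows "is_function M X Y f"
  using assms by (simp add: is_function_def)

lemma app_iff:
  assumes "is_function M X Y f" "x \<in> X" shows "app M f x = y \<longleftrightarrow> pair M x y \<in> f"
proof -
  have "\<exists>!y. pair M x y \<in> f" using assms unfolding is_function_def by blast
  from theI' [OF this] the1_equality [OF this] show ?thesis unfolding app_def by blast
qed

lemma app_in: "is_function M X Y f \<Longrightarrow> x \<in> X \<Longrightarrow> app M f x \<in> Y"
  using app_iff [of X Y f x "app M f x"] mem_cross [of x "app M f x" X Y]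
  unfolding is_function_def by blast

lemma diff_one: "diff M \<one> \<zero> = \<one>" "diff M \<one> \<one> = \<zero>"
  by (simp_all add: diff_eqI)

context
  fixes W R V assumes V: "valuation M W R V"
begin

lemma val_iff: "w \<in> W \<Longrightarrow> val M V w \<phi> = r \<longleftrightarrow> pair M (pair M w \<phi>) r \<in> V"
  using V unfolding valuation_def val_def by (intro app_iff) auto

lemma val_cases: "w \<in> W \<Longrightarrow> val M V w \<phi> = \<zero> \<or> val M V w \<phi> = \<one>"
  using V app_in [of "cross M W Fml" "{\<zero>, \<one>}" V "pair M w \<phi>"]
  unfolding valuation_def val_def by auto

lemma val_bot: "w \<in> W \<Longrightarrow> val M V w (fbot M) = \<zero>"
  using V by (auto simp: valuation_def)

lemma val_imp:
  assumes "w \<in> W"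
  shows "val M V w (fimp M \<phi> \<psi>) = \<one> \<longleftrightarrow> (val M V w \<phi> = \<one> \<longrightarrow> val M V w \<psi> = \<one>)"
proof -
  have "val M V w (fimp M \<phi> \<psi>) = diff M \<one> (val M V w \<phi> \<otimes> diff M \<one> (val M V w \<psi>))"
    using V assms by (auto simp: valuation_def)
  then show ?thesis using val_cases [OF assms, of \<phi>] val_cases [OF assms, of \<psi>]
    by (auto simp: diff_one)
qed

lemma val_box:
  "w \<in> W \<Longrightarrow> val M V w (fbox M \<phi>) = \<one> \<longleftrightarrow> (\<forall>u\<in>W. rel M R w u \<longrightarrow> val M V u \<phi> = \<one>)"
  using V by (auto simp: valuation_def)

lemma val_dia:
  "w \<in> W \<Longrightarrow> val M V w (fdia M \<phi>) = \<one> \<longleftrightarrow> (\<exists>u\<in>W. rel M R w u \<and> val M V u \<phi> = \<one>)"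
  by (auto simp: fdia_def fneg_def val_imp val_bot val_box)

end

lemma UNIV_in_sets: "UNIV \<in> sets"
  using comprehension [of "\<lambda>_. True"] definable_const by simp

lemma definable_binary: "definable (\<lambda>e. P (e 0) (e (Suc 0))) \<Longrightarrow> definable (\<lambda>e. P (e i) (e j))"
  using definable_rename [of _ "case_nat i (\<lambda>_. j)"] by fastforce

lemma projection_frame:
  assumes P: "definable (\<lambda>e. P (e 0) (e (Suc 0)))"
  obtains R where "frame M UNIV R" "image_finite M UNIV R" "\<not> transitive M UNIV R"
    "\<exists>w. \<forall>u. \<not> rel M R w u"
    "\<And>V. valuation M UNIV R V \<Longrightarrow> {x. \<exists>y. P y x} \<in> sets"
proof -
  define two where "two = \<one> \<oplus> \<one>"
  define three where "three = two \<oplus> \<one>"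
  define S where "S a b \<longleftrightarrow> (a = two \<and> b = \<one>) \<or> (a = \<one> \<and> b = \<zero>) \<or>
    (\<exists>x. x \<prec> a \<and> a = x \<oplus> three \<and> P b x \<and> (\<forall>z. z \<prec> b \<longrightarrow> \<not> P z x))" for a b
  \<comment> \<open>Components do not exceed the code of a pair, so all quantifiers can be bounded
    and \<open>R\<close> is a set over RCA0.\<close>
  define R where "R = {p. \<exists>a. a \<prec> p \<oplus> \<one> \<and> (\<exists>b. b \<prec> p \<oplus> \<one> \<and> p = pair M a b \<and> S a b)}"
  have S: "definable (\<lambda>e. S (e 0) (e (Suc 0)))"
    unfolding S_def by (intro bounded_intros definable_binary [OF P])
  have "R \<in> sets"
    unfolding R_def by (intro comprehension bounded_intros definable_binary [OF S] definable_tm_pair)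
  have rel: "rel M R a b \<longleftrightarrow> S a b" for a b
    by (auto simp: rel_def R_def less_add_one le_pair_left le_pair_right)
  have three: "x \<oplus> three = y \<oplus> three \<longleftrightarrow> x = y" for x y
    by (rule add_right_cancel)
  have small: "two \<noteq> x \<oplus> three" "\<one> \<noteq> x \<oplus> three" "\<zero> \<noteq> x \<oplus> three" for x
    using robinson_axioms(1) unfolding two_def three_def
    by (metis add_commute add_right_cancel robinson_axioms(5) zero_add)+
  have two: "two \<noteq> \<one>" "two \<noteq> \<zero>"
    unfolding two_def using robinson_axioms(1) [of \<one>] robinson_axioms(2) [of \<one> \<zero>] by simp_all
  have S_three: "S (x \<oplus> three) b \<longleftrightarrow> P b x \<and> (\<forall>z. z \<prec> b \<longrightarrow> \<not> P z x)" for x b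
  proof -
    have "x \<prec> x \<oplus> three" by (metis robinson_axioms(8) three_def)
    then show ?thesis using small [of x] unfolding S_def three by auto
  qed
  show ?thesis
  proof
    show "frame M UNIV R"
      using \<open>R \<in> sets\<close> UNIV_in_sets by (auto simp: frame_def R_def)
    show "image_finite M UNIV R"
      unfolding image_finite_def rel
    proof
      fix w
      show "\<exists>b. \<forall>u\<in>UNIV. S w u \<longrightarrow> u \<prec> b"
      proof (cases "\<exists>x b. w = x \<oplus> three \<and> S w b")
        case True
        then obtain x b where w: "w = x \<oplus> three" "S w b" by blast
        have "u = b" if "S w u" for u
          using that w unfolding w(1) S_three by (metis ar.linorder_cases)
        then have "\<forall>u\<in>UNIV. S w u \<longrightarrow> u \<prec> b \<oplus> \<one>" by (simp add: less_add_one)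
        then show ?thesis ..
      next
        case False
        \<comment> \<open>Without a successor coming from \<open>P\<close>, only the two clauses for
          the extra worlds are left, and their targets are below \<open>two\<close>.\<close>
        then have "S w u \<Longrightarrow> u = \<zero> \<or> u = \<one>" for u using S_def by blast
        then have "\<forall>u\<in>UNIV. S w u \<longrightarrow> u \<prec> two"
          unfolding two_def less_add_one using zero_le ar.order_refl by metis
        then show ?thesis ..
      qed
    qed
    have "S two \<one>" "S \<one> \<zero>" "\<not> S two \<zero>" using small two by (auto simp: S_def)
    then show "\<not> transitive M UNIV R" unfolding transitive_def rel by blast
    have "\<not> S \<zero> u" for u using small(3) two(2) by (auto simp: S_def)
    then show "\<exists>w. \<forall>u. \<not> rel M R w u" unfolding rel by blast
    fix V assume V: "valuation M UNIV R V"
    have "(\<exists>y. P y x) \<longleftrightarrow> pair M (pair M (x \<oplus> three) (fbox M (fbot M))) \<zero> \<in> V" for x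
    proof -
      \<comment> \<open>The least number principle for bounded predicates turns an arbitrary witness
        into a successor.\<close>
      have "(\<exists>y. P y x) \<longleftrightarrow> (\<exists>y. S (x \<oplus> three) y)"
        unfolding S_three using least_exists [of "\<lambda>y. P y x"] definable_fix [OF P, of "\<lambda>_. x"] by auto
      also have "\<dots> \<longleftrightarrow> val M V (x \<oplus> three) (fbox M (fbot M)) \<noteq> \<one>"
        by (simp add: val_box [OF V] val_bot [OF V] rel)
      also have "\<dots> \<longleftrightarrow> val M V (x \<oplus> three) (fbox M (fbot M)) = \<zero>"
        using val_cases [OF V] by fastforce
      finally show ?thesis by (simp only: val_iff [OF V UNIV_I])
    qed
    moreover have "V \<in> sets" using V by (simp add: valuation_def is_function_def)
    then have "{x. pair M (pair M (x \<oplus> three) (fbox M (fbot M))) \<zero> \<in> V} \<in> sets"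
      by (intro comprehension bounded_intros definable_tm_pair)
    ultimately show "{x. \<exists>y. P y x} \<in> sets" by simp
  qed
qed

text \<open>The last two premises describe the frame of \<open>projection_frame\<close>; they let
  statements 3 and 4 be used at a frame where condition (a) is refuted.\<close>

theorem ACA0_if_valuations:
  assumes "\<And>R. frame M UNIV R \<Longrightarrow> image_finite M UNIV R \<Longrightarrow> \<not> transitive M UNIV R \<Longrightarrow>
    \<exists>w. \<forall>u. \<not> rel M R w u \<Longrightarrow> \<exists>V. valuation M UNIV R V"
  shows "ACA0 M"
proof (rule aca.ACA0, unfold_locales)
  fix P assume "definable (\<lambda>e. P (e 0) (e (Suc 0)))"
  then show "{x. \<exists>y. P y x} \<in> sets"
    by (rule projection_frame) (use assms in blast)
qed

end

section \<open>Coding of finite sequences\<close>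

lemma (in rca) definable_tm_rename:
  assumes "definable_tm t" shows "definable_tm (\<lambda>e. t (\<lambda>n. e (h n)))"
proof -
  obtain s p where s: "\<And>e. t e = eval M (mix e p) s" using assms by (auto simp: definable_tm_def)
  define h' where "h' n = (if even n then 2 * h (n div 2) else n)" for n
  obtain s' where s': "\<And>e. eval M e s' = eval M (\<lambda>n. e (h' n)) s" using tm_rename by metis
  have "(\<lambda>n. mix e p (h' n)) = mix (\<lambda>n. e (h n)) p" for e
    by (rule ext) (auto simp: h'_def mix_def)
  then show ?thesis unfolding definable_tm_def by (intro exI [of _ s'] exI [of _ p]) (simp add: s s')
qed

context aca begin

text \<open>Functions are handled through their graphs, which admits those given by
  \<open>THE\<close>, such as \<open>beta\<close> and iterations. Substituting one costs an
  unbounded quantifier, hence the locale \<open>aca\<close>.\<close>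

definition definable_fun :: "((nat \<Rightarrow> 'a) \<Rightarrow> 'a) \<Rightarrow> bool" where
  "definable_fun f \<longleftrightarrow> definable (\<lambda>e. e 0 = f (\<lambda>n. e (Suc n)))"

lemma definable_fun_if_tm: "definable_tm t \<Longrightarrow> definable_fun t"
  unfolding definable_fun_def by (rule definable_eq [OF definable_tm_var definable_tm_rename [where h=Suc]])

lemma definable_fun_lift: "definable_fun f \<Longrightarrow> definable_fun (\<lambda>e. f (\<lambda>n. e (Suc n)))"
  unfolding definable_fun_def by (drule definable_rename [of _ "case_nat 0 (\<lambda>n. Suc (Suc n))"]) simp

lemma definable_subst_one: assumes "definable P" "definable_fun f" shows "definable (\<lambda>e. P (case_nat (f e) e))"
proof -
  have "definable (\<lambda>e. \<exists>x. x = f e \<and> P (case_nat x e))"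
    using assms unfolding definable_fun_def by (intro definable_ex definable_conj) simp_all
  then show ?thesis by simp
qed

text \<open>The value of the last function is held in a fresh variable 0 while the other functions,
  lifted past it, are substituted; then that variable is replaced.\<close>

lemma definable_subst:
  assumes "definable P" "\<And>n. n < k \<Longrightarrow> definable_fun (f n)"
  shows "definable (\<lambda>e. P (\<lambda>n. if n < k then f n e else e (n - k)))"
  using assms(2)
proof (induction k arbitrary: f)
  case 0
  then show ?case using assms(1) by simp
next
  case (Suc k)
  have "definable (\<lambda>e. P (\<lambda>n. if n < k then f n (\<lambda>n. e (Suc n)) else e (n - k)))"
    by (rule Suc(1)) (simp add: definable_fun_lift Suc(2))
  from definable_subst_one [OF this Suc(2) [of k]]
  have "definable (\<lambda>e. P (\<lambda>n. if n < k then f n e else case_nat (f k e) e (n - k)))"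
    by (simp only: nat.case lessI)
  moreover have "(\<lambda>n. if n < k then f n e else case_nat (f k e) e (n - k)) =
    (\<lambda>n. if n < Suc k then f n e else e (n - Suc k))" for e
    by (rule ext) (auto simp: less_Suc_eq Suc_diff_Suc [of k, symmetric])
  ultimately show ?case by simp
qed

lemma definable_subst1: "definable (\<lambda>e. P (e 0)) \<Longrightarrow> definable_fun f \<Longrightarrow> definable (\<lambda>e. P (f e))"
  by (drule definable_subst [where k=1 and f="\<lambda>_. f"]) simp_all

lemma definable_subst2:
  assumes "definable (\<lambda>e. P (e 0) (e (Suc 0)))" "definable_fun f" "definable_fun g" shows "definable (\<lambda>e. P (f e) (g e))"
  using definable_subst [OF assms(1), of 2 "case_nat f (\<lambda>_. g)"] assms(2,3)
  by (simp split: nat.split)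

lemma definable_subst3:
  assumes "definable (\<lambda>e. P (e 0) (e (Suc 0)) (e (Suc (Suc 0))))" "definable_fun f" "definable_fun g" "definable_fun h"
  shows "definable (\<lambda>e. P (f e) (g e) (h e))"
  using definable_subst [OF assms(1), of 3 "case_nat f (case_nat g (\<lambda>_. h))"] assms(2-)
  by (simp split: nat.split)

lemma definable_subst4:
  assumes "definable (\<lambda>e. P (e 0) (e (Suc 0)) (e (Suc (Suc 0))) (e (Suc (Suc (Suc 0)))))"
    "definable_fun f" "definable_fun g" "definable_fun h" "definable_fun k"
  shows "definable (\<lambda>e. P (f e) (g e) (h e) (k e))"
  using definable_subst [OF assms(1), of 4 "case_nat f (case_nat g (case_nat h (\<lambda>_. k)))"] assms(2-)
  by (simp split: nat.split)

lemma definable_fun_var: "definable_fun (\<lambda>e. e k)" and definable_fun_const: "definable_fun (\<lambda>e. c)"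
  by (intro definable_fun_if_tm bounded_intros)+

lemma definable_fun_subst1: "definable_fun (\<lambda>e. F (e 0)) \<Longrightarrow> definable_fun f \<Longrightarrow> definable_fun (\<lambda>e. F (f e))"
  unfolding definable_fun_def [of "\<lambda>e. F (e 0)"] definable_fun_def [of "\<lambda>e. F (f e)"]
  by (rule definable_subst2 [where P="\<lambda>x y. x = F y"]) (auto intro: definable_fun_var definable_fun_lift)

lemma definable_fun_subst2: "definable_fun (\<lambda>e. F (e 0) (e (Suc 0))) \<Longrightarrow> definable_fun f \<Longrightarrow> definable_fun g \<Longrightarrow> definable_fun (\<lambda>e. F (f e) (g e))"
  unfolding definable_fun_def [of "\<lambda>e. F (e 0) (e (Suc 0))"] definable_fun_def [of "\<lambda>e. F (f e) (g e)"]
  by (rule definable_subst3 [where P="\<lambda>x y z. x = F y z"]) (auto intro: definable_fun_var definable_fun_lift)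

lemma definable_fun_subst3:
  "definable_fun (\<lambda>e. F (e 0) (e (Suc 0)) (e (Suc (Suc 0)))) \<Longrightarrow> definable_fun f \<Longrightarrow> definable_fun g \<Longrightarrow> definable_fun h \<Longrightarrow>
    definable_fun (\<lambda>e. F (f e) (g e) (h e))"
  unfolding definable_fun_def [of "\<lambda>e. F (e 0) (e (Suc 0)) (e (Suc (Suc 0)))"] definable_fun_def [of "\<lambda>e. F (f e) (g e) (h e)"]
  by (rule definable_subst4 [where P="\<lambda>x y z w. x = F y z w"]) (auto intro: definable_fun_var definable_fun_lift)

lemma definable_fun_arith:
  "definable_fun f \<Longrightarrow> definable_fun g \<Longrightarrow> definable_fun (\<lambda>e. f e \<oplus> g e)" "definable_fun f \<Longrightarrow> definable_fun g \<Longrightarrow> definable_fun (\<lambda>e. f e \<otimes> g e)"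
  "definable_fun f \<Longrightarrow> definable_fun g \<Longrightarrow> definable_fun (\<lambda>e. pair M (f e) (g e))" "definable_fun f \<Longrightarrow> definable_fun g \<Longrightarrow> definable_fun (\<lambda>e. fimp M (f e) (g e))"
  "definable_fun f \<Longrightarrow> definable_fun (\<lambda>e. fbox M (f e))"
  using definable_fun_subst2 [of "(\<oplus>)" f g] definable_fun_subst2 [of "(\<otimes>)" f g] definable_fun_subst2 [of "pair M" f g]
    definable_fun_subst2 [of "fimp M" f g] definable_fun_subst1 [of "fbox M" f]
  by (simp_all add: definable_fun_if_tm definable_tm_var definable_tm_add definable_tm_mul definable_tm_pair definable_tm_fimp definable_tm_fbox)

lemma definable_atoms:
  "definable_fun f \<Longrightarrow> definable_fun g \<Longrightarrow> definable (\<lambda>e. f e = g e)" "definable_fun f \<Longrightarrow> definable_fun g \<Longrightarrow> definable (\<lambda>e. f e \<prec> g e)"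
  "X \<in> sets \<Longrightarrow> definable_fun f \<Longrightarrow> definable (\<lambda>e. f e \<in> X)" "R \<in> sets \<Longrightarrow> definable_fun f \<Longrightarrow> definable_fun g \<Longrightarrow> definable (\<lambda>e. rel M R (f e) (g e))"
  by (rule definable_subst2 definable_subst1, intro bounded_intros definable_rel, assumption+)+

lemma definable_le: "definable_fun f \<Longrightarrow> definable_fun g \<Longrightarrow> definable (\<lambda>e. f e \<preceq> g e)"
  unfolding le_def by (intro definable_disj definable_atoms)

text \<open>These rules include the unbounded quantifiers, so from here on
  \<open>bounded_induct\<close> and \<open>comprehension\<close> act as full arithmetical induction
  and comprehension.\<close>

lemmas arith_intros = definable_fun_var definable_fun_const definable_fun_arith definable_atoms definable_le definable_not definable_conj definable_disj definable_imp definable_iff definable_ex definable_all definable_const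

lemma definable_fun_if: assumes "definable P" "definable_fun f" "definable_fun g" shows "definable_fun (\<lambda>e. if P e then f e else g e)"
proof -
  have "definable (\<lambda>e. (P (\<lambda>n. e (Suc n)) \<longrightarrow> e 0 = f (\<lambda>n. e (Suc n))) \<and>
    (\<not> P (\<lambda>n. e (Suc n)) \<longrightarrow> e 0 = g (\<lambda>n. e (Suc n))))"
    using assms(2,3) definable_rename [OF assms(1), of Suc] unfolding definable_fun_def by (intro definable_conj definable_imp definable_not)
  moreover have "(\<lambda>e. (P (\<lambda>n. e (Suc n)) \<longrightarrow> e 0 = f (\<lambda>n. e (Suc n))) \<and>
    (\<not> P (\<lambda>n. e (Suc n)) \<longrightarrow> e 0 = g (\<lambda>n. e (Suc n)))) =
    (\<lambda>e. e 0 = (if P (\<lambda>n. e (Suc n)) then f (\<lambda>n. e (Suc n)) else g (\<lambda>n. e (Suc n))))"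
    by auto
  ultimately show ?thesis unfolding definable_fun_def by simp
qed

section \<open>Goedel's beta lemma inside the model\<close>

lemma division: assumes "\<zero> \<prec> m" shows "\<exists>q r. a = q \<otimes> m \<oplus> r \<and> r \<prec> m"
proof (rule bounded_induct [where P="\<lambda>a. \<exists>q r. a = q \<otimes> m \<oplus> r \<and> r \<prec> m"])
  show "definable (\<lambda>e. \<exists>q r. e 0 = q \<otimes> m \<oplus> r \<and> r \<prec> m)" by (intro arith_intros)
  show "\<exists>q r. \<zero> = q \<otimes> m \<oplus> r \<and> r \<prec> m" using assms by (intro exI [of _ \<zero>]) simp
  fix a assume "\<exists>q r. a = q \<otimes> m \<oplus> r \<and> r \<prec> m"
  then obtain q r where a: "a = q \<otimes> m \<oplus> r" "r \<prec> m" by blast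
  then consider "r \<oplus> \<one> \<prec> m" | "r \<oplus> \<one> = m" using add_one_le le_def by blast
  then show "\<exists>q r. a \<oplus> \<one> = q \<otimes> m \<oplus> r \<and> r \<prec> m"
  proof cases
    case 1
    then show ?thesis using a add_assoc by metis
  next
    case 2
    have "a \<oplus> \<one> = q \<otimes> m \<oplus> m" using a 2 add_assoc by metis
    also have "\<dots> = (q \<oplus> \<one>) \<otimes> m \<oplus> \<zero>" by (simp add: distrib_right)
    finally show ?thesis using assms by blast
  qed
qed

text \<open>Existence of remainders removes the \<open>THE\<close>, and the graph of
  \<open>beta\<close> becomes visibly arithmetical.\<close>

lemma beta_iff:
  "beta M a b i = r \<longleftrightarrow> r \<prec> (i \<oplus> \<one>) \<otimes> b \<oplus> \<one> \<and> (\<exists>q. a = q \<otimes> ((i \<oplus> \<one>) \<otimes> b \<oplus> \<one>) \<oplus> r)"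
proof -
  have "\<zero> \<prec> (i \<oplus> \<one>) \<otimes> b \<oplus> \<one>" by (simp add: less_add_one)
  then obtain q s where s: "a = q \<otimes> ((i \<oplus> \<one>) \<otimes> b \<oplus> \<one>) \<oplus> s" "s \<prec> (i \<oplus> \<one>) \<otimes> b \<oplus> \<one>"
    using division by blast
  show ?thesis
  proof
    assume "beta M a b i = r"
    then have "r = s" using beta_eqI [OF s] by simp
    then show "r \<prec> (i \<oplus> \<one>) \<otimes> b \<oplus> \<one> \<and> (\<exists>q. a = q \<otimes> ((i \<oplus> \<one>) \<otimes> b \<oplus> \<one>) \<oplus> r)"
      using s by blast
  qed (elim conjE exE, rule beta_eqI)
qed

lemma definable_fun_beta: "definable_fun f \<Longrightarrow> definable_fun g \<Longrightarrow> definable_fun h \<Longrightarrow> definable_fun (\<lambda>e. beta M (f e) (g e) (h e))"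
proof (rule definable_fun_subst3 [where F="beta M"])
  have "definable (\<lambda>e. beta M (e (Suc 0)) (e (Suc (Suc 0))) (e (Suc (Suc (Suc 0)))) = e 0)"
    unfolding beta_iff by (intro arith_intros)
  then show "definable_fun (\<lambda>e. beta M (e 0) (e (Suc 0)) (e (Suc (Suc 0))))"
    unfolding definable_fun_def by (simp add: eq_commute)
qed (assumption+)

lemma bounded_values:
  assumes g: "definable_fun (\<lambda>e. g (e 0))" shows "\<exists>c. \<forall>i. i \<prec> n \<longrightarrow> g i \<prec> c"
proof (rule bounded_induct [where P="\<lambda>n. \<exists>c. \<forall>i. i \<prec> n \<longrightarrow> g i \<prec> c"])
  show "definable (\<lambda>e. \<exists>c. \<forall>i. i \<prec> e 0 \<longrightarrow> g i \<prec> c)" by (intro arith_intros definable_fun_subst1 [OF g])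
next
  fix n assume "\<exists>c. \<forall>i. i \<prec> n \<longrightarrow> g i \<prec> c"
  then obtain c where c: "\<And>i. i \<prec> n \<Longrightarrow> g i \<prec> c" by blast
  have "g i \<prec> c \<oplus> g n \<oplus> \<one>" if "i \<prec> n \<oplus> \<one>" for i
  proof (cases "i = n")
    case True
    then show ?thesis by (simp add: less_add_one le_add)
  next
    case False
    then have "g i \<preceq> c" using c that unfolding less_add_one_iff le_def by blast
    then show ?thesis unfolding less_add_one
      using le_iff_add ar.order_trans by blast
  qed
  then show "\<exists>c. \<forall>i. i \<prec> n \<oplus> \<one> \<longrightarrow> g i \<prec> c" by blast
qed simp

text \<open>A substitute for the factorial in Goedel's construction; only divisibility by the
  positive numbers below n matters.\<close>

lemma common_multiple: "\<exists>b. \<zero> \<prec> b \<and> (\<forall>k. \<zero> \<prec> k \<longrightarrow> k \<prec> n \<longrightarrow> (\<exists>c. b = c \<otimes> k))"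
proof (rule bounded_induct [where P="\<lambda>n. \<exists>b. \<zero> \<prec> b \<and> (\<forall>k. \<zero> \<prec> k \<longrightarrow> k \<prec> n \<longrightarrow> (\<exists>c. b = c \<otimes> k))"])
  show "definable (\<lambda>e. \<exists>b. \<zero> \<prec> b \<and> (\<forall>k. \<zero> \<prec> k \<longrightarrow> k \<prec> e 0 \<longrightarrow> (\<exists>c. b = c \<otimes> k)))"
    by (intro arith_intros)
next
  fix n assume "\<exists>b. \<zero> \<prec> b \<and> (\<forall>k. \<zero> \<prec> k \<longrightarrow> k \<prec> n \<longrightarrow> (\<exists>c. b = c \<otimes> k))"
  then obtain b where b: "\<zero> \<prec> b" "\<And>k. \<zero> \<prec> k \<Longrightarrow> k \<prec> n \<Longrightarrow> \<exists>c. b = c \<otimes> k" by blast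
  show "\<exists>b. \<zero> \<prec> b \<and> (\<forall>k. \<zero> \<prec> k \<longrightarrow> k \<prec> n \<oplus> \<one> \<longrightarrow> (\<exists>c. b = c \<otimes> k))"
  proof (cases "n = \<zero>")
    case True
    then show ?thesis using b(1) unfolding less_add_one_iff by auto
  next
    case False
    then have "\<zero> \<prec> b \<otimes> n" using b(1) zero_le [of n] by (auto simp: le_def)
    moreover have "\<exists>c. b \<otimes> n = c \<otimes> k" if k: "\<zero> \<prec> k" "k \<prec> n \<oplus> \<one>" for k
    proof (cases "k = n")
      case False
      then obtain c where "b = c \<otimes> k" using b(2) k unfolding less_add_one_iff by blast
      then have "b \<otimes> n = (c \<otimes> n) \<otimes> k" by (simp add: algebra_simps)
      then show ?thesis ..
    qed auto
    ultimately show ?thesis by blast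
  qed
qed (use zero_less_one not_less_zero in blast)

text \<open>Modulo k + 1 the hypothesis makes u x equal to -1, and k is -1 as well, so u k inverts
  x. Without negative numbers the two signs of a Bezout identity are different statements.\<close>

lemma bezout_swap:
  assumes "v \<otimes> (k \<oplus> \<one>) = u \<otimes> x \<oplus> \<one>" "k \<noteq> \<zero>"
  shows "\<exists>u' v'. u' \<otimes> x = v' \<otimes> (k \<oplus> \<one>) \<oplus> \<one>"
proof -
  have "v \<noteq> \<zero>" using assms(1) robinson_axioms(1) by (metis ar.mult_zero_left)
  then obtain w where w: "k \<otimes> v = w \<oplus> \<one>" using assms(2) exists_pred ar.no_zero_divisors by metis
  have "(u \<otimes> k) \<otimes> x \<oplus> k = k \<otimes> (u \<otimes> x \<oplus> \<one>)" by (simp add: algebra_simps)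
  also have "\<dots> = (w \<oplus> \<one>) \<otimes> (k \<oplus> \<one>)"
    unfolding assms(1) [symmetric] w [symmetric] by (simp add: algebra_simps)
  also have "\<dots> = (w \<otimes> (k \<oplus> \<one>) \<oplus> \<one>) \<oplus> k" by (simp add: algebra_simps)
  finally show ?thesis unfolding add_right_cancel by blast
qed

text \<open>For I = i + 1, J = j + 1 and d = J - I the number b is a multiple c d. Then J c I + J b
  = J J c, whence (J c I + 1)(J b + 1) = J J c (I b + 1) + 1. This has the wrong sign, which
  \<open>bezout_swap\<close> corrects.\<close>

lemma beta_moduli_coprime:
  assumes "i \<prec> j" "\<zero> \<prec> b" and b: "\<And>k. \<zero> \<prec> k \<Longrightarrow> k \<prec> n \<Longrightarrow> \<exists>c. b = c \<otimes> k" and "j \<prec> n"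
  shows "\<exists>u v. u \<otimes> ((i \<oplus> \<one>) \<otimes> b \<oplus> \<one>) = v \<otimes> ((j \<oplus> \<one>) \<otimes> b \<oplus> \<one>) \<oplus> \<one>"
proof -
  obtain z where z: "j = i \<oplus> (z \<oplus> \<one>)" using assms(1) robinson_axioms(8) by metis
  have "z \<oplus> \<one> \<preceq> j" using z le_add by simp
  then have "z \<oplus> \<one> \<prec> n" using assms(4) ar.le_less_trans by blast
  moreover have "\<zero> \<prec> z \<oplus> \<one>" by (simp add: less_add_one)
  ultimately obtain c where c: "b = c \<otimes> (z \<oplus> \<one>)" using b by blast
  define I J d where "I = i \<oplus> \<one>" and "J = j \<oplus> \<one>" and "d = z \<oplus> \<one>"
  have J: "J = I \<oplus> d" unfolding I_def J_def d_def z by (simp add: ar.add_ac)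
  have "J \<otimes> (J \<otimes> c) = (I \<oplus> d) \<otimes> (J \<otimes> c)" by (simp only: J)
  then have "(J \<otimes> J \<otimes> c) \<otimes> (I \<otimes> b \<oplus> \<one>) \<oplus> \<one> =
    (J \<otimes> J \<otimes> c) \<otimes> (I \<otimes> b) \<oplus> (I \<oplus> d) \<otimes> (J \<otimes> c) \<oplus> \<one>"
    by (simp add: distrib_left mul_assoc)
  also have "\<dots> = (J \<otimes> c \<otimes> I \<oplus> \<one>) \<otimes> (J \<otimes> b \<oplus> \<one>)"
    unfolding c d_def [symmetric] by (simp add: algebra_simps)
  finally have bezout: "(J \<otimes> c \<otimes> I \<oplus> \<one>) \<otimes> (J \<otimes> b \<oplus> \<one>) = (J \<otimes> J \<otimes> c) \<otimes> (I \<otimes> b \<oplus> \<one>) \<oplus> \<one>" ..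
  show ?thesis
  proof (rule bezout_swap)
    show "((j \<oplus> \<one>) \<otimes> c \<otimes> (i \<oplus> \<one>) \<oplus> \<one>) \<otimes> ((j \<oplus> \<one>) \<otimes> b \<oplus> \<one>) =
      ((j \<oplus> \<one>) \<otimes> (j \<oplus> \<one>) \<otimes> c) \<otimes> ((i \<oplus> \<one>) \<otimes> b \<oplus> \<one>) \<oplus> \<one>"
      using bezout unfolding I_def J_def .
    show "(j \<oplus> \<one>) \<otimes> b \<noteq> \<zero>"
      using assms(2) ar.no_zero_divisors robinson_axioms(1) ar.less_irrefl by metis
  qed
qed

text \<open>The Chinese remainder theorem by internal induction on the number k of congruences.
  Besides a solution \<open>a\<close>, the hypothesis carries a common multiple \<open>p\<close> of
  the first k moduli that is invertible modulo every later one.\<close>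

theorem beta_exists:
  assumes g: "definable_fun (\<lambda>e. g (e 0))"
  obtains a b where "\<And>i. i \<prec> n \<Longrightarrow> beta M a b i = g i"
proof -
  obtain c where c: "\<And>i. i \<prec> n \<Longrightarrow> g i \<prec> c" using bounded_values [OF g] by blast
  obtain b0 where b0: "\<zero> \<prec> b0" "\<And>k. \<zero> \<prec> k \<Longrightarrow> k \<prec> n \<Longrightarrow> \<exists>c. b0 = c \<otimes> k"
    using common_multiple by blast
  \<comment> \<open>The factor \<open>b0\<close> makes the moduli pairwise coprime, the factor c + 1
    makes them larger than all values of \<open>g\<close>.\<close>
  define b where "b = b0 \<otimes> (c \<oplus> \<one>)"
  define m where "m i = (i \<oplus> \<one>) \<otimes> b \<oplus> \<one>" for i
  have b_pos: "\<zero> \<prec> b" unfolding b_def using b0(1) by (simp add: less_add_one)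
  have b_multiple: "\<exists>d. b = d \<otimes> k" if k: "\<zero> \<prec> k" "k \<prec> n" for k
  proof -
    obtain d where "b0 = d \<otimes> k" using b0(2) k by blast
    then have "b = (d \<otimes> (c \<oplus> \<one>)) \<otimes> k" unfolding b_def by (simp add: algebra_simps)
    then show ?thesis ..
  qed
  have g_less: "g i \<prec> m i" if "i \<prec> n" for i
  proof -
    obtain b1 where b1: "b0 = b1 \<oplus> \<one>" using b0(1) exists_pred by fastforce
    have "m i = (i \<otimes> b \<oplus> b1 \<otimes> (c \<oplus> \<one>) \<oplus> \<one> \<oplus> \<one>) \<oplus> c"
      unfolding m_def b_def b1 by (simp add: algebra_simps)
    then have "c \<preceq> m i" using le_add by metis
    then show ?thesis using c [OF that] ar.less_le_trans by blast
  qed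
  have "k \<preceq> n \<longrightarrow> (\<exists>a p. (\<forall>i. i \<prec> k \<longrightarrow> (\<exists>q. p = q \<otimes> m i)) \<and> (\<forall>i. i \<prec> k \<longrightarrow> (\<exists>q. a = q \<otimes> m i \<oplus> g i)) \<and>
    (\<forall>j. k \<preceq> j \<longrightarrow> j \<prec> n \<longrightarrow> (\<exists>u v. u \<otimes> p = v \<otimes> m j \<oplus> \<one>)))" for k
  proof (rule bounded_induct [where x=k and P="\<lambda>k. k \<preceq> n \<longrightarrow> (\<exists>a p. (\<forall>i. i \<prec> k \<longrightarrow> (\<exists>q. p = q \<otimes> m i)) \<and>
    (\<forall>i. i \<prec> k \<longrightarrow> (\<exists>q. a = q \<otimes> m i \<oplus> g i)) \<and> (\<forall>j. k \<preceq> j \<longrightarrow> j \<prec> n \<longrightarrow> (\<exists>u v. u \<otimes> p = v \<otimes> m j \<oplus> \<one>)))"])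
    show "definable (\<lambda>e. e 0 \<preceq> n \<longrightarrow> (\<exists>a p. (\<forall>i. i \<prec> e 0 \<longrightarrow> (\<exists>q. p = q \<otimes> m i)) \<and>
      (\<forall>i. i \<prec> e 0 \<longrightarrow> (\<exists>q. a = q \<otimes> m i \<oplus> g i)) \<and> (\<forall>j. e 0 \<preceq> j \<longrightarrow> j \<prec> n \<longrightarrow> (\<exists>u v. u \<otimes> p = v \<otimes> m j \<oplus> \<one>))))"
      unfolding m_def by (intro arith_intros definable_fun_subst1 [OF g])
    have "\<one> \<otimes> \<one> = \<zero> \<otimes> m j \<oplus> \<one>" for j by simp
    then show "\<zero> \<preceq> n \<longrightarrow> (\<exists>a p. (\<forall>i. i \<prec> \<zero> \<longrightarrow> (\<exists>q. p = q \<otimes> m i)) \<and>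
      (\<forall>i. i \<prec> \<zero> \<longrightarrow> (\<exists>q. a = q \<otimes> m i \<oplus> g i)) \<and> (\<forall>j. \<zero> \<preceq> j \<longrightarrow> j \<prec> n \<longrightarrow> (\<exists>u v. u \<otimes> p = v \<otimes> m j \<oplus> \<one>)))"
      using not_less_zero by blast
  next
    fix k
    assume IH: "k \<preceq> n \<longrightarrow> (\<exists>a p. (\<forall>i. i \<prec> k \<longrightarrow> (\<exists>q. p = q \<otimes> m i)) \<and> (\<forall>i. i \<prec> k \<longrightarrow> (\<exists>q. a = q \<otimes> m i \<oplus> g i)) \<and>
      (\<forall>j. k \<preceq> j \<longrightarrow> j \<prec> n \<longrightarrow> (\<exists>u v. u \<otimes> p = v \<otimes> m j \<oplus> \<one>)))"
    show "k \<oplus> \<one> \<preceq> n \<longrightarrow> (\<exists>a p. (\<forall>i. i \<prec> k \<oplus> \<one> \<longrightarrow> (\<exists>q. p = q \<otimes> m i)) \<and>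
      (\<forall>i. i \<prec> k \<oplus> \<one> \<longrightarrow> (\<exists>q. a = q \<otimes> m i \<oplus> g i)) \<and>
      (\<forall>j. k \<oplus> \<one> \<preceq> j \<longrightarrow> j \<prec> n \<longrightarrow> (\<exists>u v. u \<otimes> p = v \<otimes> m j \<oplus> \<one>)))"
    proof
      assume "k \<oplus> \<one> \<preceq> n"
      then have k: "k \<prec> n" "k \<preceq> n" by (simp_all add: add_one_le)
      then obtain a p where p: "\<And>i. i \<prec> k \<Longrightarrow> \<exists>q. p = q \<otimes> m i"
        and a: "\<And>i. i \<prec> k \<Longrightarrow> \<exists>q. a = q \<otimes> m i \<oplus> g i"
        and co: "\<And>j. k \<preceq> j \<Longrightarrow> j \<prec> n \<Longrightarrow> \<exists>u v. u \<otimes> p = v \<otimes> m j \<oplus> \<one>"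
        using IH by blast
      obtain u v where uv: "u \<otimes> p = v \<otimes> m k \<oplus> \<one>" using co [of k] k by auto
      define d where "d = (k \<oplus> \<one>) \<otimes> b"
      \<comment> \<open>Here u p is 1 modulo \<open>m k\<close> and 0 modulo the earlier moduli,
        while d = m k - 1 acts as -1. So the old residues survive, and modulo \<open>m k\<close> the
        result is a + (g k - a) = g k.\<close>
      define a' where "a' = a \<oplus> u \<otimes> p \<otimes> (g k \<oplus> d \<otimes> a)"
      have "\<exists>q. p \<otimes> m k = q \<otimes> m i" if i: "i \<prec> k \<oplus> \<one>" for i
      proof (cases "i = k")
        case False
        then obtain q where "p = q \<otimes> m i" using p i unfolding less_add_one_iff by blast
        then have "p \<otimes> m k = (q \<otimes> m k) \<otimes> m i" by (simp add: ar.mult_ac)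
        then show ?thesis ..
      qed auto
      moreover have "\<exists>q. a' = q \<otimes> m i \<oplus> g i" if i: "i \<prec> k \<oplus> \<one>" for i
      proof (cases "i = k")
        case True
        have "a' = (v \<otimes> (g k \<oplus> d \<otimes> a) \<oplus> a) \<otimes> m k \<oplus> g k"
          unfolding a'_def uv unfolding m_def d_def [symmetric] by (simp add: algebra_simps)
        then show ?thesis using True by blast
      next
        case False
        then obtain q r where "a = q \<otimes> m i \<oplus> g i" "p = r \<otimes> m i"
          using a p i unfolding less_add_one_iff by blast
        then have "a' = (q \<oplus> u \<otimes> r \<otimes> (g k \<oplus> d \<otimes> a)) \<otimes> m i \<oplus> g i"
          unfolding a'_def by (simp add: algebra_simps)
        then show ?thesis ..
      qed
      moreover have "\<exists>u v. u \<otimes> (p \<otimes> m k) = v \<otimes> m j \<oplus> \<one>" if "k \<oplus> \<one> \<preceq> j" "j \<prec> n" for j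
      proof -
        have "k \<prec> j" using that(1) by (simp add: add_one_le)
        then obtain u v u' v' where "u \<otimes> p = v \<otimes> m j \<oplus> \<one>" "u' \<otimes> m k = v' \<otimes> m j \<oplus> \<one>"
          using co [OF _ \<open>j \<prec> n\<close>] beta_moduli_coprime [OF _ b_pos b_multiple \<open>j \<prec> n\<close>]
          unfolding m_def le_def by blast
        \<comment> \<open>Multiplying inverses of \<open>p\<close> and of \<open>m k\<close> modulo
          \<open>m j\<close> gives one of their product.\<close>
        then have "(u \<otimes> p) \<otimes> (u' \<otimes> m k) = (v \<otimes> m j \<oplus> \<one>) \<otimes> (v' \<otimes> m j \<oplus> \<one>)" by simp
        then have "(u \<otimes> u') \<otimes> (p \<otimes> m k) = (v \<otimes> v' \<otimes> m j \<oplus> v \<oplus> v') \<otimes> m j \<oplus> \<one>"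
          by (simp add: ar.distrib_right ar.distrib_left ar.mult_ac ar.add_ac)
        then show ?thesis by blast
      qed
      ultimately show "\<exists>a p. (\<forall>i. i \<prec> k \<oplus> \<one> \<longrightarrow> (\<exists>q. p = q \<otimes> m i)) \<and>
        (\<forall>i. i \<prec> k \<oplus> \<one> \<longrightarrow> (\<exists>q. a = q \<otimes> m i \<oplus> g i)) \<and>
        (\<forall>j. k \<oplus> \<one> \<preceq> j \<longrightarrow> j \<prec> n \<longrightarrow> (\<exists>u v. u \<otimes> p = v \<otimes> m j \<oplus> \<one>))" by blast
    qed
  qed
  from this [of n] obtain a where a: "\<And>i. i \<prec> n \<Longrightarrow> \<exists>q. a = q \<otimes> m i \<oplus> g i" by auto
  show ?thesis
  proof
    show "beta M a b i = g i" if "i \<prec> n" for i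
      using a [OF that] g_less [OF that] unfolding m_def beta_iff by blast
  qed
qed

end

section \<open>Extending assignments to valuations\<close>

context rca begin

section \<open>Propositional variables and assignments\<close>

lemma Prop_in_sets: "Prop M \<in> sets"
proof -
  have "Prop M = {p. p \<noteq> \<zero> \<and> (\<forall>\<phi>. \<phi> \<prec> p \<longrightarrow> (\<forall>\<psi>. \<psi> \<prec> p \<longrightarrow> p \<noteq> fimp M \<phi> \<psi>)) \<and> (\<forall>\<phi>. \<phi> \<prec> p \<longrightarrow> p \<noteq> fbox M \<phi>)}"
    unfolding Prop_def fbot_def using subformula_less by blast
  also have "\<dots> \<in> sets"
    by (intro comprehension bounded_intros definable_tm_fimp definable_tm_fbox)
  finally show ?thesis .
qed

text \<open>A concrete variable for the correspondence arguments: three is a nonzero multiple of 3.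
  Division is again avoided, by comparing x with one.\<close>

lemma triple_in_Prop: "\<one> \<oplus> \<one> \<oplus> \<one> \<in> Prop M"
proof -
  have three_less: "\<one> \<oplus> \<one> \<oplus> \<one> \<prec> x \<oplus> x \<oplus> x \<oplus> \<one>" if "\<not> x \<prec> \<one>" for x
    unfolding less_add_one using that by (intro ar.add_mono) (simp_all add: ar.not_less)
  have "\<one> \<oplus> \<one> \<oplus> \<one> \<noteq> x \<oplus> x \<oplus> x \<oplus> \<one> \<and> \<one> \<oplus> \<one> \<oplus> \<one> \<noteq> x \<oplus> x \<oplus> x \<oplus> \<one> \<oplus> \<one>" for x
  proof (cases "x \<prec> \<one>")
    case True
    have "x \<oplus> x \<oplus> x \<oplus> \<one> \<prec> x \<oplus> x \<oplus> x \<oplus> \<one> \<oplus> \<one>" by (simp only: less_add_one ar.order_refl)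
    with triple_less [OF True] show ?thesis by (metis ar.less_irrefl ar.less_trans)
  next
    case False
    then have "\<one> \<oplus> \<one> \<oplus> \<one> \<prec> x \<oplus> x \<oplus> x \<oplus> \<one>" by (rule three_less)
    moreover from this have "\<one> \<oplus> \<one> \<oplus> \<one> \<prec> x \<oplus> x \<oplus> x \<oplus> \<one> \<oplus> \<one>"
      by (simp only: less_add_one le_def simp_thms)
    ultimately show ?thesis by (metis ar.less_irrefl)
  qed
  moreover have "\<one> \<oplus> \<one> \<oplus> \<one> \<noteq> \<zero>" by (rule robinson_axioms)
  ultimately show ?thesis unfolding Prop_def fimp_def fbox_def fbot_def by blast
qed

text \<open>Every variable receives the truth set \<open>A\<close>. Statement 5 needs just some
  assignment, the correspondence results one with a prescribed truth set.\<close>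

lemma assignment_exists:
  assumes "W \<in> sets" "A \<in> sets"
  shows "\<exists>v. is_function M (cross M W (Prop M)) {\<zero>, \<one>} v \<and>
    (\<forall>w\<in>W. \<forall>p\<in>Prop M. pair M (pair M w p) \<one> \<in> v \<longleftrightarrow> w \<in> A)"
proof -
  define S where "S w r \<longleftrightarrow> (w \<in> A \<and> r = \<one>) \<or> (w \<notin> A \<and> r = \<zero>)" for w r
  define v where "v = {x. \<exists>y. y \<prec> x \<oplus> \<one> \<and> (\<exists>r. r \<prec> x \<oplus> \<one> \<and> (\<exists>w. w \<prec> y \<oplus> \<one> \<and> (\<exists>p. p \<prec> y \<oplus> \<one> \<and>
    x = pair M y r \<and> y = pair M w p \<and> w \<in> W \<and> p \<in> Prop M \<and> S w r)))}"
  have v_set: "v \<in> sets"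
    unfolding v_def S_def by (intro comprehension bounded_intros definable_tm_pair assms Prop_in_sets)
  have v: "pair M (pair M w p) r \<in> v \<longleftrightarrow> w \<in> W \<and> p \<in> Prop M \<and> S w r" for w p r
  proof
    show "pair M (pair M w p) r \<in> v" if "w \<in> W \<and> p \<in> Prop M \<and> S w r"
      unfolding v_def mem_Collect_eq less_add_one
      using that le_pair_left [of "pair M w p" r] le_pair_right [of r "pair M w p"]
        le_pair_left [of w p] le_pair_right [of p w] by blast
  qed (auto simp: v_def)
  have v_sub: "v \<subseteq> cross M (cross M W (Prop M)) {\<zero>, \<one>}"
    by (auto simp: v_def S_def)
  have v_ex: "\<exists>!r. pair M x r \<in> v" if "x \<in> cross M W (Prop M)" for x
  proof -
    obtain w p where "x = pair M w p" "w \<in> W" "p \<in> Prop M"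
      using \<open>x \<in> cross M W (Prop M)\<close> by (auto simp: cross_def)
    then show ?thesis by (auto simp: v S_def)
  qed
  show ?thesis
    using is_functionI [OF v_set v_sub v_ex] by (intro exI [of _ v] conjI) (auto simp: v S_def)
qed

end

context aca begin

text \<open>The entry \<open>two\<close> of a table means \<open>undefined\<close>; the entries \<open>0\<close> and \<open>1\<close> are truth values.\<close>

definition "two = \<one> \<oplus> \<one>"

lemma two_neq: "two \<noteq> \<zero>" "two \<noteq> \<one>"
  unfolding two_def using robinson_axioms(1) [of \<one>] robinson_axioms(2) [of \<one> \<zero>] by simp_all

text \<open>Three numbers code a table, so formulas can quantify over tables. Since
  \<open>beta\<close> is total, the cutoff \<open>n\<close> is what makes the table finite.\<close>

definition tab :: "'a \<Rightarrow> 'a \<Rightarrow> 'a \<Rightarrow> 'a \<Rightarrow> 'a" where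
  "tab a b n i = (if i \<prec> n then beta M a b i else two)"

lemma definable_fun_tab: "definable_fun f \<Longrightarrow> definable_fun g \<Longrightarrow> definable_fun h \<Longrightarrow> definable_fun k \<Longrightarrow> definable_fun (\<lambda>e. tab (f e) (g e) (h e) (k e))"
  unfolding tab_def by (intro definable_fun_if definable_fun_beta arith_intros)

definition finite_table :: "('a \<Rightarrow> 'a) \<Rightarrow> bool" where
  "finite_table t \<longleftrightarrow> definable_fun (\<lambda>e. t (e 0)) \<and> (\<exists>n. \<forall>i. n \<preceq> i \<longrightarrow> t i = two)"

text \<open>Codes are needed to quantify over tables within formulas, functions to merge and update
  them; \<open>beta_exists\<close> leads back from functions to codes.\<close>

lemma finite_table_iff: "finite_table t \<longleftrightarrow> (\<exists>a b n. t = tab a b n)"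
proof
  assume t: "finite_table t"
  then obtain n where n: "\<And>i. n \<preceq> i \<Longrightarrow> t i = two" unfolding finite_table_def by blast
  obtain a b where "\<And>i. i \<prec> n \<Longrightarrow> beta M a b i = t i"
    using beta_exists [of t n] t unfolding finite_table_def by blast
  then have "tab a b n i = t i" for i using n [of i] by (simp add: tab_def ar.not_less)
  then have "tab a b n = t" by (rule ext)
  then show "\<exists>a b n. t = tab a b n" by blast
next
  assume "\<exists>a b n. t = tab a b n"
  then obtain a b n where t: "t = tab a b n" by blast
  have "tab a b n i = two" if "n \<preceq> i" for i using that by (simp add: tab_def ar.leD)
  moreover have "definable_fun (\<lambda>e. tab a b n (e 0))" by (intro definable_fun_tab arith_intros)
  ultimately show "finite_table t" unfolding finite_table_def t by blast
qed

lemma definable_fun_finite_table: "finite_table t \<Longrightarrow> definable_fun f \<Longrightarrow> definable_fun (\<lambda>e. t (f e))"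
  unfolding finite_table_def using definable_fun_subst1 by blast

lemma finite_table_if:
  assumes "definable (\<lambda>e. P (e 0))" "finite_table t" "finite_table t'"
  shows "finite_table (\<lambda>i. if P i then t i else t' i)"
proof -
  obtain n n' where n: "\<And>i. n \<preceq> i \<Longrightarrow> t i = two" "\<And>i. n' \<preceq> i \<Longrightarrow> t' i = two"
    using assms(2,3) unfolding finite_table_def by blast
  have "(if P i then t i else t' i) = two" if "n \<oplus> n' \<preceq> i" for i
  proof -
    have "n \<preceq> i" "n' \<preceq> i" using that le_add le_iff_add ar.order_trans by blast+
    then show ?thesis by (simp add: n)
  qed
  moreover have "definable_fun (\<lambda>e. if P (e 0) then t (e 0) else t' (e 0))"
    using assms by (intro definable_fun_if) (simp_all add: finite_table_def)
  ultimately show ?thesis unfolding finite_table_def by blast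
qed

lemma finite_table_single: "finite_table (\<lambda>i. if i = c then r else two)"
proof -
  have "(if i = c then r else two) = two" if "c \<oplus> \<one> \<preceq> i" for i
    using that by (auto simp: add_one_le)
  moreover have "definable_fun (\<lambda>e. if e 0 = c then r else two)" by (intro definable_fun_if arith_intros)
  ultimately show ?thesis unfolding finite_table_def by blast
qed

context
  fixes W R v
  assumes frame: "frame M W R" and image_finite: "image_finite M W R"
    and v: "is_function M (cross M W (Prop M)) {\<zero>, \<one>} v"
begin

lemma in_sets: "W \<in> sets" "R \<in> sets" "v \<in> sets"
  using frame v by (auto simp: frame_def is_function_def)

text \<open>\<open>sub w \<psi> u \<chi>\<close>: the value at \<open>(w, \<psi>)\<close> depends directly on the one at \<open>(u, \<chi>)\<close>.\<close>

definition sub :: "'a \<Rightarrow> 'a \<Rightarrow> 'a \<Rightarrow> 'a \<Rightarrow> bool" where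
  "sub w \<psi> u \<chi> \<longleftrightarrow> (\<exists>\<delta>. \<psi> = fimp M \<chi> \<delta> \<and> u = w) \<or> (\<exists>\<delta>. \<psi> = fimp M \<delta> \<chi> \<and> u = w) \<or>
    (\<psi> = fbox M \<chi> \<and> u \<in> W \<and> rel M R w u)"

text \<open>The truth value prescribed by the entries one level down. The disjuncts exclude one
  another because \<open>v\<close> lives on variables only; none applies to falsum.\<close>

definition truth :: "('a \<Rightarrow> 'a) \<Rightarrow> 'a \<Rightarrow> 'a \<Rightarrow> bool" where
  "truth t w \<psi> \<longleftrightarrow>
    (\<exists>\<chi> \<delta>. \<psi> = fimp M \<chi> \<delta> \<and> (t (pair M w \<chi>) = \<one> \<longrightarrow> t (pair M w \<delta>) = \<one>)) \<or>
    (\<exists>\<chi>. \<psi> = fbox M \<chi> \<and> (\<forall>u. u \<in> W \<longrightarrow> rel M R w u \<longrightarrow> t (pair M u \<chi>) = \<one>)) \<or>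
    pair M (pair M w \<psi>) \<one> \<in> v"

text \<open>A decoded entry may be any number, so everything other than a truth value counts as
  undefined, not only \<open>two\<close>.\<close>

definition defd :: "('a \<Rightarrow> 'a) \<Rightarrow> 'a \<Rightarrow> 'a \<Rightarrow> bool" where
  "defd t w \<psi> \<longleftrightarrow> t (pair M w \<psi>) = \<zero> \<or> t (pair M w \<psi>) = \<one>"

definition good :: "('a \<Rightarrow> 'a) \<Rightarrow> bool" where
  "good t \<longleftrightarrow> (\<forall>w \<psi>. w \<in> W \<longrightarrow> defd t w \<psi> \<longrightarrow>
    (\<forall>u \<chi>. sub w \<psi> u \<chi> \<longrightarrow> defd t u \<chi>) \<and> (t (pair M w \<psi>) = \<one> \<longleftrightarrow> truth t w \<psi>))"

lemma truth_cong:
  assumes "\<And>u \<chi>. sub w \<psi> u \<chi> \<Longrightarrow> t (pair M u \<chi>) = \<one> \<longleftrightarrow> t' (pair M u \<chi>) = \<one>"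
  shows "truth t w \<psi> \<longleftrightarrow> truth t' w \<psi>"
  unfolding truth_def using assms unfolding sub_def by blast

lemma sub_less: "sub w \<psi> u \<chi> \<Longrightarrow> \<chi> \<prec> \<psi>"
  using subformula_less by (auto simp: sub_def)

lemma sub_in: "sub w \<psi> u \<chi> \<Longrightarrow> w \<in> W \<Longrightarrow> u \<in> W"
  by (auto simp: sub_def)

text \<open>Image-finiteness enters the construction here: a boxed formula depends on finitely many
  worlds, so one finite table can cover them.\<close>

lemma sub_bound: assumes "w \<in> W" shows "\<exists>b. \<forall>u \<chi>. sub w \<psi> u \<chi> \<longrightarrow> u \<prec> b"
proof -
  obtain b where b: "\<And>u. u \<in> W \<Longrightarrow> rel M R w u \<Longrightarrow> u \<prec> b"
    using image_finite assms unfolding image_finite_def by blast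
  have "u \<prec> w \<oplus> b \<oplus> \<one>" if "sub w \<psi> u \<chi>" for u \<chi>
  proof -
    have "u \<preceq> w \<or> u \<preceq> b" using that b unfolding sub_def le_def by blast
    then show ?thesis unfolding less_add_one using le_add le_iff_add ar.order_trans by blast
  qed
  then show ?thesis by blast
qed

lemma definable_sub: "definable_fun f \<Longrightarrow> definable_fun g \<Longrightarrow> definable_fun h \<Longrightarrow> definable_fun k \<Longrightarrow> definable (\<lambda>e. sub (f e) (g e) (h e) (k e))"
  by (rule definable_subst4) (unfold sub_def, intro arith_intros in_sets)

lemma definable_defd:
  assumes "finite_table t" shows "definable_fun f \<Longrightarrow> definable_fun g \<Longrightarrow> definable (\<lambda>e. defd t (f e) (g e))"
  unfolding defd_def by (intro arith_intros definable_fun_finite_table [OF assms])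

lemma definable_good_tab: "definable_fun f \<Longrightarrow> definable_fun g \<Longrightarrow> definable_fun h \<Longrightarrow> definable (\<lambda>e. good (tab (f e) (g e) (h e)))"
  by (rule definable_subst3) (unfold good_def defd_def sub_def truth_def, intro arith_intros definable_fun_tab in_sets)

lemma definable_defd_tab: "definable_fun f \<Longrightarrow> definable_fun g \<Longrightarrow> definable_fun h \<Longrightarrow> definable_fun k \<Longrightarrow> definable_fun l \<Longrightarrow>
    definable (\<lambda>e. defd (tab (f e) (g e) (h e)) (k e) (l e))"
  unfolding defd_def by (intro arith_intros definable_fun_tab)

lemma goodD:
  assumes "good t" "w \<in> W" "defd t w \<psi>"
  shows "sub w \<psi> u \<chi> \<Longrightarrow> defd t u \<chi>" "t (pair M w \<psi>) = \<one> \<longleftrightarrow> truth t w \<psi>"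
  using assms unfolding good_def by blast+

text \<open>Strong induction on the formula, for all worlds at once since a box refers to other
  worlds. Both tables are defined at all dependencies, agree there, and so meet the same truth
  condition.\<close>

lemma good_agree:
  assumes "finite_table t" "finite_table t'" "good t" "good t'"
    "w \<in> W" "defd t w \<psi>" "defd t' w \<psi>"
  shows "t (pair M w \<psi>) = t' (pair M w \<psi>)"
proof -
  have "\<forall>w. w \<in> W \<longrightarrow> defd t w \<psi> \<longrightarrow> defd t' w \<psi> \<longrightarrow> t (pair M w \<psi>) = t' (pair M w \<psi>)"
  proof (rule bounded_less_induct [where x=\<psi> and P="\<lambda>\<psi>. \<forall>w. w \<in> W \<longrightarrow> defd t w \<psi> \<longrightarrow> defd t' w \<psi> \<longrightarrow>
      t (pair M w \<psi>) = t' (pair M w \<psi>)"])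
    show "definable (\<lambda>e. \<forall>w. w \<in> W \<longrightarrow> defd t w (e 0) \<longrightarrow> defd t' w (e 0) \<longrightarrow> t (pair M w (e 0)) = t' (pair M w (e 0)))"
      by (intro arith_intros definable_defd [OF assms(1)] definable_defd [OF assms(2)]
        definable_fun_finite_table [OF assms(1)] definable_fun_finite_table [OF assms(2)] in_sets)
  next
    fix \<psi> assume IH: "\<And>\<chi>. \<chi> \<prec> \<psi> \<Longrightarrow> \<forall>w. w \<in> W \<longrightarrow> defd t w \<chi> \<longrightarrow> defd t' w \<chi> \<longrightarrow>
      t (pair M w \<chi>) = t' (pair M w \<chi>)"
    show "\<forall>w. w \<in> W \<longrightarrow> defd t w \<psi> \<longrightarrow> defd t' w \<psi> \<longrightarrow> t (pair M w \<psi>) = t' (pair M w \<psi>)"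
    proof (intro allI impI)
      fix w assume w: "w \<in> W" "defd t w \<psi>" "defd t' w \<psi>"
      have "truth t w \<psi> \<longleftrightarrow> truth t' w \<psi>"
      proof (rule truth_cong)
        fix u \<chi> assume sub: "sub w \<psi> u \<chi>"
        show "t (pair M u \<chi>) = \<one> \<longleftrightarrow> t' (pair M u \<chi>) = \<one>"
          using IH sub_less [OF sub] sub_in [OF sub w(1)]
            goodD(1) [OF assms(3) w(1,2) sub] goodD(1) [OF assms(4) w(1,3) sub] by metis
      qed
      then have "t (pair M w \<psi>) = \<one> \<longleftrightarrow> t' (pair M w \<psi>) = \<one>"
        using goodD(2) [OF assms(3) w(1,2)] goodD(2) [OF assms(4) w(1,3)] by blast
      then show "t (pair M w \<psi>) = t' (pair M w \<psi>)" using w(2,3) unfolding defd_def by metis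
    qed
  qed
  then show ?thesis using assms(5-7) by blast
qed

text \<open>The first table takes precedence. By \<open>good_agree\<close> the result still equals
  the second table wherever that one is defined, so closure and correctness carry over from
  both.\<close>

lemma good_merge:
  assumes "finite_table t" "finite_table t'" "good t" "good t'"
  obtains s where "finite_table s" "good s"
    "\<And>w \<psi>. w \<in> W \<Longrightarrow> defd s w \<psi> \<longleftrightarrow> defd t w \<psi> \<or> defd t' w \<psi>"
proof
  define s where "s i = (if t i = \<zero> \<or> t i = \<one> then t i else t' i)" for i
  show "finite_table s"
    unfolding s_def by (intro finite_table_if arith_intros definable_fun_finite_table [OF assms(1)] assms(1,2))
  show defd_s: "defd s w \<psi> \<longleftrightarrow> defd t w \<psi> \<or> defd t' w \<psi>" for w \<psi>
    by (auto simp: defd_def s_def)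
  have s: "s (pair M w \<psi>) = t (pair M w \<psi>)" if "defd t w \<psi>" for w \<psi>
    using that by (auto simp: defd_def s_def)
  have s': "s (pair M w \<psi>) = t' (pair M w \<psi>)" if "w \<in> W" "defd t' w \<psi>" for w \<psi>
    using that good_agree [OF assms] by (auto simp: defd_def s_def)
  have "truth s w \<psi> \<longleftrightarrow> truth t w \<psi>" if "w \<in> W" "defd t w \<psi>" for w \<psi>
    by (rule truth_cong) (use s goodD(1) [OF assms(3) that] in simp)
  moreover have "truth s w \<psi> \<longleftrightarrow> truth t' w \<psi>" if "w \<in> W" "defd t' w \<psi>" for w \<psi>
    by (rule truth_cong) (use s' sub_in [OF _ that(1)] goodD(1) [OF assms(4) that] in simp)
  ultimately show "good s"
    unfolding good_def defd_s using goodD [OF assms(3)] goodD [OF assms(4)] s s' by metis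
qed

lemma good_extend:
  assumes "finite_table t" "good t" "w \<in> W" "\<And>u \<chi>. sub w \<psi> u \<chi> \<Longrightarrow> defd t u \<chi>"
  obtains s where "finite_table s" "good s" "defd s w \<psi>"
proof (cases "defd t w \<psi>")
  case False
  \<comment> \<open>The inner test repeats the outer one to fit \<open>finite_table_if\<close> and
    \<open>finite_table_single\<close>; the value \<open>two\<close> inside is never
    reached.\<close>
  define s where "s i = (if i = pair M w \<psi> then (if i = pair M w \<psi> then if truth t w \<psi> then \<one> else \<zero> else two) else t i)" for i
  have s: "s (pair M u \<chi>) = t (pair M u \<chi>)" if "defd t u \<chi>" for u \<chi>
    using that False by (auto simp: s_def)
  have s_new: "s (pair M w \<psi>) = (if truth t w \<psi> then \<one> else \<zero>)" by (simp add: s_def)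
  have cong: "truth s u \<chi> \<longleftrightarrow> truth t u \<chi>" if "\<And>u' \<chi>'. sub u \<chi> u' \<chi>' \<Longrightarrow> defd t u' \<chi>'" for u \<chi>
    by (rule truth_cong) (simp add: s that)
  have defd_s: "defd s u \<chi> \<longleftrightarrow> defd t u \<chi> \<or> (u = w \<and> \<chi> = \<psi>)" for u \<chi>
    by (auto simp: defd_def s_def)
  show ?thesis
  proof
    show "finite_table s"
      unfolding s_def using assms(1) by (intro finite_table_if finite_table_single arith_intros)
    show "defd s w \<psi>" using defd_s by blast
    show "good s"
      unfolding good_def
    proof (intro allI impI)
      fix u \<chi> assume u: "u \<in> W" "defd s u \<chi>"
      show "(\<forall>u' \<chi>'. sub u \<chi> u' \<chi>' \<longrightarrow> defd s u' \<chi>') \<and> (s (pair M u \<chi>) = \<one> \<longleftrightarrow> truth s u \<chi>)"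
      proof (cases "defd t u \<chi>")
        case True
        then show ?thesis using goodD [OF assms(2) u(1) True] cong [of u \<chi>] s defd_s by metis
      next
        case False
        then have "u = w" "\<chi> = \<psi>" using u(2) defd_s by blast+
        then show ?thesis using assms(4) cong [of w \<psi>] s_new defd_s by auto
      qed
    qed
  qed
qed (use assms that in blast)

text \<open>Within the strong induction on the formula, a second induction on c merges tables for
  the dependencies with pair code below c. A suitable c covers them all, and one new entry completes
  the table.\<close>

lemma good_exists:
  assumes "w \<in> W" shows "\<exists>a b n. good (tab a b n) \<and> defd (tab a b n) w \<psi>"
proof -
  have "\<forall>w. w \<in> W \<longrightarrow> (\<exists>a b n. good (tab a b n) \<and> defd (tab a b n) w \<psi>)"
  proof (rule bounded_less_induct [where x=\<psi> and P="\<lambda>\<psi>. \<forall>w. w \<in> W \<longrightarrow> (\<exists>a b n. good (tab a b n) \<and> defd (tab a b n) w \<psi>)"])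
    show "definable (\<lambda>e. \<forall>w. w \<in> W \<longrightarrow> (\<exists>a b n. good (tab a b n) \<and> defd (tab a b n) w (e 0)))"
      by (intro arith_intros definable_good_tab definable_defd_tab in_sets)
  next
    fix \<psi> assume IH: "\<And>\<chi>. \<chi> \<prec> \<psi> \<Longrightarrow> \<forall>w. w \<in> W \<longrightarrow> (\<exists>a b n. good (tab a b n) \<and> defd (tab a b n) w \<chi>)"
    show "\<forall>w. w \<in> W \<longrightarrow> (\<exists>a b n. good (tab a b n) \<and> defd (tab a b n) w \<psi>)"
    proof (intro allI impI)
      fix w assume w: "w \<in> W"
      have cover: "\<exists>a b n. good (tab a b n) \<and> (\<forall>u \<chi>. sub w \<psi> u \<chi> \<longrightarrow> pair M u \<chi> \<prec> c \<longrightarrow> defd (tab a b n) u \<chi>)" for c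
      proof (rule bounded_induct [where x=c and P="\<lambda>c. \<exists>a b n. good (tab a b n) \<and>
          (\<forall>u \<chi>. sub w \<psi> u \<chi> \<longrightarrow> pair M u \<chi> \<prec> c \<longrightarrow> defd (tab a b n) u \<chi>)"])
        show "definable (\<lambda>e. \<exists>a b n. good (tab a b n) \<and> (\<forall>u \<chi>. sub w \<psi> u \<chi> \<longrightarrow> pair M u \<chi> \<prec> e 0 \<longrightarrow> defd (tab a b n) u \<chi>))"
          by (intro arith_intros definable_good_tab definable_defd_tab definable_sub)
        have "good (tab \<zero> \<zero> \<zero>)" using two_neq by (simp add: good_def defd_def tab_def)
        then show "\<exists>a b n. good (tab a b n) \<and> (\<forall>u \<chi>. sub w \<psi> u \<chi> \<longrightarrow> pair M u \<chi> \<prec> \<zero> \<longrightarrow> defd (tab a b n) u \<chi>)"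
          using not_less_zero by blast
      next
        fix c
        assume "\<exists>a b n. good (tab a b n) \<and> (\<forall>u \<chi>. sub w \<psi> u \<chi> \<longrightarrow> pair M u \<chi> \<prec> c \<longrightarrow> defd (tab a b n) u \<chi>)"
        then obtain t where t: "finite_table t" "good t"
          "\<And>u \<chi>. sub w \<psi> u \<chi> \<Longrightarrow> pair M u \<chi> \<prec> c \<Longrightarrow> defd t u \<chi>"
          unfolding finite_table_iff by blast
        have "\<exists>s. finite_table s \<and> good s \<and> (\<forall>u \<chi>. sub w \<psi> u \<chi> \<longrightarrow> pair M u \<chi> \<prec> c \<oplus> \<one> \<longrightarrow> defd s u \<chi>)"
        proof (cases "\<exists>u \<chi>. sub w \<psi> u \<chi> \<and> pair M u \<chi> = c")
          case True
          then obtain u \<chi> where u: "sub w \<psi> u \<chi>" "pair M u \<chi> = c" by blast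
          obtain t' where t': "finite_table t'" "good t'" "defd t' u \<chi>"
            using IH [OF sub_less [OF u(1)]] sub_in [OF u(1) w] unfolding finite_table_iff by blast
          obtain s where s: "finite_table s" "good s"
            "\<And>w \<psi>. w \<in> W \<Longrightarrow> defd s w \<psi> \<longleftrightarrow> defd t w \<psi> \<or> defd t' w \<psi>"
            using good_merge [OF t(1) t'(1) t(2) t'(2)] by blast
          have "defd s u' \<chi>'" if "sub w \<psi> u' \<chi>'" "pair M u' \<chi>' \<prec> c \<oplus> \<one>" for u' \<chi>'
          proof (cases "pair M u' \<chi>' = c")
            case True
            then have "u' = u" "\<chi>' = \<chi>" using u(2) pair_inj by metis+
            then show ?thesis using s(3) t'(3) sub_in [OF that(1) w] by blast
          next
            case False
            then show ?thesis using s(3) t(3) that sub_in [OF that(1) w] less_add_one_iff by blast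
          qed
          then show ?thesis using s(1,2) by blast
        next
          case False
          then show ?thesis using t less_add_one_iff by blast
        qed
        then show "\<exists>a b n. good (tab a b n) \<and> (\<forall>u \<chi>. sub w \<psi> u \<chi> \<longrightarrow> pair M u \<chi> \<prec> c \<oplus> \<one> \<longrightarrow> defd (tab a b n) u \<chi>)"
          unfolding finite_table_iff by blast
      qed
      obtain d where d: "\<And>u \<chi>. sub w \<psi> u \<chi> \<Longrightarrow> u \<prec> d" using sub_bound [OF w] by blast
      obtain t where t: "finite_table t" "good t"
        "\<And>u \<chi>. sub w \<psi> u \<chi> \<Longrightarrow> pair M u \<chi> \<prec> pair M d \<psi> \<oplus> \<one> \<Longrightarrow> defd t u \<chi>"
        using cover [of "pair M d \<psi> \<oplus> \<one>"] unfolding finite_table_iff by blast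
      \<comment> \<open>Worlds are bounded by \<open>d\<close> and formulas by \<psi>, so
        monotonicity of pairing puts every dependency below the chosen bound.\<close>
      have "pair M u \<chi> \<prec> pair M d \<psi> \<oplus> \<one>" if "sub w \<psi> u \<chi>" for u \<chi>
        unfolding less_add_one
        using d [OF that] sub_less [OF that] by (intro pair_mono) (simp_all add: le_def)
      with t obtain s where "finite_table s" "good s" "defd s w \<psi>"
        using good_extend [of t w \<psi>] w by blast
      then show "\<exists>a b n. good (tab a b n) \<and> defd (tab a b n) w \<psi>"
        unfolding finite_table_iff by blast
    qed
  qed
  then show ?thesis using assms by blast
qed

theorem valuation_extension: "\<exists>V. valuation M W R V \<and> v \<subseteq> V"
proof -
  define V where "V = {x. \<exists>w \<psi> r. x = pair M (pair M w \<psi>) r \<and> w \<in> W \<and> (r = \<zero> \<or> r = \<one>) \<and>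
    (\<exists>a b n. good (tab a b n) \<and> tab a b n (pair M w \<psi>) = r)}"
  have V: "pair M (pair M w \<psi>) r \<in> V \<longleftrightarrow> w \<in> W \<and> (r = \<zero> \<or> r = \<one>) \<and>
    (\<exists>a b n. good (tab a b n) \<and> tab a b n (pair M w \<psi>) = r)" for w \<psi> r
    by (auto simp: V_def)
  have V_fun: "is_function M (cross M W Fml) {\<zero>, \<one>} V"
  proof (rule is_functionI)
    show "V \<in> sets" unfolding V_def
      by (intro comprehension arith_intros definable_good_tab definable_fun_tab in_sets)
    show "V \<subseteq> cross M (cross M W Fml) {\<zero>, \<one>}" by (auto simp: V_def)
    fix x assume "x \<in> cross M W Fml"
    then obtain w \<psi> where x: "x = pair M w \<psi>" "w \<in> W" by (auto simp: cross_def)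
    obtain a b n where "good (tab a b n)" "defd (tab a b n) w \<psi>" using good_exists x(2) by blast
    then have "pair M x (tab a b n x) \<in> V" unfolding x(1) V defd_def using x(2) by blast
    moreover have "r = r'" if "pair M x r \<in> V" "pair M x r' \<in> V" for r r'
    proof -
      obtain t t' where "finite_table t" "good t" "t (pair M w \<psi>) = r"
        "finite_table t'" "good t'" "t' (pair M w \<psi>) = r'"
        using \<open>pair M x r \<in> V\<close> \<open>pair M x r' \<in> V\<close> unfolding x(1) V finite_table_iff by blast
      then show ?thesis using good_agree [of t t' w \<psi>] x(2) that unfolding x(1) V defd_def by metis
    qed
    ultimately show "\<exists>!r. pair M x r \<in> V" by blast
  qed
  have app_V: "app M V (pair M w \<psi>) = r \<longleftrightarrow> pair M (pair M w \<psi>) r \<in> V" if "w \<in> W" for w \<psi> r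
    using that by (intro app_iff [OF V_fun]) simp
  \<comment> \<open>A single good table defined at (w, \<psi>) is defined at all direct dependencies
    too, so the truth condition for \<open>V\<close> reduces to the one for that table.\<close>
  have truth: "val M V w \<psi> = \<one> \<longleftrightarrow> truth (app M V) w \<psi>" if w: "w \<in> W" for w \<psi>
  proof -
    obtain t where t: "finite_table t" "good t" "defd t w \<psi>"
      using good_exists [OF w] unfolding finite_table_iff by blast
    have app_t: "app M V (pair M u \<chi>) = t (pair M u \<chi>)" if "u \<in> W" "defd t u \<chi>" for u \<chi>
      unfolding app_V [OF that(1)] V using t(1,2) that unfolding finite_table_iff defd_def by blast
    have "truth (app M V) w \<psi> \<longleftrightarrow> truth t w \<psi>"
      by (rule truth_cong) (simp add: app_t sub_in [OF _ w] goodD(1) [OF t(2) w t(3)])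
    then show ?thesis using goodD(2) [OF t(2) w t(3)] app_t [OF w t(3)] by (simp add: val_def)
  qed
  have v_Prop: "\<psi> \<in> Prop M" if "pair M (pair M w \<psi>) r \<in> v" for w \<psi> r
    using that v by (auto simp: is_function_def)
  have not_Prop: "fbot M \<notin> Prop M" "fimp M \<phi> \<psi> \<notin> Prop M" "fbox M \<phi> \<notin> Prop M" for \<phi> \<psi>
    by (auto simp: Prop_def)
  have not_v: "pair M (pair M w (fbot M)) r \<notin> v" "pair M (pair M w (fimp M \<phi> \<psi>)) r \<notin> v"
    "pair M (pair M w (fbox M \<phi>)) r \<notin> v" for w \<phi> \<psi> r
    using v_Prop not_Prop by blast+
  have zero_or_one: "val M V w \<psi> = \<zero> \<or> val M V w \<psi> = \<one>" if "w \<in> W" for w \<psi>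
    using app_in [OF V_fun, of "pair M w \<psi>"] that by (auto simp: val_def)
  have "valuation M W R V"
    unfolding valuation_def
  proof (intro conjI ballI V_fun)
    fix w \<phi> \<psi> assume w: "w \<in> W"
    have "\<not> truth (app M V) w (fbot M)" by (auto simp: truth_def not_v)
    then show "val M V w (fbot M) = \<zero>" using truth [OF w] zero_or_one [OF w] by metis
    have "val M V w (fimp M \<phi> \<psi>) = \<one> \<longleftrightarrow> (val M V w \<phi> = \<one> \<longrightarrow> val M V w \<psi> = \<one>)"
      unfolding truth [OF w, of "fimp M \<phi> \<psi>"]
      by (auto simp: truth_def val_def not_v)
    then show "val M V w (fimp M \<phi> \<psi>) = diff M \<one> (val M V w \<phi> \<otimes> diff M \<one> (val M V w \<psi>))"
      using zero_or_one [OF w, of \<phi>] zero_or_one [OF w, of \<psi>] zero_or_one [OF w, of "fimp M \<phi> \<psi>"]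
      by (auto simp: diff_one)
    show "val M V w (fbox M \<phi>) = \<one> \<longleftrightarrow> (\<forall>u\<in>W. rel M R w u \<longrightarrow> val M V u \<phi> = \<one>)"
      unfolding truth [OF w]
      by (auto simp: truth_def val_def not_v)
  qed
  moreover have "v \<subseteq> V"
  proof
    fix x assume x: "x \<in> v"
    then obtain w p r where p: "x = pair M (pair M w p) r" "w \<in> W" "p \<in> Prop M" "r = \<zero> \<or> r = \<one>"
      using v by (auto simp: is_function_def cross_def)
    have "truth (app M V) w p \<longleftrightarrow> pair M (pair M w p) \<one> \<in> v"
      using not_Prop p(3) unfolding truth_def by blast
    then have "val M V w p = \<one> \<longleftrightarrow> pair M (pair M w p) \<one> \<in> v" using truth [OF p(2)] by blast
    also have "\<dots> \<longleftrightarrow> r = \<one>"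
      using app_iff [OF v, of "pair M w p"] x p(1-3) mem_cross by metis
    finally have "val M V w p = r" using p(4) zero_or_one [OF p(2), of p] by metis
    then show "x \<in> V" unfolding p(1) val_def app_V [OF p(2)] .
  qed
  ultimately show ?thesis by blast
qed

end

end

section \<open>Iterated modalities and frame correspondence\<close>

context aca begin

lemma valuation_with_extension:
  assumes "frame M W R" "image_finite M W R" "A \<in> sets"
  obtains V p where "valuation M W R V" "\<And>w. w \<in> W \<Longrightarrow> val M V w p = \<one> \<longleftrightarrow> w \<in> A"
proof -
  have "W \<in> sets" using assms(1) by (simp add: frame_def)
  obtain v where v: "is_function M (cross M W (Prop M)) {\<zero>, \<one>} v"
    "\<forall>w\<in>W. \<forall>p\<in>Prop M. pair M (pair M w p) \<one> \<in> v \<longleftrightarrow> w \<in> A"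
    using assignment_exists [OF \<open>W \<in> sets\<close> assms(3)] by blast
  obtain V where V: "valuation M W R V" "v \<subseteq> V"
    using valuation_extension [OF assms(1,2) v(1)] by blast
  define p where "p = \<one> \<oplus> \<one> \<oplus> \<one>"
  have p: "p \<in> Prop M" unfolding p_def by (rule triple_in_Prop)
  have "val M V w p = \<one> \<longleftrightarrow> w \<in> A" if w: "w \<in> W" for w
  proof -
    have "app M v (pair M w p) = \<zero> \<or> app M v (pair M w p) = \<one>"
      using app_in [OF v(1), of "pair M w p"] w p by auto
    moreover have v_iff: "app M v (pair M w p) = r \<longleftrightarrow> pair M (pair M w p) r \<in> v" for r
      using w p by (intro app_iff [OF v(1)]) simp
    ultimately have "val M V w p = app M v (pair M w p)"
      unfolding val_iff [OF V(1) w] using V(2) by blast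
    then show ?thesis using v_iff v(2) w p by simp
  qed
  with V(1) that show ?thesis by blast
qed

text \<open>A code fixes all its later entries as well, so lengthening a sequence requires a new
  code, supplied by \<open>beta_exists\<close>.\<close>

lemma chain_Suc:
  "chain M X Q (n \<oplus> \<one>) u v \<longleftrightarrow> (\<exists>t. chain M X Q n u t \<and> Q t v \<and> v \<in> X)"
proof
  assume "chain M X Q (n \<oplus> \<one>) u v"
  then obtain a b where ab: "\<And>l. l \<prec> n \<oplus> \<one> \<or> l = n \<oplus> \<one> \<Longrightarrow> beta M a b l \<in> X"
    "beta M a b \<zero> = u" "beta M a b (n \<oplus> \<one>) = v"
    "\<And>l. l \<prec> n \<oplus> \<one> \<Longrightarrow> Q (beta M a b l) (beta M a b (l \<oplus> \<one>))"
    unfolding chain_def by blast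
  have "chain M X Q n u (beta M a b n)"
    unfolding chain_def using ab unfolding less_add_one_iff by (intro exI [of _ a] exI [of _ b]) simp
  then show "\<exists>t. chain M X Q n u t \<and> Q t v \<and> v \<in> X"
    using ab(1,3) ab(4) [of n] unfolding less_add_one_iff by blast
next
  assume "\<exists>t. chain M X Q n u t \<and> Q t v \<and> v \<in> X"
  then obtain t a b where t: "Q t v" "v \<in> X" and ab: "\<And>l. l \<prec> n \<or> l = n \<Longrightarrow> beta M a b l \<in> X"
    "beta M a b \<zero> = u" "beta M a b n = t"
    "\<And>l. l \<prec> n \<Longrightarrow> Q (beta M a b l) (beta M a b (l \<oplus> \<one>))"
    unfolding chain_def by blast
  define g where "g i = (if i \<preceq> n then beta M a b i else v)" for i
  have "definable_fun (\<lambda>e. g (e 0))" unfolding g_def by (intro definable_fun_if definable_fun_beta arith_intros)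
  \<comment> \<open>Positions 0 to n + 1 have to be coded, so the exclusive bound is n + 2.\<close>
  then obtain a' b' where a'b': "\<And>i. i \<prec> n \<oplus> \<one> \<oplus> \<one> \<Longrightarrow> beta M a' b' i = g i"
    using beta_exists [of g "n \<oplus> \<one> \<oplus> \<one>"] by blast
  have old: "beta M a' b' i = beta M a b i" if "i \<preceq> n" for i
  proof -
    have "i \<prec> n \<oplus> \<one>" using that by (simp only: less_add_one)
    then have "i \<prec> n \<oplus> \<one> \<oplus> \<one>" by (simp only: less_add_one_iff [of i "n \<oplus> \<one>"] simp_thms)
    then show ?thesis using a'b' that by (simp add: g_def)
  qed
  have "\<not> n \<oplus> \<one> \<preceq> n" by (simp add: add_one_le)
  then have new: "beta M a' b' (n \<oplus> \<one>) = v"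
    using a'b' [of "n \<oplus> \<one>"] by (simp add: g_def less_add_one)
  have "beta M a' b' l \<in> X" if "l \<prec> n \<oplus> \<one> \<or> l = n \<oplus> \<one>" for l
    using that t(2) ab(1) [of l] old [of l] new unfolding less_add_one le_def by metis
  moreover have "Q (beta M a' b' l) (beta M a' b' (l \<oplus> \<one>))" if "l \<prec> n \<oplus> \<one>" for l
  proof (cases "l = n")
    case True
    then show ?thesis using old [of n] new t(1) ab(3) by simp
  next
    case False
    then have "l \<prec> n" using that unfolding less_add_one_iff by blast
    then have "l \<preceq> n" "l \<oplus> \<one> \<preceq> n" by (simp_all add: add_one_le)
    then show ?thesis using old ab(4) \<open>l \<prec> n\<close> by simp
  qed
  moreover have "beta M a' b' \<zero> = u" using old [of \<zero>] ab(2) by simp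
  ultimately show "chain M X Q (n \<oplus> \<one>) u v"
    unfolding chain_def using new by blast
qed

lemma definable_chain:
  assumes "\<And>f. definable_fun f \<Longrightarrow> definable (\<lambda>e. f e \<in> X)" "\<And>f g. definable_fun f \<Longrightarrow> definable_fun g \<Longrightarrow> definable (\<lambda>e. Q (f e) (g e))"
    "definable_fun n" "definable_fun u" "definable_fun v"
  shows "definable (\<lambda>e. chain M X Q (n e) (u e) (v e))"
  by (rule definable_subst3 [OF _ assms(3-5)], unfold chain_def) (intro arith_intros definable_fun_beta assms(1,2))

lemma definable_reach:
  assumes "W \<in> sets" "R \<in> sets" "definable_fun n" "definable_fun u" "definable_fun v"
  shows "definable (\<lambda>e. reach M W R (n e) (u e) (v e))"
  unfolding reach_def by (intro definable_chain assms definable_atoms) 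

lemma reach_in: assumes "reach M W R n u v" shows "u \<in> W" "v \<in> W"
  using assms zero_le [of n] unfolding reach_def chain_def le_def by metis+

lemma reach_zero: "reach M W R \<zero> u v \<longleftrightarrow> u = v \<and> u \<in> W"
  by (simp add: reach_def chain_zero)

lemma reach_Suc: "reach M W R (n \<oplus> \<one>) u v \<longleftrightarrow> (\<exists>t. reach M W R n u t \<and> rel M R t v \<and> v \<in> W)"
  by (simp add: reach_def chain_Suc)

lemma rel_in: "frame M W R \<Longrightarrow> rel M R u v \<Longrightarrow> u \<in> W \<and> v \<in> W"
  unfolding frame_def rel_def using mem_cross by blast

text \<open>\<open>reach_Suc\<close> splits off the last step, but evaluating an iterated modality
  at a world splits off the first. The end point stays quantified in the induction.\<close>

lemma reach_Suc_first:
  assumes frame: "frame M W R"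
  shows "reach M W R (n \<oplus> \<one>) u v \<longleftrightarrow> (\<exists>t. rel M R u t \<and> reach M W R n t v)"
proof -
  have sets: "W \<in> sets" "R \<in> sets" using frame by (auto simp: frame_def)
  have "\<forall>v. reach M W R (n \<oplus> \<one>) u v \<longleftrightarrow> (\<exists>t. rel M R u t \<and> reach M W R n t v)"
  proof (rule bounded_induct [where x=n and P="\<lambda>n. \<forall>v. reach M W R (n \<oplus> \<one>) u v \<longleftrightarrow> (\<exists>t. rel M R u t \<and> reach M W R n t v)"])
    show "definable (\<lambda>e. \<forall>v. reach M W R (e 0 \<oplus> \<one>) u v \<longleftrightarrow> (\<exists>t. rel M R u t \<and> reach M W R (e 0) t v))"
      by (intro arith_intros definable_reach sets)
    show "\<forall>v. reach M W R (\<zero> \<oplus> \<one>) u v \<longleftrightarrow> (\<exists>t. rel M R u t \<and> reach M W R \<zero> t v)"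
      unfolding reach_Suc reach_zero using rel_in [OF frame] by blast
  next
    fix n assume "\<forall>v. reach M W R (n \<oplus> \<one>) u v \<longleftrightarrow> (\<exists>t. rel M R u t \<and> reach M W R n t v)"
    then show "\<forall>v. reach M W R (n \<oplus> \<one> \<oplus> \<one>) u v \<longleftrightarrow> (\<exists>t. rel M R u t \<and> reach M W R (n \<oplus> \<one>) t v)"
      unfolding reach_Suc [of W R "n \<oplus> \<one>"] reach_Suc [of W R n] by blast
  qed
  then show ?thesis by blast
qed

text \<open>The common form of \<open>fbox_pow\<close> and \<open>fdia_pow\<close>; it also iterates
  the choice of successors in an ascending sequence.\<close>

definition iter :: "('a \<Rightarrow> 'a) \<Rightarrow> 'a \<Rightarrow> 'a \<Rightarrow> 'a" where
  "iter F n x = (THE y. chain M Fml (\<lambda>x y. y = F x) n x y)"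

context
  fixes F assumes F: "definable_fun (\<lambda>e. F (e 0))"
begin

lemma definable_iter_chain: "definable_fun n \<Longrightarrow> definable_fun u \<Longrightarrow> definable_fun v \<Longrightarrow> definable (\<lambda>e. chain M Fml (\<lambda>x y. y = F x) (n e) (u e) (v e))"
  by (rule definable_chain) (auto intro: definable_const definable_atoms definable_fun_subst1 [OF F])

lemma iter_chain: "chain M Fml (\<lambda>x y. y = F x) n x y \<longleftrightarrow> iter F n x = y"
proof -
  have "\<exists>!y. chain M Fml (\<lambda>x y. y = F x) n x y"
    unfolding Ex1_def
  proof (rule bounded_induct [where x=n and P="\<lambda>n. \<exists>y. chain M Fml (\<lambda>x y. y = F x) n x y \<and>
      (\<forall>z. chain M Fml (\<lambda>x y. y = F x) n x z \<longrightarrow> z = y)"])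
    show "definable (\<lambda>e. \<exists>y. chain M Fml (\<lambda>x y. y = F x) (e 0) x y \<and>
      (\<forall>z. chain M Fml (\<lambda>x y. y = F x) (e 0) x z \<longrightarrow> z = y))"
      by (intro arith_intros definable_iter_chain)
  qed (auto simp: chain_zero chain_Suc)
  from theI' [OF this] the1_equality [OF this] show ?thesis unfolding iter_def by blast
qed

lemma iter_zero: "iter F \<zero> x = x"
  unfolding iter_chain [symmetric] by (simp add: chain_zero)

lemma iter_Suc: "iter F (n \<oplus> \<one>) x = F (iter F n x)"
  unfolding iter_chain [symmetric] chain_Suc by (auto simp: iter_chain)

lemma definable_fun_iter: "definable_fun n \<Longrightarrow> definable_fun u \<Longrightarrow> definable_fun (\<lambda>e. iter F (n e) (u e))"
proof (rule definable_fun_subst2 [where F="iter F"])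
  have "definable (\<lambda>e. iter F (e (Suc 0)) (e (Suc (Suc 0))) = e 0)"
    unfolding iter_chain [symmetric] by (intro definable_iter_chain arith_intros)
  then show "definable_fun (\<lambda>e. iter F (e 0) (e (Suc 0)))" unfolding definable_fun_def by (simp add: eq_commute)
qed (assumption+)

end

lemma definable_fun_fdia: "definable_fun f \<Longrightarrow> definable_fun (\<lambda>e. fdia M (f e))"
  unfolding fdia_def fneg_def by (intro arith_intros)

lemma definable_fun_fbox_fun: "definable_fun (\<lambda>e. fbox M (e 0))" and definable_fun_fdia_fun: "definable_fun (\<lambda>e. fdia M (e 0))"
  by (intro arith_intros definable_fun_fdia)+

lemma fbox_pow_iter: "fbox_pow M = iter (fbox M)" and fdia_pow_iter: "fdia_pow M = iter (fdia M)"
  by (simp_all add: fun_eq_iff fbox_pow_def fdia_pow_def iter_def)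

lemma val_fbox_pow:
  assumes frame: "frame M W R" and V: "valuation M W R V" and "w \<in> W"
  shows "val M V w (fbox_pow M n \<phi>) = \<one> \<longleftrightarrow> (\<forall>u. reach M W R n w u \<longrightarrow> val M V u \<phi> = \<one>)"
proof -
  have sets: "W \<in> sets" "R \<in> sets" "V \<in> sets"
    using frame V by (auto simp: frame_def valuation_def is_function_def)
  \<comment> \<open>Membership in the set \<open>V\<close> in place of \<open>val\<close> avoids a
    \<open>THE\<close> and keeps the induction predicate arithmetical.\<close>
  let ?true = "\<lambda>w \<psi>. pair M (pair M w \<psi>) \<one> \<in> V"
  have "\<forall>w. w \<in> W \<longrightarrow> (?true w (iter (fbox M) n \<phi>) \<longleftrightarrow> (\<forall>u. reach M W R n w u \<longrightarrow> ?true u \<phi>))"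
  proof (rule bounded_induct [where x=n and P="\<lambda>n. \<forall>w. w \<in> W \<longrightarrow>
      (?true w (iter (fbox M) n \<phi>) \<longleftrightarrow> (\<forall>u. reach M W R n w u \<longrightarrow> ?true u \<phi>))"])
    show "definable (\<lambda>e. \<forall>w. w \<in> W \<longrightarrow> (?true w (iter (fbox M) (e 0) \<phi>) \<longleftrightarrow> (\<forall>u. reach M W R (e 0) w u \<longrightarrow> ?true u \<phi>)))"
      by (intro arith_intros definable_reach definable_fun_iter [OF definable_fun_fbox_fun] sets)
    show "\<forall>w. w \<in> W \<longrightarrow> (?true w (iter (fbox M) \<zero> \<phi>) \<longleftrightarrow> (\<forall>u. reach M W R \<zero> w u \<longrightarrow> ?true u \<phi>))"
      by (simp add: iter_zero [OF definable_fun_fbox_fun] reach_zero)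
  next
    fix n
    assume IH: "\<forall>w. w \<in> W \<longrightarrow> (?true w (iter (fbox M) n \<phi>) \<longleftrightarrow> (\<forall>u. reach M W R n w u \<longrightarrow> ?true u \<phi>))"
    have "?true w (fbox M \<psi>) \<longleftrightarrow> (\<forall>u. rel M R w u \<longrightarrow> ?true u \<psi>)" if "w \<in> W" for w \<psi>
      using val_box [OF V that, of \<psi>] val_iff [OF V] rel_in [OF frame] that by metis
    then show "\<forall>w. w \<in> W \<longrightarrow> (?true w (iter (fbox M) (n \<oplus> \<one>) \<phi>) \<longleftrightarrow> (\<forall>u. reach M W R (n \<oplus> \<one>) w u \<longrightarrow> ?true u \<phi>))"
      unfolding iter_Suc [OF definable_fun_fbox_fun] reach_Suc_first [OF frame]
      using IH rel_in [OF frame] by metis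
  qed
  then show ?thesis
    unfolding fbox_pow_iter using val_iff [OF V] reach_in assms(3) by metis
qed

lemma val_fdia_pow:
  assumes frame: "frame M W R" and V: "valuation M W R V" and "w \<in> W"
  shows "val M V w (fdia_pow M n \<phi>) = \<one> \<longleftrightarrow> (\<exists>u. reach M W R n w u \<and> val M V u \<phi> = \<one>)"
proof -
  have sets: "W \<in> sets" "R \<in> sets" "V \<in> sets"
    using frame V by (auto simp: frame_def valuation_def is_function_def)
  let ?true = "\<lambda>w \<psi>. pair M (pair M w \<psi>) \<one> \<in> V"
  have "\<forall>w. w \<in> W \<longrightarrow> (?true w (iter (fdia M) n \<phi>) \<longleftrightarrow> (\<exists>u. reach M W R n w u \<and> ?true u \<phi>))"
  proof (rule bounded_induct [where x=n and P="\<lambda>n. \<forall>w. w \<in> W \<longrightarrow>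
      (?true w (iter (fdia M) n \<phi>) \<longleftrightarrow> (\<exists>u. reach M W R n w u \<and> ?true u \<phi>))"])
    show "definable (\<lambda>e. \<forall>w. w \<in> W \<longrightarrow> (?true w (iter (fdia M) (e 0) \<phi>) \<longleftrightarrow> (\<exists>u. reach M W R (e 0) w u \<and> ?true u \<phi>)))"
      by (intro arith_intros definable_reach definable_fun_iter [OF definable_fun_fdia_fun] sets)
    show "\<forall>w. w \<in> W \<longrightarrow> (?true w (iter (fdia M) \<zero> \<phi>) \<longleftrightarrow> (\<exists>u. reach M W R \<zero> w u \<and> ?true u \<phi>))"
      by (simp add: iter_zero [OF definable_fun_fdia_fun] reach_zero)
  next
    fix n
    assume IH: "\<forall>w. w \<in> W \<longrightarrow> (?true w (iter (fdia M) n \<phi>) \<longleftrightarrow> (\<exists>u. reach M W R n w u \<and> ?true u \<phi>))"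
    have "?true w (fdia M \<psi>) \<longleftrightarrow> (\<exists>u. rel M R w u \<and> ?true u \<psi>)" if "w \<in> W" for w \<psi>
      using val_dia [OF V that, of \<psi>] val_iff [OF V] rel_in [OF frame] that by metis
    then show "\<forall>w. w \<in> W \<longrightarrow> (?true w (iter (fdia M) (n \<oplus> \<one>) \<phi>) \<longleftrightarrow> (\<exists>u. reach M W R (n \<oplus> \<one>) w u \<and> ?true u \<phi>))"
      unfolding iter_Suc [OF definable_fun_fdia_fun] reach_Suc_first [OF frame]
      using IH rel_in [OF frame] by metis
  qed
  then show ?thesis
    unfolding fdia_pow_iter using val_iff [OF V] reach_in assms(3) by metis
qed

section \<open>Frame conditions and the formulas expressing them\<close>

lemma forces_impD:
  assumes "forces M W R (fimp M \<phi> \<psi>)" "valuation M W R V" "w \<in> W" "val M V w \<phi> = \<one>"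
  shows "val M V w \<psi> = \<one>"
proof -
  have "val M V w (fimp M \<phi> \<psi>) = \<one>" using assms(1-3) by (simp add: forces_def)
  then show ?thesis using assms(4) unfolding val_imp [OF assms(2,3)] by simp
qed

theorem confluence_correspondence:
  assumes frame: "frame M W R" and "image_finite M W R"
  shows "(\<forall>x\<in>W. \<forall>y\<in>W. \<forall>z\<in>W. reach M W R i x y \<and> reach M W R j x z \<longrightarrow>
      (\<exists>u\<in>W. reach M W R m y u \<and> reach M W R n z u)) \<longleftrightarrow>
    (\<forall>\<phi>\<in>Fml. forces M W R (fimp M (fdia_pow M i (fbox_pow M m \<phi>)) (fbox_pow M j (fdia_pow M n \<phi>))))"
    (is "?confluent \<longleftrightarrow> ?valid")
proof
  assume confluent: ?confluent
  show ?valid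
    unfolding forces_def
  proof (intro ballI allI impI)
    fix \<phi> V x assume V: "valuation M W R V" and x: "x \<in> W"
    note pow = val_fbox_pow [OF frame V] val_fdia_pow [OF frame V]
    show "val M V x (fimp M (fdia_pow M i (fbox_pow M m \<phi>)) (fbox_pow M j (fdia_pow M n \<phi>))) = \<one>"
      unfolding val_imp [OF V x] pow [OF x]
    proof (intro impI allI)
      fix z assume "\<exists>y. reach M W R i x y \<and> val M V y (fbox_pow M m \<phi>) = \<one>" and z: "reach M W R j x z"
      then obtain y where y: "reach M W R i x y" "val M V y (fbox_pow M m \<phi>) = \<one>" by blast
      then obtain u where u: "reach M W R m y u" "reach M W R n z u"
        using confluent x z reach_in by meson
      then have "val M V u \<phi> = \<one>" using y pow(1) reach_in by metis
      then show "val M V z (fdia_pow M n \<phi>) = \<one>" using u(2) pow(2) reach_in by metis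
    qed
  qed
next
  assume valid: ?valid
  show ?confluent
  proof (intro ballI impI, elim conjE)
    fix x y z assume x: "x \<in> W" and y: "y \<in> W" and z: "z \<in> W"
      and xy: "reach M W R i x y" and xz: "reach M W R j x z"
    \<comment> \<open>The least truth set for which the m-fold box of p holds at y. A p-world that z
      reaches in n steps is then the common world wanted.\<close>
    have "{u. reach M W R m y u} \<in> sets"
      using frame by (intro comprehension definable_reach arith_intros) (auto simp: frame_def)
    then obtain V p where V: "valuation M W R V"
      and p: "\<And>w. w \<in> W \<Longrightarrow> val M V w p = \<one> \<longleftrightarrow> reach M W R m y w"
      using valuation_with_extension [OF assms] by (metis mem_Collect_eq)
    note pow = val_fbox_pow [OF frame V] val_fdia_pow [OF frame V]
    have "val M V y (fbox_pow M m p) = \<one>" unfolding pow(1) [OF y] using p reach_in by blast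
    then have "val M V x (fdia_pow M i (fbox_pow M m p)) = \<one>" unfolding pow(2) [OF x] using xy by blast
    then have "val M V x (fbox_pow M j (fdia_pow M n p)) = \<one>"
      by (rule forces_impD [OF valid [rule_format, OF Fml] V x])
    then have "val M V z (fdia_pow M n p) = \<one>" unfolding pow(1) [OF x] using xz by blast
    then obtain u where "reach M W R n z u" "val M V u p = \<one>" unfolding pow(2) [OF z] by blast
    then show "\<exists>u\<in>W. reach M W R m y u \<and> reach M W R n z u" using p reach_in by blast
  qed
qed

text \<open>Always moving to the least successor in \<open>A\<close> replaces dependent choice.
  Outside \<open>A\<close> the step function is the identity, so that it is total.\<close>

lemma ascending_sequence_exists:
  assumes frame: "frame M W R" and A: "A \<in> sets" "A \<subseteq> W" "x \<in> A"
    and step: "\<And>x. x \<in> A \<Longrightarrow> \<exists>y\<in>A. rel M R x y"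
  shows "\<exists>f. ascending_sequence M W R f"
proof -
  have "R \<in> sets" using frame by (simp add: frame_def)
  define S where "S x y \<longleftrightarrow> y \<in> A \<and> rel M R x y \<and> (\<forall>z. z \<prec> y \<longrightarrow> \<not> (z \<in> A \<and> rel M R x z))" for x y
  define F where "F x = (if x \<in> A then THE y. S x y else x)" for x
  have S_ex: "\<exists>y. S x y" if "x \<in> A" for x
    unfolding S_def using step [OF that] least_exists [of "\<lambda>y. y \<in> A \<and> rel M R x y"]
      definable_conj [OF definable_atoms(3) [OF A(1) definable_fun_var] definable_atoms(4) [OF \<open>R \<in> sets\<close> definable_fun_const definable_fun_var]] by blast
  moreover have S_unique: "y = z" if "S x y" "S x z" for x y z
    using that unfolding S_def by (metis ar.linorder_cases)
  ultimately have S_F: "y = F x \<longleftrightarrow> S x y" if "x \<in> A" for x y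
    using that unfolding F_def by (metis theI)
  have "definable (\<lambda>e. (e (Suc 0) \<in> A \<longrightarrow> S (e (Suc 0)) (e 0)) \<and> (e (Suc 0) \<notin> A \<longrightarrow> e 0 = e (Suc 0)))"
    unfolding S_def by (intro arith_intros A(1) \<open>R \<in> sets\<close>)
  moreover have "(\<lambda>e. (e (Suc 0) \<in> A \<longrightarrow> S (e (Suc 0)) (e 0)) \<and> (e (Suc 0) \<notin> A \<longrightarrow> e 0 = e (Suc 0)))
    = (\<lambda>e. e 0 = F (e (Suc 0)))"
    using S_F F_def by (intro ext) metis
  ultimately have definable_fun_F: "definable_fun (\<lambda>e. F (e 0))" unfolding definable_fun_def by simp
  define a where "a n = iter F n x" for n
  have a_in: "a n \<in> A" for n
  proof (rule bounded_induct [where P="\<lambda>n. a n \<in> A"])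
    show "definable (\<lambda>e. a (e 0) \<in> A)" unfolding a_def by (intro arith_intros definable_fun_iter [OF definable_fun_F] A(1))
    show "a \<zero> \<in> A" unfolding a_def iter_zero [OF definable_fun_F] by (rule A(3))
    show "a (n \<oplus> \<one>) \<in> A" if "a n \<in> A" for n
      using S_F [OF that] unfolding a_def iter_Suc [OF definable_fun_F] S_def by blast
  qed
  define f where "f = {p. \<exists>n. p = pair M n (a n)}"
  have f: "pair M n y \<in> f \<longleftrightarrow> y = a n" for n y by (auto simp: f_def)
  have f_fun: "is_function M UNIV W f"
  proof (rule is_functionI)
    show "f \<in> sets" unfolding f_def a_def
      by (intro comprehension arith_intros definable_fun_iter [OF definable_fun_F])
    show "f \<subseteq> cross M UNIV W" using subsetD [OF A(2) a_in] by (auto simp: f_def)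
  qed (simp add: f)
  have "app M f n = a n" for n using app_iff [OF f_fun] f by blast
  moreover have "rel M R (a n) (a (n \<oplus> \<one>))" for n
    using S_F [OF a_in, of _ n] unfolding a_def iter_Suc [OF definable_fun_F] S_def by blast
  ultimately show ?thesis unfolding ascending_sequence_def using f_fun by auto
qed

theorem loeb_correspondence:
  assumes frame: "frame M W R" and "image_finite M W R"
  shows "transitive M W R \<and> (\<nexists>f. ascending_sequence M W R f) \<longleftrightarrow>
    (\<forall>\<phi>\<in>Fml. forces M W R (fimp M (fbox M (fimp M (fbox M \<phi>) \<phi>)) (fbox M \<phi>)))"
    (is "?L \<longleftrightarrow> ?valid")
proof
  assume L: ?L
  show ?valid
    unfolding forces_def
  proof (intro ballI allI impI)
    fix \<phi> V w assume V: "valuation M W R V" and w: "w \<in> W"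
    have sets: "W \<in> sets" "R \<in> sets" "V \<in> sets"
      using frame V by (auto simp: frame_def valuation_def is_function_def)
    show "val M V w (fimp M (fbox M (fimp M (fbox M \<phi>) \<phi>)) (fbox M \<phi>)) = \<one>"
      unfolding val_imp [OF V w]
    proof (intro impI, rule ccontr)
      assume loeb: "val M V w (fbox M (fimp M (fbox M \<phi>) \<phi>)) = \<one>" and "val M V w (fbox M \<phi>) \<noteq> \<one>"
      \<comment> \<open>Worlds seen from w that refute \<phi>. The boxed premise gives each a
        successor refuting \<phi>, and transitivity puts that successor back into
        \<open>A\<close>.\<close>
      define A where "A = {u. u \<in> W \<and> rel M R w u \<and> \<not> pair M (pair M u \<phi>) \<one> \<in> V}"
      have A: "u \<in> A \<longleftrightarrow> u \<in> W \<and> rel M R w u \<and> val M V u \<phi> \<noteq> \<one>" for u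
        unfolding A_def using val_iff [OF V] by blast
      have "\<exists>u'\<in>A. rel M R u u'" if "u \<in> A" for u
      proof -
        have u: "u \<in> W" "rel M R w u" "val M V u \<phi> \<noteq> \<one>" using that A by blast+
        then have "val M V u (fimp M (fbox M \<phi>) \<phi>) = \<one>" using loeb val_box [OF V w] by blast
        then have "val M V u (fbox M \<phi>) \<noteq> \<one>" using u(3) val_imp [OF V u(1)] by blast
        then obtain u' where "u' \<in> W" "rel M R u u'" "val M V u' \<phi> \<noteq> \<one>"
          using val_box [OF V u(1)] by blast
        moreover from this have "rel M R w u'"
          using L u(1,2) w unfolding transitive_def by blast
        ultimately show ?thesis using A by blast
      qed
      moreover obtain u where "u \<in> A"
        using \<open>val M V w (fbox M \<phi>) \<noteq> \<one>\<close> val_box [OF V w] A by blast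
      moreover have "A \<in> sets" unfolding A_def by (intro comprehension arith_intros sets)
      moreover have "A \<subseteq> W" by (auto simp: A_def)
      ultimately show False using ascending_sequence_exists [OF frame] L by blast
    qed
  qed
next
  assume valid: ?valid
  \<comment> \<open>Contrapositive of the formula at a variable with truth set \<open>A\<close>:
    among the worlds outside \<open>A\<close> that x sees, one sees no further world outside
    \<open>A\<close>.\<close>
  have loeb: "\<exists>u\<in>W. rel M R x u \<and> u \<notin> A \<and> (\<forall>t\<in>W. rel M R u t \<longrightarrow> t \<in> A)"
    if A: "A \<in> sets" and x: "x \<in> W" and y: "y \<in> W" "rel M R x y" "y \<notin> A" for A x y
  proof (rule ccontr)
    assume none: "\<not> ?thesis"
    obtain V p where V: "valuation M W R V"
      and p: "\<And>w. w \<in> W \<Longrightarrow> val M V w p = \<one> \<longleftrightarrow> w \<in> A"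
      using valuation_with_extension [OF assms A] by blast
    have "val M V u (fimp M (fbox M p) p) = \<one>" if "u \<in> W" "rel M R x u" for u
      unfolding val_imp [OF V that(1)] val_box [OF V that(1)] using none that p by blast
    then have "val M V x (fbox M (fimp M (fbox M p) p)) = \<one>" using val_box [OF V x] by blast
    then have "val M V x (fbox M p) = \<one>"
      by (rule forces_impD [OF valid [rule_format, OF Fml] V x])
    then show False using y p val_box [OF V x] by blast
  qed
  have "transitive M W R"
    unfolding transitive_def
  proof (intro ballI impI, rule ccontr)
    fix x y z assume W: "x \<in> W" "y \<in> W" "z \<in> W" and rel: "rel M R x y" "rel M R y z" "\<not> rel M R x z"
    \<comment> \<open>Only y and z lie outside this set. Since x does not see z, the world found
      must be y, yet y sees z.\<close>
    have "{u. u \<noteq> y \<and> u \<noteq> z} \<in> sets" by (intro comprehension arith_intros)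
    from loeb [OF this W(1,2) rel(1)] show False using rel W by auto
  qed
  moreover have False if f: "ascending_sequence M W R f" for f
  proof -
    have f_fun: "is_function M UNIV W f" and asc: "\<And>i. rel M R (app M f i) (app M f (i \<oplus> \<one>))"
      using f by (auto simp: ascending_sequence_def)
    have "f \<in> sets" using f_fun by (simp add: is_function_def)
    \<comment> \<open>The complement of the range of \<open>f\<close>, a set by arithmetical
      comprehension. Each world in the range sees the next value of \<open>f\<close>, again in the
      range.\<close>
    then have "{u. \<forall>i. pair M i u \<notin> f} \<in> sets" by (intro comprehension arith_intros)
    from loeb [OF this, of "app M f \<zero>" "app M f (\<zero> \<oplus> \<one>)"]
    obtain u where u: "\<not> (\<forall>i. pair M i u \<notin> f)" "\<forall>t\<in>W. rel M R u t \<longrightarrow> (\<forall>i. pair M i t \<notin> f)"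
      using asc app_in [OF f_fun] app_iff [OF f_fun] by blast
    then obtain i where "pair M i u \<in> f" by blast
    then have "u = app M f i" using app_iff [OF f_fun, of i u] by simp
    then show False using u(2) asc [of i] app_in [OF f_fun] app_iff [OF f_fun] by blast
  qed
  ultimately show ?L by blast
qed

end

theorem theorem2p27:
  fixes M :: "'a l2"
  defines "stmt1 \<equiv> ACA0 M"
  defines "stmt2 \<equiv> (\<forall>W R v. frame M W R \<and> image_finite M W R \<and>
      is_function M (cross M W (Prop M)) {\<zero>\<^bsub>M\<^esub>, \<one>\<^bsub>M\<^esub>} v \<longrightarrow>
      (\<exists>V. valuation M W R V \<and> v \<subseteq> V))"
  defines "stmt3 \<equiv> (\<forall>W R. frame M W R \<and> image_finite M W R \<longrightarrow>
      (\<forall>i j m n. \<not> (i = \<zero>\<^bsub>M\<^esub> \<and> n = \<zero>\<^bsub>M\<^esub>) \<and> \<not> (m = \<zero>\<^bsub>M\<^esub> \<and> j = \<zero>\<^bsub>M\<^esub>) \<longrightarrow>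
        ((\<forall>x\<in>W. \<forall>y\<in>W. \<forall>z\<in>W. reach M W R i x y \<and> reach M W R j x z \<longrightarrow>
            (\<exists>u\<in>W. reach M W R m y u \<and> reach M W R n z u))
         \<longleftrightarrow>
         (\<forall>\<phi>\<in>Fml. forces M W R
            (fimp M (fdia_pow M i (fbox_pow M m \<phi>)) (fbox_pow M j (fdia_pow M n \<phi>)))))))"
  defines "stmt4 \<equiv> (\<forall>W R. frame M W R \<and> image_finite M W R \<longrightarrow>
      (transitive M W R \<and> (\<nexists>f. ascending_sequence M W R f)
       \<longleftrightarrow>
       (\<forall>\<phi>\<in>Fml. forces M W R
          (fimp M (fbox M (fimp M (fbox M \<phi>) \<phi>)) (fbox M \<phi>)))))"
  defines "stmt5 \<equiv> (\<forall>W R. frame M W R \<and> image_finite M W R \<longrightarrow> (\<exists>V. valuation M W R V))"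
  assumes "RCA0 M"
  shows "(stmt1 \<longleftrightarrow> stmt2) \<and> (stmt1 \<longleftrightarrow> stmt3) \<and> (stmt1 \<longleftrightarrow> stmt4) \<and> (stmt1 \<longleftrightarrow> stmt5)"
proof -
  interpret rca M by unfold_locales fact
  have "stmt2 \<and> stmt3 \<and> stmt4" if stmt1
  proof -
    interpret aca M using that unfolding stmt1_def by (rule aca_if_ACA0)
    show ?thesis
      unfolding stmt2_def stmt3_def stmt4_def
      using valuation_extension confluence_correspondence loeb_correspondence by simp
  qed
  moreover have stmt5 if stmt2
    unfolding stmt5_def
  proof (intro allI impI, elim conjE)
    fix W R assume W: "frame M W R" "image_finite M W R"
    then have "W \<in> sets" by (simp add: frame_def)
    then obtain v where "is_function M (cross M W (Prop M)) {\<zero>\<^bsub>M\<^esub>, \<one>\<^bsub>M\<^esub>} v"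
      using assignment_exists by blast
    then show "\<exists>V. valuation M W R V" using W that unfolding stmt2_def by blast
  qed
  moreover have stmt1 if stmt5
    unfolding stmt1_def by (rule ACA0_if_valuations) (use that in \<open>simp add: stmt5_def\<close>)
  moreover have stmt1 if stmt4
    unfolding stmt1_def
  proof (rule ACA0_if_valuations)
    fix R assume R: "frame M UNIV R" "image_finite M UNIV R" "\<not> transitive M UNIV R"
    then have "\<not> (\<forall>\<phi>\<in>Fml. forces M UNIV R (fimp M (fbox M (fimp M (fbox M \<phi>) \<phi>)) (fbox M \<phi>)))"
      using that unfolding stmt4_def by blast
    then show "\<exists>V. valuation M UNIV R V" unfolding forces_def by blast
  qed
  moreover have stmt1 if stmt3
    unfolding stmt1_def
  proof (rule ACA0_if_valuations)
    fix R assume R: "frame M UNIV R" "image_finite M UNIV R" "\<exists>w. \<forall>u. \<not> rel M R w u"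
    let ?z = "\<zero>\<^bsub>M\<^esub>" and ?o = "\<one>\<^bsub>M\<^esub>"
    obtain w where w: "\<And>u. \<not> rel M R w u" using R(3) by blast
    have "reach M UNIV R ?z w w" by (simp add: reach_def chain_zero)
    moreover have "\<not> reach M UNIV R ?o w u" for u unfolding reach_def using chain_oneD w by metis
    ultimately have "\<not> (\<forall>x\<in>UNIV. \<forall>y\<in>UNIV. \<forall>z\<in>UNIV. reach M UNIV R ?z x y \<and> reach M UNIV R ?z x z \<longrightarrow>
      (\<exists>u\<in>UNIV. reach M UNIV R ?o y u \<and> reach M UNIV R ?o z u))" by blast
    \<comment> \<open>For i = j = 0 and m = n = 1 the frame condition amounts to seriality, which
      fails at \<open>w\<close>. The instances below come in the order i, n, m, j in which the side
      condition mentions them.\<close>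
    then have "\<not> (\<forall>\<phi>\<in>Fml. forces M UNIV R
      (fimp M (fdia_pow M ?z (fbox_pow M ?o \<phi>)) (fbox_pow M ?z (fdia_pow M ?o \<phi>))))"
      using that [unfolded stmt3_def, rule_format, of UNIV R ?z ?o ?o ?z] R(1,2) zero_neq_one by blast
    then show "\<exists>V. valuation M UNIV R V" unfolding forces_def by blast
  qed
  ultimately show ?thesis by blast
qed

end
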